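(* Let $R$ be a $\mathbb{Z}$-graded ring and let $C$ be a colimit preserving and grading shift preserving comonad on $\mathsf{Mod}^{\mathbb{Z}}R$. Then $C(R)$ is a graded coring, and $C$ is naturally isomorphic to $-\otimes_R C(R)$ as a comonad. The category $\mathsf{Comod}\,C$ of comodules over the comonad $C$ is equivalent to the category $\mathsf{Comod}^{\mathbb{Z}}_R\,C(R)$ of $R$-linear graded comodules over the coring $C(R)$.
   Context: $\mathsf{Mod}^{\mathbb{Z}}R$ is the category of $\mathbb{Z}$-graded right $R$-modules with degree-preserving maps, and $(1)$ is its grading shift autoequivalence. It is canonically enriched over graded abelian groups via $\hom_R(M,N)=\bigoplus_{i\in\mathbb{Z}}\mathrm{Hom}_R(M,N(i))$. A comonad $C$ preserves the grading shift if it commutes with $(1)$; such an (additive) $C$ is regarded as canonically lifted to an enriched comonad on the enriched category. A graded coring (over $R$) is a comonoid in the monoidal category of graded $R$-$R$-bimodules under $\otimes_R$. The left $R$-action on $C(R)$ is given by the map $R=\hom_R(R,R)\to\hom_R(C(R),C(R))$ coming from the enrichment. *)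

theory Defs
  imports "HOL-Algebra.Ring" "HOL-Algebra.Free_Abelian_Groups"
begin

section \<open>Categories, functors and natural transformations\<close>

record ('o, 'a) cat =
  Obj :: "'o set"
  Arr :: "'a set"
  Dom :: "'a \<Rightarrow> 'o"
  Cod :: "'a \<Rightarrow> 'o"
  Id :: "'o \<Rightarrow> 'a"
  Comp :: "'a \<Rightarrow> 'a \<Rightarrow> 'a" (infixl "\<bullet>\<index>" 70)

definition Hom :: "('o, 'a) cat \<Rightarrow> 'o \<Rightarrow> 'o \<Rightarrow> 'a set" where
  "Hom A x y = {f \<in> Arr A. Dom A f = x \<and> Cod A f = y}"

locale category =
  fixes A :: "('o, 'a) cat" (structure)
  assumes Dom_Obj: "f \<in> Arr A \<Longrightarrow> Dom A f \<in> Obj A"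
    and Cod_Obj: "f \<in> Arr A \<Longrightarrow> Cod A f \<in> Obj A"
    and Id_Hom: "x \<in> Obj A \<Longrightarrow> Id A x \<in> Hom A x x"
    and Comp_Hom: "f \<in> Hom A x y \<Longrightarrow> g \<in> Hom A y z \<Longrightarrow> g \<bullet> f \<in> Hom A x z"
    and Comp_Id: "f \<in> Hom A x y \<Longrightarrow> f \<bullet> Id A x = f"
    and Id_Comp: "f \<in> Hom A x y \<Longrightarrow> Id A y \<bullet> f = f"
    and Comp_assoc: "f \<in> Hom A w x \<Longrightarrow> g \<in> Hom A x y \<Longrightarrow> h \<in> Hom A y z
      \<Longrightarrow> (h \<bullet> g) \<bullet> f = h \<bullet> (g \<bullet> f)"

definition is_inverse :: "('o, 'a) cat \<Rightarrow> 'a \<Rightarrow> 'a \<Rightarrow> bool" where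
  "is_inverse A f g \<longleftrightarrow> g \<in> Hom A (Cod A f) (Dom A f) \<and>
     g \<bullet>\<^bsub>A\<^esub> f = Id A (Dom A f) \<and> f \<bullet>\<^bsub>A\<^esub> g = Id A (Cod A f)"

definition is_iso :: "('o, 'a) cat \<Rightarrow> 'a \<Rightarrow> bool" where
  "is_iso A f \<longleftrightarrow> f \<in> Arr A \<and> (\<exists>g. is_inverse A f g)"

definition inverse_arr :: "('o, 'a) cat \<Rightarrow> 'a \<Rightarrow> 'a" where
  "inverse_arr A f = (THE g. is_inverse A f g)"

record ('o, 'a, 'p, 'b) fctr =
  fobj :: "'o \<Rightarrow> 'p"
  farr :: "'a \<Rightarrow> 'b"

locale cat_functor = A: category A + B: category B
  for A :: "('o, 'a) cat" and B :: "('p, 'b) cat" +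
  fixes F :: "('o, 'a, 'p, 'b, 'm) fctr_scheme"
  assumes fobj_Obj: "x \<in> Obj A \<Longrightarrow> fobj F x \<in> Obj B"
    and farr_Hom: "f \<in> Hom A x y \<Longrightarrow> farr F f \<in> Hom B (fobj F x) (fobj F y)"
    and farr_Id: "x \<in> Obj A \<Longrightarrow> farr F (Id A x) = Id B (fobj F x)"
    and farr_Comp: "f \<in> Hom A x y \<Longrightarrow> g \<in> Hom A y z
      \<Longrightarrow> farr F (g \<bullet>\<^bsub>A\<^esub> f) = farr F g \<bullet>\<^bsub>B\<^esub> farr F f"

definition id_functor :: "('o, 'a, 'o, 'a) fctr" where
  "id_functor = \<lparr>fobj = (\<lambda>x. x), farr = (\<lambda>f. f)\<rparr>"

definition comp_functor ::
    "('p, 'b, 'q, 'c, 'm) fctr_scheme \<Rightarrow> ('o, 'a, 'p, 'b, 'n) fctr_scheme \<Rightarrow> ('o, 'a, 'q, 'c) fctr" where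
  "comp_functor G F = \<lparr>fobj = (\<lambda>x. fobj G (fobj F x)), farr = (\<lambda>f. farr G (farr F f))\<rparr>"

locale nat_trans = F: cat_functor A B F + G: cat_functor A B G
  for A :: "('o, 'a) cat" and B :: "('p, 'b) cat"
    and F :: "('o, 'a, 'p, 'b, 'm) fctr_scheme" and G :: "('o, 'a, 'p, 'b, 'n) fctr_scheme" +
  fixes t :: "'o \<Rightarrow> 'b"
  assumes component_Hom: "x \<in> Obj A \<Longrightarrow> t x \<in> Hom B (fobj F x) (fobj G x)"
    and naturality: "f \<in> Hom A x y \<Longrightarrow> t y \<bullet>\<^bsub>B\<^esub> farr F f = farr G f \<bullet>\<^bsub>B\<^esub> t x"

locale nat_iso = nat_trans +
  assumes component_iso: "x \<in> Obj A \<Longrightarrow> is_iso B (t x)"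

definition equivalent_categories :: "('o, 'a) cat \<Rightarrow> ('p, 'b) cat \<Rightarrow> bool" where
  "equivalent_categories A B \<longleftrightarrow>
     (\<exists>(F :: ('o, 'a, 'p, 'b) fctr) (G :: ('p, 'b, 'o, 'a) fctr) s t.
        cat_functor A B F \<and> cat_functor B A G \<and>
        nat_iso A A id_functor (comp_functor G F) s \<and>
        nat_iso B B (comp_functor F G) id_functor t)"


section \<open>Universes of small sets and colimits\<close>

text \<open>A set is small if it belongs to U.  Closure under power sets
  is not demanded; closure under (encoded) binary products is automatic, because an infinite type
  admits an injective pairing function.\<close>

locale small_universe =
  fixes U :: "'u set set"
  assumes small_subset: "Y \<in> U \<Longrightarrow> X \<subseteq> Y \<Longrightarrow> X \<in> U"
    and small_image: "X \<in> U \<Longrightarrow> f ` X \<in> U"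
    and small_Union: "I \<in> U \<Longrightarrow> (\<And>i. i \<in> I \<Longrightarrow> S i \<in> U) \<Longrightarrow> (\<Union>i\<in>I. S i) \<in> U"
    and small_infinite: "\<exists>X\<in>U. infinite X"

definition small_category :: "'u set set \<Rightarrow> ('u, 'u) cat \<Rightarrow> bool" where
  "small_category U J \<longleftrightarrow> category J \<and> Obj J \<in> U \<and> Arr J \<in> U"

definition is_cocone ::
    "('j, 'k) cat \<Rightarrow> ('o, 'a) cat \<Rightarrow> ('j, 'k, 'o, 'a, 'm) fctr_scheme \<Rightarrow> 'o \<Rightarrow> ('j \<Rightarrow> 'a) \<Rightarrow> bool" where
  "is_cocone J A D X c \<longleftrightarrow> cat_functor J A D \<and> X \<in> Obj A \<and>
     (\<forall>j\<in>Obj J. c j \<in> Hom A (fobj D j) X) \<and>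
     (\<forall>u\<in>Arr J. c (Cod J u) \<bullet>\<^bsub>A\<^esub> farr D u = c (Dom J u))"

definition is_colimit ::
    "('j, 'k) cat \<Rightarrow> ('o, 'a) cat \<Rightarrow> ('j, 'k, 'o, 'a, 'm) fctr_scheme \<Rightarrow> 'o \<Rightarrow> ('j \<Rightarrow> 'a) \<Rightarrow> bool" where
  "is_colimit J A D X c \<longleftrightarrow> is_cocone J A D X c \<and>
     (\<forall>Y d. is_cocone J A D Y d \<longrightarrow>
        (\<exists>!h. h \<in> Hom A X Y \<and> (\<forall>j\<in>Obj J. h \<bullet>\<^bsub>A\<^esub> c j = d j)))"

definition preserves_colimits ::
    "'u set set \<Rightarrow> ('o, 'a) cat \<Rightarrow> ('p, 'b) cat \<Rightarrow> ('o, 'a, 'p, 'b, 'm) fctr_scheme \<Rightarrow> bool" where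
  "preserves_colimits U A B F \<longleftrightarrow>
     (\<forall>(J :: ('u, 'u) cat) (D :: ('u, 'u, 'o, 'a) fctr) X c.
        small_category U J \<longrightarrow> is_colimit J A D X c \<longrightarrow>
        is_colimit J B (comp_functor F D) (fobj F X) (\<lambda>j. farr F (c j)))"


section \<open>Comonads and their comodules\<close>

record ('o, 'a) comonad = "('o, 'a, 'o, 'a) fctr" +
  comult :: "'o \<Rightarrow> 'a"
  counit :: "'o \<Rightarrow> 'a"

locale is_comonad =
  comult: nat_trans A A C "comp_functor C C" "comult C" +
  counit: nat_trans A A C id_functor "counit C"
  for A :: "('o, 'a) cat" and C :: "('o, 'a) comonad" +
  assumes comult_coassoc: "x \<in> Obj A \<Longrightarrow>
      farr C (comult C x) \<bullet>\<^bsub>A\<^esub> comult C x = comult C (fobj C x) \<bullet>\<^bsub>A\<^esub> comult C x"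
    and counit_left: "x \<in> Obj A \<Longrightarrow> counit C (fobj C x) \<bullet>\<^bsub>A\<^esub> comult C x = Id A (fobj C x)"
    and counit_right: "x \<in> Obj A \<Longrightarrow> farr C (counit C x) \<bullet>\<^bsub>A\<^esub> comult C x = Id A (fobj C x)"

locale comonad_iso = C: is_comonad A C + D: is_comonad A D + nat_iso A A C D t
  for A :: "('o, 'a) cat" and C D :: "('o, 'a) comonad" and t :: "'o \<Rightarrow> 'a" +
  assumes counit_compat: "x \<in> Obj A \<Longrightarrow> counit D x \<bullet>\<^bsub>A\<^esub> t x = counit C x"
    and comult_compat: "x \<in> Obj A \<Longrightarrow>
      comult D x \<bullet>\<^bsub>A\<^esub> t x = farr D (t x) \<bullet>\<^bsub>A\<^esub> (t (fobj C x) \<bullet>\<^bsub>A\<^esub> comult C x)"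

datatype ('o, 'm) arrow = Arrow (source: 'o) (target: 'o) (mor: 'm)

definition is_comodule :: "('o, 'a) cat \<Rightarrow> ('o, 'a) comonad \<Rightarrow> 'o \<times> 'a \<Rightarrow> bool" where
  "is_comodule A C = (\<lambda>(x, r). x \<in> Obj A \<and> r \<in> Hom A x (fobj C x) \<and>
     farr C r \<bullet>\<^bsub>A\<^esub> r = comult C x \<bullet>\<^bsub>A\<^esub> r \<and> counit C x \<bullet>\<^bsub>A\<^esub> r = Id A x)"

definition Comod :: "('o, 'a) cat \<Rightarrow> ('o, 'a) comonad \<Rightarrow> ('o \<times> 'a, ('o \<times> 'a, 'a) arrow) cat" where
  "Comod A C =
    \<lparr>Obj = {X. is_comodule A C X},
     Arr = {f. is_comodule A C (source f) \<and> is_comodule A C (target f) \<and>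
               mor f \<in> Hom A (fst (source f)) (fst (target f)) \<and>
               farr C (mor f) \<bullet>\<^bsub>A\<^esub> snd (source f) = snd (target f) \<bullet>\<^bsub>A\<^esub> mor f},
     Dom = source,
     Cod = target,
     Id = (\<lambda>X. Arrow X X (Id A (fst X))),
     Comp = (\<lambda>g f. Arrow (source f) (target g) (mor g \<bullet>\<^bsub>A\<^esub> mor f))\<rparr>"


section \<open>Graded rings and graded modules\<close>

definition is_decomposition ::
    "('a, 'm) monoid_scheme \<Rightarrow> (int \<Rightarrow> 'a set) \<Rightarrow> 'a \<Rightarrow> (int \<Rightarrow> 'a) \<Rightarrow> bool" where
  "is_decomposition M G x f \<longleftrightarrow> (\<forall>i. f i \<in> G i) \<and> finite {i. f i \<noteq> \<one>\<^bsub>M\<^esub>} \<and>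
     x = finprod M f {i. f i \<noteq> \<one>\<^bsub>M\<^esub>}"

text \<open>Abelian groups underlying modules are written multiplicatively, as commutative groups in the
  sense of the locale \<^locale>\<open>comm_group\<close>.\<close>

locale graded_group = comm_group M
  for M :: "('a, 'm) monoid_scheme" (structure) +
  fixes G :: "int \<Rightarrow> 'a set"
  assumes degree_subgroup: "subgroup (G i) M"
    and direct_sum: "x \<in> carrier M \<Longrightarrow> \<exists>!f. is_decomposition M G x f"

record 'a gring = "'a ring" +
  rdeg :: "int \<Rightarrow> 'a set"

locale graded_ring = ring R + graded_group "add_monoid R" "rdeg R"
  for R :: "'a gring" (structure) +
  assumes degree_one: "\<one> \<in> rdeg R 0"
    and degree_mult: "x \<in> rdeg R i \<Longrightarrow> y \<in> rdeg R j \<Longrightarrow> x \<otimes> y \<in> rdeg R (i + j)"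

definition hcomponent :: "'a gring \<Rightarrow> 'a \<Rightarrow> int \<Rightarrow> 'a" where
  "hcomponent R r = (THE f. is_decomposition (add_monoid R) (rdeg R) r f)"

record 'a gmod = "'a monoid" +
  ract :: "'a \<Rightarrow> 'a \<Rightarrow> 'a"
  deg :: "int \<Rightarrow> 'a set"

locale graded_module = R: graded_ring R + graded_group M "deg M"
  for R :: "'a gring" and M :: "'a gmod" +
  assumes ract_closed: "x \<in> carrier M \<Longrightarrow> r \<in> carrier R \<Longrightarrow> ract M x r \<in> carrier M"
    and ract_add_left: "x \<in> carrier M \<Longrightarrow> y \<in> carrier M \<Longrightarrow> r \<in> carrier R
      \<Longrightarrow> ract M (x \<otimes>\<^bsub>M\<^esub> y) r = ract M x r \<otimes>\<^bsub>M\<^esub> ract M y r"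
    and ract_add_right: "x \<in> carrier M \<Longrightarrow> r \<in> carrier R \<Longrightarrow> s \<in> carrier R
      \<Longrightarrow> ract M x (r \<oplus>\<^bsub>R\<^esub> s) = ract M x r \<otimes>\<^bsub>M\<^esub> ract M x s"
    and ract_mult: "x \<in> carrier M \<Longrightarrow> r \<in> carrier R \<Longrightarrow> s \<in> carrier R
      \<Longrightarrow> ract M x (r \<otimes>\<^bsub>R\<^esub> s) = ract M (ract M x r) s"
    and ract_one: "x \<in> carrier M \<Longrightarrow> ract M x \<one>\<^bsub>R\<^esub> = x"
    and degree_ract: "x \<in> deg M i \<Longrightarrow> r \<in> rdeg R j \<Longrightarrow> ract M x r \<in> deg M (i + j)"

definition is_graded_map :: "'a gring \<Rightarrow> 'a gmod \<Rightarrow> 'a gmod \<Rightarrow> ('a \<Rightarrow> 'a) \<Rightarrow> bool" where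
  "is_graded_map R M N f \<longleftrightarrow> f \<in> hom M N \<and>
     (\<forall>x\<in>carrier M. \<forall>r\<in>carrier R. f (ract M x r) = ract N (f x) r) \<and>
     (\<forall>i. f ` deg M i \<subseteq> deg N i)"

type_synonym 'u garrow = "('u gmod, 'u \<Rightarrow> 'u) arrow"

text \<open>Functions are taken to be \<^const>\<open>undefined\<close> outside the carrier of the source, so that equality
  of arrows is equality of maps on carriers.\<close>

definition GrMod :: "'u set set \<Rightarrow> 'u gring \<Rightarrow> ('u gmod, 'u garrow) cat" where
  "GrMod U R =
    \<lparr>Obj = {M. graded_module R M \<and> carrier M \<in> U},
     Arr = {f. graded_module R (source f) \<and> carrier (source f) \<in> U \<and>
               graded_module R (target f) \<and> carrier (target f) \<in> U \<and>
               mor f \<in> extensional (carrier (source f)) \<and>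
               is_graded_map R (source f) (target f) (mor f)},
     Dom = source,
     Cod = target,
     Id = (\<lambda>M. Arrow M M (\<lambda>x\<in>carrier M. x)),
     Comp = (\<lambda>g f. Arrow (source f) (target g) (compose (carrier (source f)) (mor g) (mor f)))\<rparr>"

definition reg_mod :: "'a gring \<Rightarrow> 'a gmod" where
  "reg_mod R = \<lparr>carrier = carrier R, monoid.mult = ring.add R, one = \<zero>\<^bsub>R\<^esub>,
                ract = monoid.mult R, deg = rdeg R\<rparr>"


section \<open>The grading shift and the enrichment\<close>

definition shift :: "int \<Rightarrow> 'a gmod \<Rightarrow> 'a gmod" where
  "shift i M = M\<lparr>deg := (\<lambda>n. deg M (n + i))\<rparr>"

definition shift_arr :: "int \<Rightarrow> 'a garrow \<Rightarrow> 'a garrow" where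
  "shift_arr i f = Arrow (shift i (source f)) (shift i (target f)) (mor f)"

definition shift_functor :: "('a gmod, 'a garrow, 'a gmod, 'a garrow) fctr" where
  "shift_functor = \<lparr>fobj = shift 1, farr = shift_arr 1\<rparr>"

text \<open>Commuting with the grading shift is witnessed by a natural isomorphism
  from \<open>C(M(1))\<close> to \<open>C(M)(1)\<close> that respects the comonad structure; the case
  of strict equality is that of identity components.\<close>

locale shift_preserving =
  is_comonad "GrMod U R" C +
  nat_iso "GrMod U R" "GrMod U R" "comp_functor C shift_functor" "comp_functor shift_functor C" \<sigma>
  for U :: "'u set set" and R :: "'u gring" and C :: "('u gmod, 'u garrow) comonad"
    and \<sigma> :: "'u gmod \<Rightarrow> 'u garrow" +
  assumes shift_counit: "M \<in> Obj (GrMod U R) \<Longrightarrow>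
      shift_arr 1 (counit C M) \<bullet>\<^bsub>GrMod U R\<^esub> \<sigma> M = counit C (shift 1 M)"
    and shift_comult: "M \<in> Obj (GrMod U R) \<Longrightarrow>
      shift_arr 1 (comult C M) \<bullet>\<^bsub>GrMod U R\<^esub> \<sigma> M =
      \<sigma> (fobj C M) \<bullet>\<^bsub>GrMod U R\<^esub> (farr C (\<sigma> M) \<bullet>\<^bsub>GrMod U R\<^esub> comult C (shift 1 M))"

text \<open>The induced isomorphisms from \<open>C(M(i))\<close> to \<open>C(M)(i)\<close> for all integers i.\<close>

primrec shift_iso_nat ::
    "'u set set \<Rightarrow> 'u gring \<Rightarrow> ('u gmod, 'u garrow) comonad \<Rightarrow> ('u gmod \<Rightarrow> 'u garrow) \<Rightarrow>
     nat \<Rightarrow> 'u gmod \<Rightarrow> 'u garrow" where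
  "shift_iso_nat U R C \<sigma> 0 M = Id (GrMod U R) (fobj C M)"
| "shift_iso_nat U R C \<sigma> (Suc n) M =
     shift_arr 1 (shift_iso_nat U R C \<sigma> n M) \<bullet>\<^bsub>GrMod U R\<^esub> \<sigma> (shift (int n) M)"

definition shift_iso ::
    "'u set set \<Rightarrow> 'u gring \<Rightarrow> ('u gmod, 'u garrow) comonad \<Rightarrow> ('u gmod \<Rightarrow> 'u garrow) \<Rightarrow>
     int \<Rightarrow> 'u gmod \<Rightarrow> 'u garrow" where
  "shift_iso U R C \<sigma> i M =
     (if 0 \<le> i then shift_iso_nat U R C \<sigma> (nat i) M
      else shift_arr i (inverse_arr (GrMod U R) (shift_iso_nat U R C \<sigma> (nat (- i)) (shift i M))))"

text \<open>An element of the graded abelian group \<open>hom(M,N)\<close>, the direct sum over i of the groups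
  \<open>Hom(M,N(i))\<close>, is given by its family of components.  The first operation below is the action of
  the enriched functor on such an element, the second is evaluation at an element of M,
  i.e. the sum of the values of the components.\<close>

definition enriched_map ::
    "'u set set \<Rightarrow> 'u gring \<Rightarrow> ('u gmod, 'u garrow) comonad \<Rightarrow> ('u gmod \<Rightarrow> 'u garrow) \<Rightarrow>
     'u gmod \<Rightarrow> (int \<Rightarrow> 'u garrow) \<Rightarrow> int \<Rightarrow> 'u garrow" where
  "enriched_map U R C \<sigma> N f = (\<lambda>i. shift_iso U R C \<sigma> i N \<bullet>\<^bsub>GrMod U R\<^esub> farr C (f i))"

definition evaluate :: "'u gmod \<Rightarrow> (int \<Rightarrow> 'u garrow) \<Rightarrow> 'u \<Rightarrow> 'u" where
  "evaluate N f x = finprod N (\<lambda>i. mor (f i) x) {i. mor (f i) x \<noteq> \<one>\<^bsub>N\<^esub>}"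

text \<open>The identification of R with \<open>hom(R,R)\<close>: an element acts by left multiplication, and
  its component of degree i is a map from R to \<open>R(i)\<close>.\<close>

definition left_mult :: "'u gring \<Rightarrow> 'u \<Rightarrow> int \<Rightarrow> 'u garrow" where
  "left_mult R r i = Arrow (reg_mod R) (shift i (reg_mod R))
     (\<lambda>x\<in>carrier R. hcomponent R r i \<otimes>\<^bsub>R\<^esub> x)"


section \<open>Graded bimodules and tensor products\<close>

record 'a gbimod =
  rmod :: "'a gmod"
  lact :: "'a \<Rightarrow> 'a \<Rightarrow> 'a"

locale graded_bimodule = graded_module R "rmod D"
  for R :: "'a gring" and D :: "'a gbimod" +
  assumes lact_closed: "r \<in> carrier R \<Longrightarrow> x \<in> carrier (rmod D) \<Longrightarrow> lact D r x \<in> carrier (rmod D)"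
    and lact_add_right: "r \<in> carrier R \<Longrightarrow> x \<in> carrier (rmod D) \<Longrightarrow> y \<in> carrier (rmod D)
      \<Longrightarrow> lact D r (x \<otimes>\<^bsub>rmod D\<^esub> y) = lact D r x \<otimes>\<^bsub>rmod D\<^esub> lact D r y"
    and lact_add_left: "r \<in> carrier R \<Longrightarrow> s \<in> carrier R \<Longrightarrow> x \<in> carrier (rmod D)
      \<Longrightarrow> lact D (r \<oplus>\<^bsub>R\<^esub> s) x = lact D r x \<otimes>\<^bsub>rmod D\<^esub> lact D s x"
    and lact_mult: "r \<in> carrier R \<Longrightarrow> s \<in> carrier R \<Longrightarrow> x \<in> carrier (rmod D)
      \<Longrightarrow> lact D (r \<otimes>\<^bsub>R\<^esub> s) x = lact D r (lact D s x)"
    and lact_one: "x \<in> carrier (rmod D) \<Longrightarrow> lact D \<one>\<^bsub>R\<^esub> x = x"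
    and lact_ract: "r \<in> carrier R \<Longrightarrow> x \<in> carrier (rmod D) \<Longrightarrow> s \<in> carrier R
      \<Longrightarrow> ract (rmod D) (lact D r x) s = lact D r (ract (rmod D) x s)"
    and degree_lact: "r \<in> rdeg R i \<Longrightarrow> x \<in> deg (rmod D) j \<Longrightarrow> lact D r x \<in> deg (rmod D) (i + j)"

definition is_left_linear :: "'a gring \<Rightarrow> 'a gbimod \<Rightarrow> 'a gbimod \<Rightarrow> ('a \<Rightarrow> 'a) \<Rightarrow> bool" where
  "is_left_linear R D E f \<longleftrightarrow>
     (\<forall>r\<in>carrier R. \<forall>x\<in>carrier (rmod D). f (lact D r x) = lact E r (f x))"

definition reg_bimod :: "'a gring \<Rightarrow> 'a gbimod" where
  "reg_bimod R = \<lparr>rmod = reg_mod R, lact = monoid.mult R\<rparr>"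

text \<open>The tensor product of a right module and a bimodule is the usual quotient of the free abelian
  group on pairs, transported along an arbitrarily chosen bijection onto a small set.\<close>

definition tensor_free :: "'a gmod \<Rightarrow> 'a gbimod \<Rightarrow> ('a \<times> 'a \<Rightarrow>\<^sub>0 int) monoid" where
  "tensor_free M D = free_Abelian_group (carrier M \<times> carrier (rmod D))"

definition tensor_relations :: "'a gring \<Rightarrow> 'a gmod \<Rightarrow> 'a gbimod \<Rightarrow> ('a \<times> 'a \<Rightarrow>\<^sub>0 int) set" where
  "tensor_relations R M D =
     {frag_of (x \<otimes>\<^bsub>M\<^esub> y, d) - frag_of (x, d) - frag_of (y, d) | x y d.
        x \<in> carrier M \<and> y \<in> carrier M \<and> d \<in> carrier (rmod D)} \<union>
     {frag_of (x, d \<otimes>\<^bsub>rmod D\<^esub> e) - frag_of (x, d) - frag_of (x, e) | x d e.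
        x \<in> carrier M \<and> d \<in> carrier (rmod D) \<and> e \<in> carrier (rmod D)} \<union>
     {frag_of (ract M x r, d) - frag_of (x, lact D r d) | x r d.
        x \<in> carrier M \<and> r \<in> carrier R \<and> d \<in> carrier (rmod D)}"

definition tensor_quotient ::
    "'a gring \<Rightarrow> 'a gmod \<Rightarrow> 'a gbimod \<Rightarrow> ('a \<times> 'a \<Rightarrow>\<^sub>0 int) set monoid" where
  "tensor_quotient R M D =
     tensor_free M D Mod generate (tensor_free M D) (tensor_relations R M D)"

definition tensor_code ::
    "'u set set \<Rightarrow> 'u gring \<Rightarrow> 'u gmod \<Rightarrow> 'u gbimod \<Rightarrow> ('u \<times> 'u \<Rightarrow>\<^sub>0 int) set \<Rightarrow> 'u" where
  "tensor_code U R M D = (SOME e. inj_on e (carrier (tensor_quotient R M D)) \<and>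
     e ` carrier (tensor_quotient R M D) \<in> U)"

definition tensor_group :: "'u set set \<Rightarrow> 'u gring \<Rightarrow> 'u gmod \<Rightarrow> 'u gbimod \<Rightarrow> 'u monoid" where
  "tensor_group U R M D =
    (let Q = tensor_quotient R M D; e = tensor_code U R M D; d = inv_into (carrier Q) e
     in \<lparr>carrier = e ` carrier Q, monoid.mult = (\<lambda>s t. e (d s \<otimes>\<^bsub>Q\<^esub> d t)), one = e \<one>\<^bsub>Q\<^esub>\<rparr>)"

definition pure :: "'u set set \<Rightarrow> 'u gring \<Rightarrow> 'u gmod \<Rightarrow> 'u gbimod \<Rightarrow> 'u \<Rightarrow> 'u \<Rightarrow> 'u" where
  "pure U R M D x d = tensor_code U R M D
     (generate (tensor_free M D) (tensor_relations R M D) #>\<^bsub>tensor_free M D\<^esub> frag_of (x, d))"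

text \<open>The additive map on the tensor product with prescribed values on pure tensors.\<close>

definition tensor_lift ::
    "'u set set \<Rightarrow> 'u gring \<Rightarrow> 'u gmod \<Rightarrow> 'u gbimod \<Rightarrow> ('u, 'm) monoid_scheme \<Rightarrow>
     ('u \<Rightarrow> 'u \<Rightarrow> 'u) \<Rightarrow> 'u \<Rightarrow> 'u" where
  "tensor_lift U R M D B g =
     (THE h. h \<in> hom (tensor_group U R M D) B \<and> h \<in> extensional (carrier (tensor_group U R M D)) \<and>
        (\<forall>x\<in>carrier M. \<forall>d\<in>carrier (rmod D). h (pure U R M D x d) = g x d))"

definition tensor :: "'u set set \<Rightarrow> 'u gring \<Rightarrow> 'u gmod \<Rightarrow> 'u gbimod \<Rightarrow> 'u gmod" where
  "tensor U R M D =
    (let T = tensor_group U R M D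
     in \<lparr>carrier = carrier T, monoid.mult = monoid.mult T, one = one T,
         ract = (\<lambda>t r. tensor_lift U R M D T (\<lambda>x d. pure U R M D x (ract (rmod D) d r)) t),
         deg = (\<lambda>n. generate T {pure U R M D x d | x d i j.
                  x \<in> deg M i \<and> d \<in> deg (rmod D) j \<and> i + j = n})\<rparr>)"

definition tensor_bimod :: "'u set set \<Rightarrow> 'u gring \<Rightarrow> 'u gbimod \<Rightarrow> 'u gbimod \<Rightarrow> 'u gbimod" where
  "tensor_bimod U R D E =
    \<lparr>rmod = tensor U R (rmod D) E,
     lact = (\<lambda>r. tensor_lift U R (rmod D) E (tensor_group U R (rmod D) E)
                   (\<lambda>d e. pure U R (rmod D) E (lact D r d) e))\<rparr>"

text \<open>The tensor product of a map f of right modules with a map g of bimodules from D to E.\<close>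

definition tensor_arr ::
    "'u set set \<Rightarrow> 'u gring \<Rightarrow> 'u garrow \<Rightarrow> 'u gbimod \<Rightarrow> 'u gbimod \<Rightarrow> ('u \<Rightarrow> 'u) \<Rightarrow> 'u garrow" where
  "tensor_arr U R f D E g =
     Arrow (tensor U R (source f) D) (tensor U R (target f) E)
       (tensor_lift U R (source f) D (tensor U R (target f) E)
          (\<lambda>x d. pure U R (target f) E (mor f x) (g d)))"

text \<open>The associativity isomorphism from \<open>(M \<otimes> D) \<otimes> E\<close> to \<open>M \<otimes> (D \<otimes> E)\<close>
  and the unit isomorphisms.\<close>

definition associator ::
    "'u set set \<Rightarrow> 'u gring \<Rightarrow> 'u gmod \<Rightarrow> 'u gbimod \<Rightarrow> 'u gbimod \<Rightarrow> 'u garrow" where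
  "associator U R M D E =
    (let S = tensor U R (tensor U R M D) E; T = tensor U R M (tensor_bimod U R D E)
     in Arrow S T
          (THE h. h \<in> hom S T \<and> h \<in> extensional (carrier S) \<and>
             (\<forall>x\<in>carrier M. \<forall>d\<in>carrier (rmod D). \<forall>e\<in>carrier (rmod E).
                h (pure U R (tensor U R M D) E (pure U R M D x d) e) =
                pure U R M (tensor_bimod U R D E) x (pure U R (rmod D) E d e))))"

definition right_unitor :: "'u set set \<Rightarrow> 'u gring \<Rightarrow> 'u gmod \<Rightarrow> 'u garrow" where
  "right_unitor U R M = Arrow (tensor U R M (reg_bimod R)) M
     (tensor_lift U R M (reg_bimod R) M (\<lambda>x r. ract M x r))"

definition left_unitor :: "'u set set \<Rightarrow> 'u gring \<Rightarrow> 'u gbimod \<Rightarrow> 'u garrow" where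
  "left_unitor U R D = Arrow (tensor U R (reg_mod R) D) (rmod D)
     (tensor_lift U R (reg_mod R) D (rmod D) (\<lambda>r d. lact D r d))"


section \<open>Graded corings and their comodules\<close>

locale graded_coring = graded_bimodule R D
  for U :: "'u set set" and R :: "'u gring" and D :: "'u gbimod" and \<Delta> \<epsilon> :: "'u garrow" +
  assumes coring_small: "carrier (rmod D) \<in> U"
    and comult_map: "\<Delta> \<in> Hom (GrMod U R) (rmod D) (tensor U R (rmod D) D)"
    and comult_left_linear: "is_left_linear R D (tensor_bimod U R D D) (mor \<Delta>)"
    and counit_map: "\<epsilon> \<in> Hom (GrMod U R) (rmod D) (reg_mod R)"
    and counit_left_linear: "is_left_linear R D (reg_bimod R) (mor \<epsilon>)"
    and coring_coassoc:
      "associator U R (rmod D) D D \<bullet>\<^bsub>GrMod U R\<^esub>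
         (tensor_arr U R \<Delta> D D (\<lambda>d. d) \<bullet>\<^bsub>GrMod U R\<^esub> \<Delta>) =
       tensor_arr U R (Id (GrMod U R) (rmod D)) D (tensor_bimod U R D D) (mor \<Delta>) \<bullet>\<^bsub>GrMod U R\<^esub> \<Delta>"
    and coring_counit_left:
      "left_unitor U R D \<bullet>\<^bsub>GrMod U R\<^esub> (tensor_arr U R \<epsilon> D D (\<lambda>d. d) \<bullet>\<^bsub>GrMod U R\<^esub> \<Delta>) =
       Id (GrMod U R) (rmod D)"
    and coring_counit_right:
      "right_unitor U R (rmod D) \<bullet>\<^bsub>GrMod U R\<^esub>
         (tensor_arr U R (Id (GrMod U R) (rmod D)) D (reg_bimod R) (mor \<epsilon>) \<bullet>\<^bsub>GrMod U R\<^esub> \<Delta>) =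
       Id (GrMod U R) (rmod D)"

definition tensor_comonad ::
    "'u set set \<Rightarrow> 'u gring \<Rightarrow> 'u gbimod \<Rightarrow> 'u garrow \<Rightarrow> 'u garrow \<Rightarrow> ('u gmod, 'u garrow) comonad" where
  "tensor_comonad U R D \<Delta> \<epsilon> =
    \<lparr>fobj = (\<lambda>M. tensor U R M D),
     farr = (\<lambda>f. tensor_arr U R f D D (\<lambda>d. d)),
     comult = (\<lambda>M. inverse_arr (GrMod U R) (associator U R M D D) \<bullet>\<^bsub>GrMod U R\<^esub>
                   tensor_arr U R (Id (GrMod U R) M) D (tensor_bimod U R D D) (mor \<Delta>)),
     counit = (\<lambda>M. right_unitor U R M \<bullet>\<^bsub>GrMod U R\<^esub>
                   tensor_arr U R (Id (GrMod U R) M) D (reg_bimod R) (mor \<epsilon>))\<rparr>"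

definition is_coring_comodule ::
    "'u set set \<Rightarrow> 'u gring \<Rightarrow> 'u gbimod \<Rightarrow> 'u garrow \<Rightarrow> 'u garrow \<Rightarrow> 'u gmod \<times> 'u garrow \<Rightarrow> bool" where
  "is_coring_comodule U R D \<Delta> \<epsilon> = (\<lambda>(M, \<rho>).
     M \<in> Obj (GrMod U R) \<and> \<rho> \<in> Hom (GrMod U R) M (tensor U R M D) \<and>
     associator U R M D D \<bullet>\<^bsub>GrMod U R\<^esub> (tensor_arr U R \<rho> D D (\<lambda>d. d) \<bullet>\<^bsub>GrMod U R\<^esub> \<rho>) =
       tensor_arr U R (Id (GrMod U R) M) D (tensor_bimod U R D D) (mor \<Delta>) \<bullet>\<^bsub>GrMod U R\<^esub> \<rho> \<and>
     right_unitor U R M \<bullet>\<^bsub>GrMod U R\<^esub>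
         (tensor_arr U R (Id (GrMod U R) M) D (reg_bimod R) (mor \<epsilon>) \<bullet>\<^bsub>GrMod U R\<^esub> \<rho>) =
       Id (GrMod U R) M)"

definition CoringComod ::
    "'u set set \<Rightarrow> 'u gring \<Rightarrow> 'u gbimod \<Rightarrow> 'u garrow \<Rightarrow> 'u garrow \<Rightarrow>
     ('u gmod \<times> 'u garrow, ('u gmod \<times> 'u garrow, 'u garrow) arrow) cat" where
  "CoringComod U R D \<Delta> \<epsilon> =
    \<lparr>Obj = {X. is_coring_comodule U R D \<Delta> \<epsilon> X},
     Arr = {f. is_coring_comodule U R D \<Delta> \<epsilon> (source f) \<and> is_coring_comodule U R D \<Delta> \<epsilon> (target f) \<and>
               mor f \<in> Hom (GrMod U R) (fst (source f)) (fst (target f)) \<and>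
               tensor_arr U R (mor f) D D (\<lambda>d. d) \<bullet>\<^bsub>GrMod U R\<^esub> snd (source f) =
                 snd (target f) \<bullet>\<^bsub>GrMod U R\<^esub> mor f},
     Dom = source,
     Cod = target,
     Id = (\<lambda>X. Arrow X X (Id (GrMod U R) (fst X))),
     Comp = (\<lambda>g f. Arrow (source f) (target g) (mor g \<bullet>\<^bsub>GrMod U R\<^esub> mor f))\<rparr>"

text \<open>\<open>C(R)\<close> with the left action given by
  \<open>R = hom(R,R) \<rightarrow> hom(C(R),C(R))\<close>.\<close>

definition value_bimod ::
    "'u set set \<Rightarrow> 'u gring \<Rightarrow> ('u gmod, 'u garrow) comonad \<Rightarrow> ('u gmod \<Rightarrow> 'u garrow) \<Rightarrow> 'u gbimod" where
  "value_bimod U R C \<sigma> =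
    \<lparr>rmod = fobj C (reg_mod R),
     lact = (\<lambda>r. evaluate (fobj C (reg_mod R))
                   (enriched_map U R C \<sigma> (reg_mod R) (left_mult R r)))\<rparr>"

end

theory Submission
  imports Defs
begin

text \<open>For \<open>x\<close> in \<open>M\<^sub>i\<close>, left multiplication \<open>r \<mapsto> x r\<close> is a map \<open>R \<rightarrow> M(i)\<close>, and \<open>C\<close> together with the
  shift isomorphism turns it into a map \<open>L\<^sub>x\<close> of degree \<open>i\<close> from \<open>C(R)\<close> to \<open>C(M)\<close>.  Since \<open>C\<close> preserves the
  initial object and binary coproducts it is additive, so \<open>L\<^sub>x\<close> is additive in \<open>x\<close>, and functoriality
  gives \<open>L\<^bsub>x r\<^esub> = L\<^sub>x \<circ> L\<^sub>r\<close>; hence \<open>x \<otimes> d \<mapsto> L\<^sub>x d\<close> defines a natural map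
  \<open>\<phi>\<^sub>M : M \<otimes> C(R) \<rightarrow> C(M)\<close>.  An inverse is obtained by presenting \<open>M\<close> as a small colimit of shifts of
  \<open>R \<oplus> R\<close>, which \<open>C\<close> preserves.  On elements \<open>L\<^sub>x d\<close> the counit and comultiplication of \<open>C\<close> are
  determined by their values at \<open>R\<close>, so \<open>\<theta> = \<phi>\<inverse>\<close> transports the comonad structure to
  \<open>- \<otimes> C(R)\<close>.  The coring axioms say that \<open>C(R)\<close>, with coaction \<open>\<Delta>\<close>, is a comodule over the
  transported comonad, except for the left counit law, which holds because the left unitor
  of \<open>C(R)\<close> is \<open>\<phi>\<^sub>R\<close>.\<close>

section \<open>Graded groups\<close>

text \<open>Only homogeneous elements give arrows of the category, so maps on elements are defined
  degree by degree and extended along the direct sum, and identities are checked on homogeneous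
  elements. The isomorphism \<open>\<sigma>\<close> is given for one shift only. The enrichment
  needs its iterates in all integer degrees; their cocycle law, naturality and compatibility with
  the comonad structure are what make \<open>L\<close> functorial. The inverse of the comparison map
  is not given by a formula on C(M): it comes from the universal property of a colimit. Preservation
  of colimits speaks only of index categories with small sets of objects and arrows in
  \<open>'u\<close>, hence the encoding of index categories and the cardinality estimates. The
  comonad laws of the tensor functor are not verified on elements. Only the compatibility of its
  counit and comultiplication with the isomorphism is; the laws then follow by cancelling that
  isomorphism.\<close>

definition gcomp :: "('a, 'm) monoid_scheme \<Rightarrow> (int \<Rightarrow> 'a set) \<Rightarrow> 'a \<Rightarrow> int \<Rightarrow> 'a" where
  "gcomp M G x = (THE f. is_decomposition M G x f)"

text \<open>\<open>gfinprod\<close> over \<open>UNIV\<close> restricts itself to the support, so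
  decompositions with different supports can be compared and multiplied termwise.\<close>

lemma is_decomposition_gfinprod:
  assumes "comm_group M"
  shows "is_decomposition M G x f \<longleftrightarrow>
    (\<forall>i. f i \<in> G i) \<and> finite {i. f i \<noteq> \<one>\<^bsub>M\<^esub>} \<and> x = gfinprod M f UNIV"
  by (auto simp: is_decomposition_def gfinprod_def)

lemma gfinprod_single:
  assumes "comm_group M" "f i \<in> carrier M" "\<And>j. j \<noteq> i \<Longrightarrow> f j = \<one>\<^bsub>M\<^esub>"
  shows "gfinprod M f UNIV = f i"
proof -
  interpret comm_group M by fact
  have "gfinprod M f UNIV = gfinprod M f {i}"
    by (rule gfinprod_mono_neutral_cong_right) (use assms in \<open>auto, metis one_closed\<close>)
  then show ?thesis using assms(2) by (simp add: gfinprod_eq_finprod)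
qed

text \<open>A homomorphism may kill further terms, so the two supports can differ. The product is
  first taken over the support of \<open>f\<close>, and the terms that became neutral are dropped
  afterwards.\<close>

lemma gfinprod_hom:
  assumes "comm_group M" "comm_group B" "h \<in> hom M B" "finite {i. f i \<noteq> \<one>\<^bsub>M\<^esub>}" "\<And>i. f i \<in> carrier M"
  shows "h (gfinprod M f UNIV) = gfinprod B (\<lambda>i. h (f i)) UNIV"
proof -
  interpret M: comm_group M by fact
  interpret B: comm_group B by fact
  interpret group_hom M B h
    using assms by unfold_locales
  have hc: "\<And>x. x \<in> carrier M \<Longrightarrow> h x \<in> carrier B" by simp
  have "h (finprod M f I) = finprod B (\<lambda>i. h (f i)) I" if "finite I" for I
    using that
  proof (induction I)
    case (insert a I)
    have "f \<in> I \<rightarrow> carrier M" "(\<lambda>i. h (f i)) \<in> I \<rightarrow> carrier B" using assms(5) hc by auto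
    with insert show ?case using assms(5) hc
      by (simp add: M.finprod_insert B.finprod_insert)
  qed simp
  then have "h (gfinprod M f UNIV) = finprod B (\<lambda>i. h (f i)) {i. f i \<noteq> \<one>\<^bsub>M\<^esub>}"
    using assms(4) by (simp add: gfinprod_def)
  also have "\<dots> = gfinprod B (\<lambda>i. h (f i)) {i. f i \<noteq> \<one>\<^bsub>M\<^esub>}"
    using assms(4,5) hc by (subst B.gfinprod_eq_finprod) auto
  also have "\<dots> = gfinprod B (\<lambda>i. h (f i)) UNIV"
    by (rule B.gfinprod_mono_neutral_cong_left) (use assms(5) hc in auto)
  finally show ?thesis .
qed

context graded_group
begin

lemma deg_closed: "x \<in> G i \<Longrightarrow> x \<in> carrier M"
  by (rule subgroup.mem_carrier[OF degree_subgroup])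

lemma deg_one: "\<one> \<in> G i"
  by (rule subgroup.one_closed[OF degree_subgroup])

lemma deg_mult: "x \<in> G i \<Longrightarrow> y \<in> G i \<Longrightarrow> x \<otimes> y \<in> G i"
  by (rule subgroup.m_closed[OF degree_subgroup])

lemma deg_inv: "x \<in> G i \<Longrightarrow> inv x \<in> G i"
  by (rule subgroup.m_inv_closed[OF degree_subgroup])

lemma gcomp_decomposition: "x \<in> carrier M \<Longrightarrow> is_decomposition M G x (gcomp M G x)"
  unfolding gcomp_def using direct_sum[of x] by (rule theI')

lemma gcomp_eqI:
  assumes "is_decomposition M G x f" shows "gcomp M G x = f"
proof -
  have "x \<in> carrier M"
    using assms deg_closed unfolding is_decomposition_gfinprod[OF comm_group_axioms]
    by (auto intro!: gfinprod_closed)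
  then show ?thesis using assms direct_sum gcomp_decomposition by metis
qed

lemma gcomp_deg: "x \<in> carrier M \<Longrightarrow> gcomp M G x i \<in> G i"
  and gcomp_finite: "x \<in> carrier M \<Longrightarrow> finite {i. gcomp M G x i \<noteq> \<one>}"
  and gcomp_prod: "x \<in> carrier M \<Longrightarrow> gfinprod M (gcomp M G x) UNIV = x"
  using gcomp_decomposition[of x] by (auto simp: is_decomposition_gfinprod[OF comm_group_axioms])

lemma gcomp_closed: "x \<in> carrier M \<Longrightarrow> gcomp M G x i \<in> carrier M"
  using gcomp_deg deg_closed by blast

lemma gcomp_homogeneous: "x \<in> G i \<Longrightarrow> gcomp M G x = (\<lambda>j. if j = i then x else \<one>)"
  by (rule gcomp_eqI, subst is_decomposition_gfinprod[OF comm_group_axioms])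
    (auto simp: deg_one deg_closed gfinprod_single[OF comm_group_axioms, of _ i])

lemma gcomp_mult:
  assumes x: "x \<in> carrier M" and y: "y \<in> carrier M"
  shows "gcomp M G (x \<otimes> y) = (\<lambda>i. gcomp M G x i \<otimes> gcomp M G y i)"
proof (rule gcomp_eqI, subst is_decomposition_gfinprod[OF comm_group_axioms], intro conjI allI)
  show "gcomp M G x i \<otimes> gcomp M G y i \<in> G i" for i
    using x y by (simp add: gcomp_deg deg_mult)
  show "finite {i. gcomp M G x i \<otimes> gcomp M G y i \<noteq> \<one>}"
    by (rule finite_subset[OF _ finite_UnI[OF gcomp_finite[OF x] gcomp_finite[OF y]]])
      (use x y in auto)
  show "x \<otimes> y = gfinprod M (\<lambda>i. gcomp M G x i \<otimes> gcomp M G y i) UNIV"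
    by (subst gfinprod_distrib) (use x y in \<open>auto simp: gcomp_finite gcomp_prod gcomp_closed\<close>)
qed

text \<open>An element is the finite product of its components, rebuilt here one factor at a time.
  The empty product needs no case of its own, since \<open>\<one>\<close> is homogeneous.\<close>

lemma graded_induct [consumes 1, case_names homogeneous mult]:
  assumes "x \<in> carrier M" "\<And>i x. x \<in> G i \<Longrightarrow> P x"
    "\<And>x y. x \<in> carrier M \<Longrightarrow> y \<in> carrier M \<Longrightarrow> P x \<Longrightarrow> P y \<Longrightarrow> P (x \<otimes> y)"
  shows "P x"
proof -
  let ?f = "gcomp M G x"
  have "P (finprod M ?f I)" if "finite I" for I
    using that
  proof (induction I)
    case empty
    then show ?case using assms(2) deg_one by simp
  next
    case (insert a I)
    have "?f \<in> I \<rightarrow> carrier M" "?f a \<in> carrier M"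
      using gcomp_closed[OF assms(1)] by auto
    then show ?case
      using insert assms(2)[OF gcomp_deg[OF assms(1)]] assms(3) by simp
  qed
  from this[OF gcomp_finite[OF assms(1)]] show ?thesis
    using gcomp_prod[OF assms(1)] gcomp_finite[OF assms(1)] by (simp add: gfinprod_def)
qed

lemma hom_eqI_homogeneous:
  assumes "group B" "h \<in> hom M B" "k \<in> hom M B" "\<And>i x. x \<in> G i \<Longrightarrow> h x = k x" "x \<in> carrier M"
  shows "h x = k x"
  using assms(5)
proof (induction x rule: graded_induct)
  case (mult x y)
  then show ?case using assms(2,3) by (simp add: hom_mult)
qed (use assms in auto)

end

text \<open>Applying \<open>p i\<close> to a decomposition kills every factor except
  \<open>f i\<close>, which forces uniqueness; existence holds because decomposable elements are
  closed under products. Directness of a sum is thereby reduced to exhibiting projections, which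
  suits quotients, where uniqueness of components is not visible.\<close>

lemma graded_groupI:
  fixes M :: "('a, 'm) monoid_scheme" (structure)
  assumes M: "comm_group M" and sub: "\<And>i. subgroup (G i) M" and p: "\<And>i. p i \<in> hom M M"
    and same: "\<And>i x. x \<in> G i \<Longrightarrow> p i x = x"
    and other: "\<And>i j x. x \<in> G j \<Longrightarrow> i \<noteq> j \<Longrightarrow> p i x = \<one>\<^bsub>M\<^esub>"
    and gen: "carrier M \<subseteq> generate M (\<Union>i. G i)"
  shows "graded_group M G"
proof -
  interpret comm_group M by fact
  note decomp = is_decomposition_gfinprod[OF M]
  have Gc: "G i \<subseteq> carrier M" for i by (rule subgroup.subset[OF sub])
  have G1: "\<one>\<^bsub>M\<^esub> \<in> G i" for i by (rule subgroup.one_closed[OF sub])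
  have single: "is_decomposition M G x (\<lambda>j. if j = i then x else \<one>\<^bsub>M\<^esub>)" if "x \<in> G i" for x i
    using that Gc[of i] by (auto simp: decomp G1 gfinprod_single[OF M, of _ i])
  have ex: "\<exists>f. is_decomposition M G x f" if "x \<in> generate M (\<Union>i. G i)" for x
    using that
  proof (induction rule: generate.induct)
    case one
    show ?case using single[OF G1] by auto
  next
    case (incl h)
    then show ?case using single by blast
  next
    case (inv h)
    then show ?case using single[OF subgroup.m_inv_closed[OF sub]] by auto
  next
    case (eng h1 h2)
    then obtain f1 f2 where f: "is_decomposition M G h1 f1" "is_decomposition M G h2 f2" by blast
    have "is_decomposition M G (h1 \<otimes> h2) (\<lambda>i. f1 i \<otimes> f2 i)"
      unfolding decomp
    proof (intro conjI allI)
      show "f1 i \<otimes> f2 i \<in> G i" for i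
        using f unfolding decomp by (simp add: subgroup.m_closed[OF sub])
      show "finite {i. f1 i \<otimes> f2 i \<noteq> \<one>}"
        using f unfolding decomp
        by (auto intro!: finite_subset[of _ "{i. f1 i \<noteq> \<one>} \<union> {i. f2 i \<noteq> \<one>}"])
      show "h1 \<otimes> h2 = gfinprod M (\<lambda>i. f1 i \<otimes> f2 i) UNIV"
        using f Gc unfolding decomp by (subst gfinprod_distrib) (auto simp: subset_iff)
    qed
    then show ?case by blast
  qed
  have uniq: "f i = p i x" if "is_decomposition M G x f" for x f i
  proof -
    have f: "\<And>j. f j \<in> G j" and fin: "finite {j. f j \<noteq> \<one>}" and x: "x = gfinprod M f UNIV"
      using that by (auto simp: decomp)
    have "p i x = gfinprod M (\<lambda>j. p i (f j)) UNIV"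
      unfolding x by (rule gfinprod_hom[OF M M p fin]) (use f Gc in blast)
    also have "\<dots> = p i (f i)"
      by (rule gfinprod_single[OF M]) (use f Gc same other[OF f] in \<open>auto simp: subset_iff\<close>)
    finally show ?thesis using f same by simp
  qed
  show ?thesis
  proof (intro graded_group.intro graded_group_axioms.intro M)
    fix x assume "x \<in> carrier M"
    then obtain f where f: "is_decomposition M G x f" using ex gen by blast
    show "\<exists>!f. is_decomposition M G x f"
    proof (rule ex1I[of _ f])
      fix g assume "is_decomposition M G x g"
      then show "g = f" using uniq[OF f] uniq by (intro ext) metis
    qed (rule f)
  qed (rule sub)
qed

lemma hom_mult_hom:
  assumes "comm_group B" "h \<in> hom M B" "k \<in> hom M B"
  shows "(\<lambda>x. h x \<otimes>\<^bsub>B\<^esub> k x) \<in> hom M B"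
proof -
  interpret comm_group B by fact
  show ?thesis using assms by (auto simp: hom_def Pi_iff m_ac)
qed

text \<open>The map out of a direct sum given by a family of maps on the summands. Only the values
  of \<open>h i\<close> on \<open>G i\<close> matter.\<close>

definition gext :: "('a, 'm) monoid_scheme \<Rightarrow> (int \<Rightarrow> 'a set) \<Rightarrow> ('b, 'n) monoid_scheme \<Rightarrow>
    (int \<Rightarrow> 'a \<Rightarrow> 'b) \<Rightarrow> 'a \<Rightarrow> 'b" where
  "gext M G B h x = gfinprod B (\<lambda>i. h i (gcomp M G x i)) UNIV"

context graded_group
begin

context
  fixes B :: "('b, 'n) monoid_scheme" and h :: "int \<Rightarrow> 'a \<Rightarrow> 'b"
  assumes B: "comm_group B"
    and h_closed: "\<And>i x. x \<in> G i \<Longrightarrow> h i x \<in> carrier B"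
    and h_mult: "\<And>i x y. x \<in> G i \<Longrightarrow> y \<in> G i \<Longrightarrow> h i (x \<otimes> y) = h i x \<otimes>\<^bsub>B\<^esub> h i y"
begin

text \<open>Additivity on \<open>G i\<close> makes \<open>h i \<one>\<close> idempotent in a group,
  hence neutral. Vanishing components therefore do not enlarge the support.\<close>

lemma gext_one: "h i \<one> = \<one>\<^bsub>B\<^esub>"
proof -
  interpret B: comm_group B by (rule B)
  have "h i \<one> = h i \<one> \<otimes>\<^bsub>B\<^esub> h i \<one>"
    using h_mult[OF deg_one deg_one, of i] by simp
  then show ?thesis
    using h_closed[OF deg_one, of i] by simp
qed

lemma gext_finite: "x \<in> carrier M \<Longrightarrow> finite {i. h i (gcomp M G x i) \<noteq> \<one>\<^bsub>B\<^esub>}"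
  by (rule finite_subset[OF _ gcomp_finite[of x]]) (auto simp: gext_one)

lemma gext_hom: "gext M G B h \<in> hom M B"
proof -
  interpret B: comm_group B by (rule B)
  show ?thesis
    unfolding gext_def
    by (rule homI)
      (auto simp: gcomp_mult gcomp_deg h_mult h_closed gext_finite B.gfinprod_distrib)
qed

lemma gext_homogeneous: "x \<in> G i \<Longrightarrow> gext M G B h x = h i x"
  unfolding gext_def
  by (subst gfinprod_single[OF B, of _ i])
    (auto simp: gcomp_homogeneous h_closed gext_one)

end
end

section \<open>Small sets\<close>

context small_universe
begin

text \<open>A two-element subset of an infinite small set is a small index set, so a binary union is
  an instance of \<open>small_Union\<close>.\<close>

lemma small_Un: "A \<in> U \<Longrightarrow> B \<in> U \<Longrightarrow> A \<union> B \<in> U"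
proof -
  assume A: "A \<in> U" and B: "B \<in> U"
  obtain X where X: "X \<in> U" "infinite X" using small_infinite by blast
  then obtain a b where ab: "a \<in> X" "b \<in> X" "a \<noteq> b"
    by (metis finite.emptyI finite.insertI insertCI subsetI subset_antisym insert_iff empty_iff)
  have "{a, b} \<in> U" using small_subset[OF X(1)] ab by simp
  then have "(\<Union>i\<in>{a, b}. if i = a then A else B) \<in> U"
    by (rule small_Union) (use A B in auto)
  then show ?thesis using ab by (simp add: Un_commute)
qed

lemma small_infinite_superset:
  assumes "A \<in> U" obtains X where "X \<in> U" "infinite X" "A \<subseteq> X"
  using small_infinite small_Un[OF assms] by (metis Un_upper1 Un_upper2 finite_subset)

lemma small_code:
  fixes S :: "'b set" and X :: "'u set"
  assumes "X \<in> U" "S \<lesssim> X"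
  obtains e :: "'b \<Rightarrow> 'u" where "inj_on e S" "e ` S \<in> U"
  using assms small_subset[OF assms(1)] by (auto simp: lepoll_def)

end

lemma times_lepoll_infinite:
  assumes "infinite X" "A \<lesssim> X" "B \<lesssim> X"
  shows "A \<times> B \<lesssim> X"
proof -
  have "A \<times> B \<lesssim> X \<times> X"
    using assms by (intro times_lepoll_mono)
  also have "X \<times> X \<approx> X"
    using assms(1) by (simp add: eqpoll_iff_card_of_ordIso card_of_Times_same_infinite)
  finally show ?thesis .
qed

text \<open>On an infinite basis the free abelian group is no larger than the basis. Enlarging the
  generators to \<open>X \<times> X\<close> puts the finite case under the same estimate.\<close>

lemma free_Abelian_group_lepoll:
  assumes "infinite X" "A \<subseteq> X \<times> X"
  shows "carrier (free_Abelian_group A) \<lesssim> X"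
proof -
  have "carrier (free_Abelian_group A) \<lesssim> carrier (free_Abelian_group (X \<times> X))"
    using assms(2) by (intro subset_imp_lepoll) (auto simp: subset_iff)
  also have "carrier (free_Abelian_group (X \<times> X)) \<approx> X \<times> X"
    using assms(1) by (intro eqpoll_free_Abelian_group_infinite) (auto simp: finite_cartesian_product_iff)
  also have "X \<times> X \<lesssim> X"
    using times_lepoll_infinite assms(1) lepoll_refl by blast
  finally show ?thesis .
qed

section \<open>Tensor products\<close>

locale tensor_setting = small_universe U + M: graded_module R M + D: graded_bimodule R D
  for U :: "'u set set" and R :: "'u gring" and M :: "'u gmod" and D :: "'u gbimod" +
  assumes M_small: "carrier M \<in> U" and D_small: "carrier (rmod D) \<in> U"

definition balanced ::
    "'u gring \<Rightarrow> 'u gmod \<Rightarrow> 'u gbimod \<Rightarrow> ('b, 'm) monoid_scheme \<Rightarrow> ('u \<Rightarrow> 'u \<Rightarrow> 'b) \<Rightarrow> bool" where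
  "balanced R M D B g \<longleftrightarrow>
     (\<forall>x\<in>carrier M. \<forall>d\<in>carrier (rmod D). g x d \<in> carrier B) \<and>
     (\<forall>x\<in>carrier M. \<forall>y\<in>carrier M. \<forall>d\<in>carrier (rmod D). g (x \<otimes>\<^bsub>M\<^esub> y) d = g x d \<otimes>\<^bsub>B\<^esub> g y d) \<and>
     (\<forall>x\<in>carrier M. \<forall>d\<in>carrier (rmod D). \<forall>e\<in>carrier (rmod D).
        g x (d \<otimes>\<^bsub>rmod D\<^esub> e) = g x d \<otimes>\<^bsub>B\<^esub> g x e) \<and>
     (\<forall>x\<in>carrier M. \<forall>r\<in>carrier R. \<forall>d\<in>carrier (rmod D). g (ract M x r) d = g x (lact D r d))"

lemma balancedI:
  assumes "\<And>x d. x \<in> carrier M \<Longrightarrow> d \<in> carrier (rmod D) \<Longrightarrow> g x d \<in> carrier B"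
    "\<And>x y d. x \<in> carrier M \<Longrightarrow> y \<in> carrier M \<Longrightarrow> d \<in> carrier (rmod D) \<Longrightarrow>
      g (x \<otimes>\<^bsub>M\<^esub> y) d = g x d \<otimes>\<^bsub>B\<^esub> g y d"
    "\<And>x d e. x \<in> carrier M \<Longrightarrow> d \<in> carrier (rmod D) \<Longrightarrow> e \<in> carrier (rmod D) \<Longrightarrow>
      g x (d \<otimes>\<^bsub>rmod D\<^esub> e) = g x d \<otimes>\<^bsub>B\<^esub> g x e"
    "\<And>x r d. x \<in> carrier M \<Longrightarrow> r \<in> carrier R \<Longrightarrow> d \<in> carrier (rmod D) \<Longrightarrow>
      g (ract M x r) d = g x (lact D r d)"
  shows "balanced R M D B g"
  using assms by (simp add: balanced_def)

context tensor_setting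
begin

abbreviation "F \<equiv> tensor_free M D"
abbreviation "N \<equiv> generate F (tensor_relations R M D)"
abbreviation "Q \<equiv> tensor_quotient R M D"
abbreviation "T \<equiv> tensor_group U R M D"
abbreviation "code \<equiv> tensor_code U R M D"
abbreviation ptens (infixl "\<odot>" 75) where "x \<odot> d \<equiv> pure U R M D x d"

lemma F_comm_group: "comm_group F"
  by (simp add: tensor_free_def abelian_free_Abelian_group)

lemma F_group: "group F"
  by (simp add: tensor_free_def)

lemma frag_closed: "x \<in> carrier M \<Longrightarrow> d \<in> carrier (rmod D) \<Longrightarrow> frag_of (x, d) \<in> carrier F"
  by (simp add: tensor_free_def)

lemma F_diff: "a \<in> carrier F \<Longrightarrow> b \<in> carrier F \<Longrightarrow> a - b = a \<otimes>\<^bsub>F\<^esub> inv\<^bsub>F\<^esub> b"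
  by (simp add: tensor_free_def)

lemma F_diff_closed: "a \<in> carrier F \<Longrightarrow> b \<in> carrier F \<Longrightarrow> a - b \<in> carrier F"
  by (simp add: F_diff group.inv_closed[OF F_group] monoid.m_closed[OF group.is_monoid[OF F_group]])

lemma relations_closed: "tensor_relations R M D \<subseteq> carrier F"
  unfolding tensor_relations_def
  by (auto intro!: F_diff_closed frag_closed D.ract_closed M.ract_closed D.lact_closed)

lemma N_normal: "N \<lhd> F"
  by (intro comm_group.subgroup_imp_normal[OF F_comm_group] group.generate_is_subgroup[OF F_group]
      relations_closed)

lemma Q_eq: "Q = F Mod N"
  by (simp add: tensor_quotient_def)

lemma Q_comm_group: "comm_group Q"
  unfolding Q_eq by (intro comm_group.abelian_FactGroup[OF F_comm_group]
      group.generate_is_subgroup[OF F_group] relations_closed)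

text \<open>The quotient is an image of a free group on pairs from a small infinite set. This
  justifies the choice made in \<open>tensor_code\<close>.\<close>

lemma Q_small: "\<exists>e. inj_on e (carrier Q) \<and> e ` carrier Q \<in> U"
proof -
  obtain X where X: "X \<in> U" "infinite X" "carrier M \<union> carrier (rmod D) \<subseteq> X"
    using small_infinite_superset[OF small_Un[OF M_small D_small]] by blast
  have "carrier Q = (\<lambda>a. N #>\<^bsub>F\<^esub> a) ` carrier F"
    by (auto simp: Q_eq FactGroup_def RCOSETS_def)
  then have "carrier Q \<lesssim> carrier F"
    by (simp add: image_lepoll)
  also have "carrier F \<lesssim> X"
    unfolding tensor_free_def using X by (intro free_Abelian_group_lepoll) auto
  finally obtain e :: "_ \<Rightarrow> 'u" where "inj_on e (carrier Q)" "e ` carrier Q \<in> U"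
    using small_code[OF X(1)] by blast
  then show ?thesis by blast
qed

lemma code_inj: "inj_on code (carrier Q)" and code_small: "code ` carrier Q \<in> U"
  using someI_ex[OF Q_small] by (simp_all add: tensor_code_def)

lemma T_carrier: "carrier T = code ` carrier Q"
  by (simp add: tensor_group_def Let_def)

lemma T_small: "carrier T \<in> U"
  by (simp add: T_carrier code_small)

lemma T_mult: "a \<in> carrier Q \<Longrightarrow> b \<in> carrier Q \<Longrightarrow> code a \<otimes>\<^bsub>T\<^esub> code b = code (a \<otimes>\<^bsub>Q\<^esub> b)"
  using code_inj by (simp add: tensor_group_def Let_def)

lemma T_one: "\<one>\<^bsub>T\<^esub> = code \<one>\<^bsub>Q\<^esub>"
  by (simp add: tensor_group_def Let_def)

lemma code_iso: "code \<in> iso Q T"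
  using code_inj by (auto simp: iso_def hom_def T_mult T_carrier bij_betw_def)

lemma T_comm_group: "comm_group T"
proof -
  interpret Q: comm_group Q by (rule Q_comm_group)
  have "comm_group (T\<lparr>one := code \<one>\<^bsub>Q\<^esub>\<rparr>)"
    by (rule Q.iso_imp_img_comm_group[OF code_iso])
  moreover have "T\<lparr>one := code \<one>\<^bsub>Q\<^esub>\<rparr> = T"
    by (simp add: T_one[symmetric])
  ultimately show ?thesis by simp
qed

lemma coset_closed: "a \<in> carrier F \<Longrightarrow> N #>\<^bsub>F\<^esub> a \<in> carrier Q"
  by (auto simp: Q_eq FactGroup_def RCOSETS_def)

lemma coset_mult: "a \<in> carrier F \<Longrightarrow> b \<in> carrier F \<Longrightarrow>
    N #>\<^bsub>F\<^esub> (a \<otimes>\<^bsub>F\<^esub> b) = (N #>\<^bsub>F\<^esub> a) \<otimes>\<^bsub>Q\<^esub> (N #>\<^bsub>F\<^esub> b)"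
  by (simp add: Q_eq FactGroup_def normal.rcos_sum[OF N_normal])

definition cls :: "('u \<times> 'u \<Rightarrow>\<^sub>0 int) \<Rightarrow> 'u" where
  "cls a = code (N #>\<^bsub>F\<^esub> a)"

lemma cls_hom: "cls \<in> hom F T"
  by (auto simp: hom_def cls_def coset_mult T_mult coset_closed T_carrier)

lemma cls_surj: "t \<in> carrier T \<Longrightarrow> \<exists>a\<in>carrier F. t = cls a"
  by (auto simp: T_carrier Q_eq FactGroup_def RCOSETS_def cls_def)

lemma cls_frag: "cls (frag_of (x, d)) = x \<odot> d"
  by (simp add: cls_def pure_def)

lemma cls_relation: "a \<in> tensor_relations R M D \<Longrightarrow> cls a = \<one>\<^bsub>T\<^esub>"
proof -
  assume "a \<in> tensor_relations R M D"
  then have "a \<in> N" by (rule generate.incl)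
  then have "N #>\<^bsub>F\<^esub> a = N"
    using N_normal F_group by (meson group.coset_join2 normal_imp_subgroup subgroup.mem_carrier)
  then show ?thesis by (simp add: cls_def T_one Q_eq)
qed

lemma pure_closed: "x \<in> carrier M \<Longrightarrow> d \<in> carrier (rmod D) \<Longrightarrow> x \<odot> d \<in> carrier T"
  using hom_in_carrier[OF cls_hom frag_closed] by (simp add: cls_frag)

sublocale Tg: comm_group T by (rule T_comm_group)

lemma cls_diff: "a \<in> carrier F \<Longrightarrow> b \<in> carrier F \<Longrightarrow> cls (a - b) = cls a \<otimes>\<^bsub>T\<^esub> inv\<^bsub>T\<^esub> cls b"
proof -
  interpret group_hom F T cls
    by (simp add: group_hom_def group_hom_axioms_def F_group cls_hom)
  show "a \<in> carrier F \<Longrightarrow> b \<in> carrier F \<Longrightarrow> ?thesis" by (simp add: F_diff)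
qed

lemma pure_add_left:
  assumes "x \<in> carrier M" "y \<in> carrier M" "d \<in> carrier (rmod D)"
  shows "(x \<otimes>\<^bsub>M\<^esub> y) \<odot> d = (x \<odot> d) \<otimes>\<^bsub>T\<^esub> (y \<odot> d)"
proof -
  have "cls (frag_of (x \<otimes>\<^bsub>M\<^esub> y, d) - frag_of (x, d) - frag_of (y, d)) = \<one>\<^bsub>T\<^esub>"
    by (rule cls_relation) (use assms in \<open>auto simp: tensor_relations_def\<close>)
  then have "((x \<otimes>\<^bsub>M\<^esub> y) \<odot> d) \<otimes>\<^bsub>T\<^esub> inv\<^bsub>T\<^esub> (x \<odot> d) \<otimes>\<^bsub>T\<^esub> inv\<^bsub>T\<^esub> (y \<odot> d) = \<one>\<^bsub>T\<^esub>"
    using assms by (simp add: cls_diff F_diff_closed frag_closed cls_frag)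
  then show ?thesis
    using assms by (smt (verit) Tg.inv_closed Tg.inv_solve_right' Tg.m_closed Tg.m_comm Tg.one_closed Tg.r_one Tg.l_one M.m_closed pure_closed)
qed

lemma pure_add_right:
  assumes "x \<in> carrier M" "d \<in> carrier (rmod D)" "e \<in> carrier (rmod D)"
  shows "x \<odot> (d \<otimes>\<^bsub>rmod D\<^esub> e) = (x \<odot> d) \<otimes>\<^bsub>T\<^esub> (x \<odot> e)"
proof -
  have "cls (frag_of (x, d \<otimes>\<^bsub>rmod D\<^esub> e) - frag_of (x, d) - frag_of (x, e)) = \<one>\<^bsub>T\<^esub>"
    by (rule cls_relation) (use assms in \<open>auto simp: tensor_relations_def\<close>)
  then have "(x \<odot> (d \<otimes>\<^bsub>rmod D\<^esub> e)) \<otimes>\<^bsub>T\<^esub> inv\<^bsub>T\<^esub> (x \<odot> d) \<otimes>\<^bsub>T\<^esub> inv\<^bsub>T\<^esub> (x \<odot> e) = \<one>\<^bsub>T\<^esub>"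
    using assms by (simp add: cls_diff F_diff_closed frag_closed cls_frag)
  then show ?thesis
    using assms by (smt (verit) Tg.inv_closed Tg.inv_solve_right' Tg.m_closed Tg.m_comm Tg.one_closed Tg.r_one Tg.l_one D.m_closed pure_closed)
qed

lemma pure_balanced:
  assumes "x \<in> carrier M" "r \<in> carrier R" "d \<in> carrier (rmod D)"
  shows "ract M x r \<odot> d = x \<odot> lact D r d"
proof -
  have "cls (frag_of (ract M x r, d) - frag_of (x, lact D r d)) = \<one>\<^bsub>T\<^esub>"
    by (rule cls_relation) (use assms in \<open>auto simp: tensor_relations_def\<close>)
  then have "(ract M x r \<odot> d) \<otimes>\<^bsub>T\<^esub> inv\<^bsub>T\<^esub> (x \<odot> lact D r d) = \<one>\<^bsub>T\<^esub>"
    using assms by (simp add: cls_diff frag_closed cls_frag M.ract_closed D.lact_closed)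
  then show ?thesis
    using assms by (simp add: Tg.inv_solve_right' M.ract_closed D.lact_closed pure_closed)
qed

lemma pure_one_left: "d \<in> carrier (rmod D) \<Longrightarrow> \<one>\<^bsub>M\<^esub> \<odot> d = \<one>\<^bsub>T\<^esub>"
  using pure_add_left[of "\<one>\<^bsub>M\<^esub>" "\<one>\<^bsub>M\<^esub>" d] pure_closed[of "\<one>\<^bsub>M\<^esub>" d] by simp

lemma pure_one_right: "x \<in> carrier M \<Longrightarrow> x \<odot> \<one>\<^bsub>rmod D\<^esub> = \<one>\<^bsub>T\<^esub>"
  using pure_add_right[of x "\<one>\<^bsub>rmod D\<^esub>" "\<one>\<^bsub>rmod D\<^esub>"] pure_closed[of x "\<one>\<^bsub>rmod D\<^esub>"] by simp

lemma pure_inv: "x \<in> carrier M \<Longrightarrow> d \<in> carrier (rmod D) \<Longrightarrow> inv\<^bsub>T\<^esub> (x \<odot> d) = (inv\<^bsub>M\<^esub> x) \<odot> d"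
  using pure_add_left[of "inv\<^bsub>M\<^esub> x" x d]
  by (intro Tg.inv_equality) (simp_all add: pure_one_left pure_closed)

text \<open>Induction on the free abelian group proceeds by differences, so \<open>P\<close> is
  proved for each class together with its inverse. The inverse of a pure tensor is again pure and
  the neutral element is the pure tensor of neutral elements, so closure of \<open>P\<close> under
  products is enough.\<close>

lemma tensor_induct [consumes 1, case_names pure mult]:
  assumes t: "t \<in> carrier T"
    and pure: "\<And>x d. x \<in> carrier M \<Longrightarrow> d \<in> carrier (rmod D) \<Longrightarrow> P (x \<odot> d)"
    and mult: "\<And>s t. s \<in> carrier T \<Longrightarrow> t \<in> carrier T \<Longrightarrow> P s \<Longrightarrow> P t \<Longrightarrow> P (s \<otimes>\<^bsub>T\<^esub> t)"
  shows "P t"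
proof -
  have inv: "P (inv\<^bsub>T\<^esub> cls a) \<and> P (cls a)" if "a \<in> carrier F" for a
    using that unfolding tensor_free_def carrier_free_Abelian_group_iff
  proof (induction a rule: free_Abelian_group_induct[consumes 1])
    case 1
    have "cls 0 = \<one>\<^bsub>T\<^esub>"
      using cls_diff[of 0 0] group_hom.hom_one[of F T cls] cls_hom F_group
      by (simp add: group_hom_def group_hom_axioms_def tensor_free_def)
    then show ?case
      using pure[of "\<one>\<^bsub>M\<^esub>" "\<one>\<^bsub>rmod D\<^esub>"] pure_one_left[of "\<one>\<^bsub>rmod D\<^esub>"] by simp
  next
    case (2 x y)
    then have xy: "x \<in> carrier F" "y \<in> carrier F" by (simp_all add: tensor_free_def)
    then have "cls x \<in> carrier T" "cls y \<in> carrier T" using hom_in_carrier[OF cls_hom] by auto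
    then show ?case
      using 2 mult[of "cls x" "inv\<^bsub>T\<^esub> cls y"] mult[of "inv\<^bsub>T\<^esub> cls x" "cls y"]
      by (simp add: cls_diff[OF xy] Tg.inv_mult)
  next
    case (3 a)
    then show ?case using pure by (cases a) (auto simp: cls_frag pure_inv)
  qed
  then show ?thesis using cls_surj[OF t] by auto
qed

lemma tensor_hom_eqI:
  assumes "h \<in> hom T B" "k \<in> hom T B"
    "\<And>x d. x \<in> carrier M \<Longrightarrow> d \<in> carrier (rmod D) \<Longrightarrow> h (x \<odot> d) = k (x \<odot> d)"
    "t \<in> carrier T"
  shows "h t = k t"
  using assms(4)
proof (induction rule: tensor_induct)
  case (mult s t)
  then show ?case by (simp add: hom_mult[OF assms(1)] hom_mult[OF assms(2)])
qed (rule assms(3))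

text \<open>Justifies the definite description in \<open>tensor_lift\<close>; extensionality makes
  the map unique as a function. The map is built on the free group, descends because the relations
  lie in the kernel, and is then composed with decoding.\<close>

lemma tensor_universal:
  assumes B: "comm_group B" and g: "balanced R M D B g"
  shows "\<exists>!h. h \<in> hom T B \<and> h \<in> extensional (carrier T) \<and>
    (\<forall>x\<in>carrier M. \<forall>d\<in>carrier (rmod D). h (x \<odot> d) = g x d)"
proof -
  interpret B: comm_group B by (rule B)
  obtain h0 where h0: "h0 \<in> hom F B" and
    h0f: "\<And>x d. x \<in> carrier M \<Longrightarrow> d \<in> carrier (rmod D) \<Longrightarrow> h0 (frag_of (x, d)) = g x d"
  proof (rule B.free_Abelian_group_universal[of "\<lambda>(x, d). g x d" "carrier M \<times> carrier (rmod D)"])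
    show "(\<lambda>(x, d). g x d) ` (carrier M \<times> carrier (rmod D)) \<subseteq> carrier B"
      using g by (auto simp: balanced_def)
  qed (auto simp: tensor_free_def)
  interpret h0: group_hom F B h0
    by (simp add: group_hom_def group_hom_axioms_def F_group h0 B.group_axioms)
  have h0_diff: "h0 (a - b) = h0 a \<otimes>\<^bsub>B\<^esub> inv\<^bsub>B\<^esub> h0 b" if "a \<in> carrier F" "b \<in> carrier F" for a b
    using that by (simp add: F_diff)
  \<comment> \<open>Once \<open>g\<close> is known to be additive in one argument, the image of the
    corresponding relation is a commutator.\<close>
  have cancel: "a \<otimes>\<^bsub>B\<^esub> b \<otimes>\<^bsub>B\<^esub> inv\<^bsub>B\<^esub> a \<otimes>\<^bsub>B\<^esub> inv\<^bsub>B\<^esub> b = \<one>\<^bsub>B\<^esub>"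
    if "a \<in> carrier B" "b \<in> carrier B" for a b
    using that by (metis B.inv_closed B.m_assoc B.m_closed B.m_comm B.r_inv B.r_one)
  have "tensor_relations R M D \<subseteq> kernel F B h0"
  proof
    fix a assume a: "a \<in> tensor_relations R M D"
    have "h0 a = \<one>\<^bsub>B\<^esub>"
      using a g unfolding tensor_relations_def
      by (auto simp: h0_diff F_diff_closed frag_closed h0f M.ract_closed D.lact_closed balanced_def
          cancel)
    then show "a \<in> kernel F B h0"
      using a relations_closed by (auto simp: kernel_def)
  qed
  then have "N \<subseteq> kernel F B h0"
    by (intro group.generate_subgroup_incl[OF F_group] h0.subgroup_kernel)
  then obtain h1 where h1: "h1 \<in> hom Q B" "\<And>a. a \<in> carrier F \<Longrightarrow> h1 (N #>\<^bsub>F\<^esub> a) = h0 a"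
    using h0.FactGroup_universal_kernel[OF N_normal] unfolding Q_eq by metis
  define h where "h = restrict (h1 \<circ> inv_into (carrier Q) code) (carrier T)"
  have hcode: "h (code q) = h1 q" if "q \<in> carrier Q" for q
    using that code_inj by (simp add: h_def T_carrier)
  interpret Q: comm_group Q by (rule Q_comm_group)
  have hh: "h \<in> hom T B"
  proof (rule homI)
    fix s t assume "s \<in> carrier T" "t \<in> carrier T"
    then obtain a b where "a \<in> carrier Q" "b \<in> carrier Q" "s = code a" "t = code b"
      by (auto simp: T_carrier)
    then show "h (s \<otimes>\<^bsub>T\<^esub> t) = h s \<otimes>\<^bsub>B\<^esub> h t"
      using hom_mult[OF h1(1)] by (simp add: T_mult hcode)
  qed (use hcode hom_in_carrier[OF h1(1)] in \<open>auto simp: T_carrier\<close>)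
  have hp: "h (x \<odot> d) = g x d" if "x \<in> carrier M" "d \<in> carrier (rmod D)" for x d
    using that by (simp add: pure_def hcode coset_closed frag_closed h1(2) h0f)
  show ?thesis
  proof (rule ex1I[of _ h])
    fix k assume k: "k \<in> hom T B \<and> k \<in> extensional (carrier T) \<and>
      (\<forall>x\<in>carrier M. \<forall>d\<in>carrier (rmod D). k (x \<odot> d) = g x d)"
    show "k = h"
      by (rule extensionalityI[of _ "carrier T"])
        (use k hp hh tensor_hom_eqI[of k B h] in \<open>auto simp: h_def\<close>)
  qed (use hh hp in \<open>auto simp: h_def\<close>)
qed

lemma tensor_lift:
  assumes "comm_group B" "balanced R M D B g"
  shows tensor_lift_hom: "tensor_lift U R M D B g \<in> hom T B"
    and tensor_lift_extensional: "tensor_lift U R M D B g \<in> extensional (carrier T)"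
    and tensor_lift_pure: "x \<in> carrier M \<Longrightarrow> d \<in> carrier (rmod D) \<Longrightarrow>
      tensor_lift U R M D B g (x \<odot> d) = g x d"
  using theI'[OF tensor_universal[OF assms]] by (simp_all add: tensor_lift_def)

end

section \<open>The category of graded modules\<close>

text \<open>Records such as \<open>add_monoid R\<close>, \<open>reg_mod R\<close>, a shift, or
  \<open>tensor_group\<close> and \<open>tensor\<close> share these three fields without being
  equal. Group and grading facts depend on the three fields only.\<close>

lemma same_comm_group:
  assumes "comm_group M" "carrier N = carrier M" "mult N = mult M" "one N = one M"
  shows "comm_group N"
proof -
  interpret comm_group M by fact
  show ?thesis
    by (rule comm_groupI) (unfold assms(2-4), auto simp: m_assoc intro: m_comm l_inv_ex)
qed

lemma same_subgroup:
  assumes "carrier N = carrier M" "mult N = mult M" "one N = one M"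
  shows "subgroup H N \<longleftrightarrow> subgroup H M"
  by (simp add: subgroup_def m_inv_def assms)

lemma same_decomposition:
  assumes "carrier N = carrier M" "mult N = mult M" "one N = one M"
  shows "is_decomposition N G x f \<longleftrightarrow> is_decomposition M G x f"
  by (simp add: is_decomposition_def finprod_def assms)

lemma same_graded_group:
  assumes "graded_group M G" "carrier N = carrier M" "mult N = mult M" "one N = one M"
  shows "graded_group N G"
proof -
  interpret graded_group M G by fact
  show ?thesis
    by (intro graded_group.intro same_comm_group[OF comm_group_axioms] graded_group_axioms.intro)
      (simp_all add: assms same_subgroup[OF assms(2-4)] same_decomposition[OF assms(2-4)]
        degree_subgroup direct_sum)
qed

lemma (in graded_ring) ring_graded_induct [consumes 1, case_names homogeneous add]:
  assumes "r \<in> carrier R" "\<And>i r. r \<in> rdeg R i \<Longrightarrow> P r"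
    "\<And>r s. r \<in> carrier R \<Longrightarrow> s \<in> carrier R \<Longrightarrow> P r \<Longrightarrow> P s \<Longrightarrow> P (r \<oplus> s)"
  shows "P r"
  by (rule graded_induct[of r P]) (use assms in auto)

lemma (in graded_ring) rdeg_closed: "r \<in> rdeg R i \<Longrightarrow> r \<in> carrier R"
  using deg_closed by simp

lemma (in graded_module) ract_one_left: "r \<in> carrier R \<Longrightarrow> ract M \<one>\<^bsub>M\<^esub> r = \<one>\<^bsub>M\<^esub>"
  using ract_add_left[of "\<one>\<^bsub>M\<^esub>" "\<one>\<^bsub>M\<^esub>" r] ract_closed[of "\<one>\<^bsub>M\<^esub>" r] by simp

text \<open>Both sides of the linearity law are additive in \<open>x\<close> and in
  \<open>r\<close>, so induction over components in each variable reduces it to homogeneous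
  elements.\<close>

lemma is_graded_mapI:
  assumes M: "graded_module R M" and N: "graded_module R N" and f: "f \<in> hom M N"
    and lin: "\<And>i j x r. x \<in> deg M i \<Longrightarrow> r \<in> rdeg R j \<Longrightarrow> f (ract M x r) = ract N (f x) r"
    and deg: "\<And>i x. x \<in> deg M i \<Longrightarrow> f x \<in> deg N i"
  shows "is_graded_map R M N f"
proof -
  interpret M: graded_module R M by fact
  interpret N: graded_module R N by fact
  have fc: "x \<in> carrier M \<Longrightarrow> f x \<in> carrier N" for x using f hom_in_carrier by metis
  have "f (ract M x r) = ract N (f x) r" if "x \<in> carrier M" "r \<in> carrier R" for x r
    using that(2,1)
  proof (induction r arbitrary: x rule: M.R.ring_graded_induct)
    case (homogeneous j r)
    then have r: "r \<in> carrier R" by (simp add: M.R.rdeg_closed)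
    from homogeneous(2) show ?case
    proof (induction x rule: M.graded_induct)
      case (mult x y)
      then show ?case
        by (simp add: M.ract_add_left N.ract_add_left hom_mult[OF f] M.ract_closed fc r)
    qed (use lin homogeneous in blast)
  next
    case (add r s)
    then show ?case
      by (simp add: M.ract_add_right N.ract_add_right hom_mult[OF f] M.ract_closed fc)
  qed
  with f deg show ?thesis by (auto simp: is_graded_map_def)
qed

lemma GrMod_Obj [simp]: "M \<in> Obj (GrMod U R) \<longleftrightarrow> graded_module R M \<and> carrier M \<in> U"
  by (simp add: GrMod_def)

lemma GrMod_Hom: "f \<in> Hom (GrMod U R) M N \<longleftrightarrow>
    source f = M \<and> target f = N \<and> M \<in> Obj (GrMod U R) \<and> N \<in> Obj (GrMod U R) \<and>
    mor f \<in> extensional (carrier M) \<and> is_graded_map R M N (mor f)"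
  by (auto simp: GrMod_def Hom_def)

lemma Hom_objs:
  assumes "f \<in> Hom (GrMod U R) M N"
  shows Hom_source: "M \<in> Obj (GrMod U R)" and Hom_target: "N \<in> Obj (GrMod U R)"
    and Hom_source_module: "graded_module R M" and Hom_target_module: "graded_module R N"
  using assms by (auto simp: GrMod_Hom)

lemma Hom_facts:
  assumes "f \<in> Hom (GrMod U R) M N"
  shows Hom_hom: "mor f \<in> hom M N"
    and Hom_closed: "x \<in> carrier M \<Longrightarrow> mor f x \<in> carrier N"
    and Hom_mult: "x \<in> carrier M \<Longrightarrow> y \<in> carrier M \<Longrightarrow> mor f (x \<otimes>\<^bsub>M\<^esub> y) = mor f x \<otimes>\<^bsub>N\<^esub> mor f y"
    and Hom_ract: "x \<in> carrier M \<Longrightarrow> r \<in> carrier R \<Longrightarrow> mor f (ract M x r) = ract N (mor f x) r"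
    and Hom_deg: "x \<in> deg M i \<Longrightarrow> mor f x \<in> deg N i"
    and Hom_is_Arrow: "f = Arrow M N (mor f)"
proof -
  have "source f = M" "target f = N" and g: "is_graded_map R M N (mor f)"
    using assms by (simp_all add: GrMod_Hom)
  then show "f = Arrow M N (mor f)" by (cases f) simp
  show "mor f \<in> hom M N" using g by (simp add: is_graded_map_def)
  then show "x \<in> carrier M \<Longrightarrow> mor f x \<in> carrier N"
    "x \<in> carrier M \<Longrightarrow> y \<in> carrier M \<Longrightarrow> mor f (x \<otimes>\<^bsub>M\<^esub> y) = mor f x \<otimes>\<^bsub>N\<^esub> mor f y"
    by (auto simp: hom_def)
  show "x \<in> carrier M \<Longrightarrow> r \<in> carrier R \<Longrightarrow> mor f (ract M x r) = ract N (mor f x) r"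
    "x \<in> deg M i \<Longrightarrow> mor f x \<in> deg N i"
    using g unfolding is_graded_map_def by blast+
qed

lemma Hom_one: 
  assumes "f \<in> Hom (GrMod U R) M N" shows "mor f \<one>\<^bsub>M\<^esub> = \<one>\<^bsub>N\<^esub>"
proof -
  interpret M: graded_module R M using assms by (rule Hom_source_module)
  interpret N: graded_module R N using assms by (rule Hom_target_module)
  show ?thesis using Hom_hom[OF assms] M.is_group N.is_group hom_one by blast
qed

lemma Hom_eqI:
  assumes "f \<in> Hom (GrMod U R) M N" "g \<in> Hom (GrMod U R) M N"
    "\<And>x. x \<in> carrier M \<Longrightarrow> mor f x = mor g x"
  shows "f = g"
proof -
  have "mor f = mor g"
    by (rule extensionalityI[of _ "carrier M"]) (use assms in \<open>auto simp: GrMod_Hom\<close>)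
  then show ?thesis using Hom_is_Arrow[OF assms(1)] Hom_is_Arrow[OF assms(2)] by simp
qed

lemma Arrow_Hom:
  assumes "M \<in> Obj (GrMod U R)" "N \<in> Obj (GrMod U R)" "is_graded_map R M N f"
    "f \<in> extensional (carrier M)"
  shows "Arrow M N f \<in> Hom (GrMod U R) M N"
  using assms by (simp add: GrMod_Hom)

lemma restrict_graded_map:
  assumes M: "graded_module R M" and f: "is_graded_map R M N f"
  shows "is_graded_map R M N (restrict f (carrier M))"
proof -
  interpret M: graded_module R M by fact
  show ?thesis using f
    by (auto simp: is_graded_map_def hom_def Pi_iff M.ract_closed image_subset_iff M.deg_closed)
qed

lemma restrict_Hom:
  assumes "M \<in> Obj (GrMod U R)" "N \<in> Obj (GrMod U R)" "is_graded_map R M N f"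
  shows "Arrow M N (restrict f (carrier M)) \<in> Hom (GrMod U R) M N"
  using assms by (intro Arrow_Hom restrict_graded_map) auto

lemma GrMod_Id: "Id (GrMod U R) M = Arrow M M (\<lambda>x\<in>carrier M. x)"
  by (simp add: GrMod_def)

lemma mor_Id: "x \<in> carrier M \<Longrightarrow> mor (Id (GrMod U R) M) x = x"
  by (simp add: GrMod_Id)

lemma mor_Comp: "f \<in> Hom (GrMod U R) M N \<Longrightarrow> x \<in> carrier M \<Longrightarrow>
    mor (g \<bullet>\<^bsub>GrMod U R\<^esub> f) x = mor g (mor f x)"
  by (simp add: GrMod_def Hom_def compose_def)

lemma GrMod_Id_Hom: "M \<in> Obj (GrMod U R) \<Longrightarrow> Id (GrMod U R) M \<in> Hom (GrMod U R) M M"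
  unfolding GrMod_Id
  by (rule restrict_Hom) (auto simp: is_graded_map_def hom_def)

lemma GrMod_Comp_Hom:
  assumes f: "f \<in> Hom (GrMod U R) M N" and g: "g \<in> Hom (GrMod U R) N K"
  shows "g \<bullet>\<^bsub>GrMod U R\<^esub> f \<in> Hom (GrMod U R) M K"
proof -
  interpret M: graded_module R M using f by (rule Hom_source_module)
  have "g \<bullet>\<^bsub>GrMod U R\<^esub> f = Arrow M K (restrict (\<lambda>x. mor g (mor f x)) (carrier M))"
    using f g by (simp add: GrMod_def Hom_def compose_def)
  moreover have "is_graded_map R M K (\<lambda>x. mor g (mor f x))"
    using Hom_facts[OF f] Hom_facts[OF g] by (auto simp: is_graded_map_def hom_def)
  ultimately show ?thesis
    using restrict_Hom[OF Hom_source[OF f] Hom_target[OF g]] by metis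
qed

lemma GrMod_category: "category (GrMod U R)"
proof
  show "f \<in> Arr (GrMod U R) \<Longrightarrow> Dom (GrMod U R) f \<in> Obj (GrMod U R)"
    and "f \<in> Arr (GrMod U R) \<Longrightarrow> Cod (GrMod U R) f \<in> Obj (GrMod U R)" for f
    by (auto simp: GrMod_def)
  fix f x y assume f: "f \<in> Hom (GrMod U R) x y"
  show "f \<bullet>\<^bsub>GrMod U R\<^esub> Id (GrMod U R) x = f"
    using f GrMod_Comp_Hom[OF GrMod_Id_Hom f] Hom_source[OF f]
    by (intro Hom_eqI[of _ _ _ x y]) (simp_all add: mor_Comp[OF GrMod_Id_Hom] mor_Id)
  show "Id (GrMod U R) y \<bullet>\<^bsub>GrMod U R\<^esub> f = f"
    using f GrMod_Comp_Hom[OF f GrMod_Id_Hom] Hom_target[OF f]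
    by (intro Hom_eqI[of _ _ _ x y]) (simp_all add: mor_Comp[OF f] mor_Id Hom_closed[OF f])
next
  fix f g h w x y z
  assume f: "f \<in> Hom (GrMod U R) w x" and g: "g \<in> Hom (GrMod U R) x y"
    and h: "h \<in> Hom (GrMod U R) y z"
  note [intro] = GrMod_Comp_Hom
  show "h \<bullet>\<^bsub>GrMod U R\<^esub> g \<bullet>\<^bsub>GrMod U R\<^esub> f = h \<bullet>\<^bsub>GrMod U R\<^esub> (g \<bullet>\<^bsub>GrMod U R\<^esub> f)"
    using f g h GrMod_Comp_Hom[OF f g]
    by (intro Hom_eqI[of _ _ _ w z]) (auto simp: mor_Comp[where M = w] mor_Comp[where M = x] Hom_closed[OF f])
qed (rule GrMod_Id_Hom GrMod_Comp_Hom; assumption)+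

lemma (in category) is_inverse_unique:
  assumes "f \<in> Arr A" "is_inverse A f g" "is_inverse A f h"
  shows "g = h"
proof -
  have f: "f \<in> Hom A (Dom A f) (Cod A f)" using assms(1) by (simp add: Hom_def)
  have g: "g \<in> Hom A (Cod A f) (Dom A f)" and h: "h \<in> Hom A (Cod A f) (Dom A f)"
    using assms by (auto simp: is_inverse_def)
  have "g = (h \<bullet> f) \<bullet> g"
    using assms g by (simp add: is_inverse_def Id_Comp)
  also have "\<dots> = h \<bullet> (f \<bullet> g)" by (rule Comp_assoc[OF g f h])
  also have "\<dots> = h" using assms h by (simp add: is_inverse_def Comp_Id)
  finally show ?thesis .
qed

lemma (in category) inverse_arrI:
  assumes "f \<in> Arr A" "is_inverse A f g" shows "inverse_arr A f = g"
  unfolding inverse_arr_def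
  by (rule the_equality) (use assms is_inverse_unique in blast)+

lemma (in category) inverse_arr:
  assumes "is_iso A f" "f \<in> Hom A x y"
  shows inverse_arr_Hom: "inverse_arr A f \<in> Hom A y x"
    and inverse_arr_left: "inverse_arr A f \<bullet> f = Id A x"
    and inverse_arr_right: "f \<bullet> inverse_arr A f = Id A y"
proof -
  obtain g where f: "f \<in> Arr A" and g: "is_inverse A f g" using assms(1) by (auto simp: is_iso_def)
  from inverse_arrI[OF f g] g assms(2)
  show "inverse_arr A f \<in> Hom A y x" "inverse_arr A f \<bullet> f = Id A x" "f \<bullet> inverse_arr A f = Id A y"
    by (auto simp: is_inverse_def Hom_def)
qed

lemma GrMod_is_inverseI:
  assumes f: "f \<in> Hom (GrMod U R) M N" and g: "g \<in> Hom (GrMod U R) N M"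
    and gf: "\<And>x. x \<in> carrier M \<Longrightarrow> mor g (mor f x) = x"
    and fg: "\<And>y. y \<in> carrier N \<Longrightarrow> mor f (mor g y) = y"
  shows "is_inverse (GrMod U R) f g" and "is_iso (GrMod U R) f"
proof -
  have d: "Dom (GrMod U R) f = M" "Cod (GrMod U R) f = N" "f \<in> Arr (GrMod U R)"
    using f by (auto simp: Hom_def)
  have "g \<bullet>\<^bsub>GrMod U R\<^esub> f = Id (GrMod U R) M"
    using GrMod_Comp_Hom[OF f g] GrMod_Id_Hom[OF Hom_source[OF f]] gf
    by (intro Hom_eqI) (auto simp: mor_Comp[OF f] mor_Id)
  moreover have "f \<bullet>\<^bsub>GrMod U R\<^esub> g = Id (GrMod U R) N"
    using GrMod_Comp_Hom[OF g f] GrMod_Id_Hom[OF Hom_target[OF f]] fg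
    by (intro Hom_eqI) (auto simp: mor_Comp[OF g] mor_Id)
  ultimately show "is_inverse (GrMod U R) f g"
    using g d by (simp add: is_inverse_def)
  then show "is_iso (GrMod U R) f" using d by (auto simp: is_iso_def)
qed

text \<open>Biadditivity makes both sides of the balance law additive in each of \<open>r\<close>,
  \<open>x\<close> and \<open>d\<close>, so three nested inductions reduce the law to homogeneous
  triples, where degrees can be compared.\<close>

lemma balanced_homogeneousI:
  assumes M: "graded_module R M" and D: "graded_bimodule R D" and B: "comm_group B"
    and closed: "\<And>x d. x \<in> carrier M \<Longrightarrow> d \<in> carrier (rmod D) \<Longrightarrow> g x d \<in> carrier B"
    and left: "\<And>x y d. x \<in> carrier M \<Longrightarrow> y \<in> carrier M \<Longrightarrow> d \<in> carrier (rmod D) \<Longrightarrow>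
      g (x \<otimes>\<^bsub>M\<^esub> y) d = g x d \<otimes>\<^bsub>B\<^esub> g y d"
    and right: "\<And>x d e. x \<in> carrier M \<Longrightarrow> d \<in> carrier (rmod D) \<Longrightarrow> e \<in> carrier (rmod D) \<Longrightarrow>
      g x (d \<otimes>\<^bsub>rmod D\<^esub> e) = g x d \<otimes>\<^bsub>B\<^esub> g x e"
    and bal: "\<And>x r d i j k. x \<in> deg M i \<Longrightarrow> r \<in> rdeg R j \<Longrightarrow> d \<in> deg (rmod D) k \<Longrightarrow>
      g (ract M x r) d = g x (lact D r d)"
  shows "balanced R M D B g"
proof (rule balancedI)
  interpret M: graded_module R M by fact
  interpret D: graded_bimodule R D by fact
  fix x r d assume x: "x \<in> carrier M" and r: "r \<in> carrier R" and d: "d \<in> carrier (rmod D)"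
  from r x d show "g (ract M x r) d = g x (lact D r d)"
  proof (induction r arbitrary: x d rule: M.R.ring_graded_induct)
    case (add r s)
    then show ?case
      by (simp add: M.ract_add_right D.lact_add_left left right M.ract_closed D.lact_closed)
  next
    case (homogeneous j r)
    then have r: "r \<in> carrier R" by (simp add: M.R.rdeg_closed)
    from homogeneous(2,3) show ?case
    proof (induction x arbitrary: d rule: M.graded_induct)
      case (mult x y)
      then show ?case by (simp add: M.ract_add_left left M.ract_closed D.lact_closed r)
    next
      case (homogeneous i x)
      then have x: "x \<in> carrier M" by (simp add: M.deg_closed)
      from homogeneous(2) show ?case
      proof (induction d rule: D.graded_induct)
        case (mult d e)
        then show ?case by (simp add: D.lact_add_right right M.ract_closed D.lact_closed r x)
      qed (use bal homogeneous \<open>r \<in> rdeg R j\<close> in blast)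
    qed
  qed
qed (use assms in auto)

section \<open>Graded tensor products\<close>

context tensor_setting
begin

abbreviation "TM \<equiv> tensor U R M D"
abbreviation "TG n \<equiv> generate T {x \<odot> d | x d i j. x \<in> deg M i \<and> d \<in> deg (rmod D) j \<and> i + j = n}"

lemma TM_simps [simp]: "carrier TM = carrier T" "mult TM = mult T" "one TM = one T"
  and TM_deg: "deg TM = TG"
  and TM_ract: "ract TM = (\<lambda>t r. tensor_lift U R M D T (\<lambda>x d. x \<odot> ract (rmod D) d r) t)"
  by (simp_all add: tensor_def Let_def)

lemma tensor_induct_homogeneous [consumes 1, case_names pure mult]:
  assumes t: "t \<in> carrier T"
    and pure: "\<And>x d i j. x \<in> deg M i \<Longrightarrow> d \<in> deg (rmod D) j \<Longrightarrow> P (x \<odot> d)"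
    and mult: "\<And>s t. s \<in> carrier T \<Longrightarrow> t \<in> carrier T \<Longrightarrow> P s \<Longrightarrow> P t \<Longrightarrow> P (s \<otimes>\<^bsub>T\<^esub> t)"
  shows "P t"
  using t
proof (induction rule: tensor_induct)
  case (pure x d)
  then show ?case
  proof (induction x rule: M.graded_induct)
    case (mult x y)
    then show ?case by (simp add: pure_add_left assms(3) pure_closed)
  next
    case (homogeneous i x)
    then have x: "x \<in> carrier M" by (simp add: M.deg_closed)
    from homogeneous(2) show ?case
    proof (induction d rule: D.graded_induct)
      case (mult d e)
      then show ?case by (simp add: pure_add_right assms(3) pure_closed x)
    qed (use assms(2) homogeneous in blast)
  qed
qed (rule assms(3))

text \<open>The degree \<open>n\<close> part of \<open>x \<odot> d\<close>, namely the sum over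
  \<open>i\<close> of the components of \<open>x\<close> in degree \<open>i\<close> tensored with
  those of \<open>d\<close> in degree \<open>n - i\<close>.\<close>

definition proj_pure :: "int \<Rightarrow> 'u \<Rightarrow> 'u \<Rightarrow> 'u" where
  "proj_pure n x d = gext M (deg M) T (\<lambda>i x. x \<odot> gcomp (rmod D) (deg (rmod D)) d (n - i)) x"

context
  fixes n :: int and d
  assumes d: "d \<in> carrier (rmod D)"
begin

lemma proj_pure_hom: "(\<lambda>x. proj_pure n x d) \<in> hom M T"
  unfolding proj_pure_def
  using M.gext_hom[OF T_comm_group, of "\<lambda>i x. x \<odot> gcomp (rmod D) (deg (rmod D)) d (n - i)"] d
  by (simp add: pure_closed pure_add_left M.deg_closed D.gcomp_closed)

lemma proj_pure_homogeneous: "x \<in> deg M i \<Longrightarrow>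
    proj_pure n x d = x \<odot> gcomp (rmod D) (deg (rmod D)) d (n - i)"
  unfolding proj_pure_def using d
  by (subst M.gext_homogeneous[OF T_comm_group, where i = i])
    (simp_all add: pure_closed pure_add_left M.deg_closed D.gcomp_closed)

end

lemma proj_pure_homogeneous2: "x \<in> deg M i \<Longrightarrow> d \<in> deg (rmod D) j \<Longrightarrow>
    proj_pure n x d = (if i + j = n then x \<odot> d else \<one>\<^bsub>T\<^esub>)"
  by (auto simp: proj_pure_homogeneous D.deg_closed D.gcomp_homogeneous pure_one_right M.deg_closed)

text \<open>For homogeneous \<open>x\<close>, \<open>r\<close>, \<open>d\<close> the tensors
  \<open>(x r) \<odot> d\<close> and \<open>x \<odot> (r d)\<close> carry the same total degree, so
  the projection keeps both or kills both. This lets the projections descend to the tensor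
  product.\<close>

lemma proj_pure_balanced: "balanced R M D T (proj_pure n)"
proof (rule balanced_homogeneousI[OF M.graded_module_axioms D.graded_bimodule_axioms T_comm_group])
  fix x d e assume x: "x \<in> carrier M" and d: "d \<in> carrier (rmod D)"
  show "proj_pure n x d \<in> carrier T"
    using hom_in_carrier[OF proj_pure_hom[OF d] x] .
  fix y assume y: "y \<in> carrier M"
  show "proj_pure n (x \<otimes>\<^bsub>M\<^esub> y) d = proj_pure n x d \<otimes>\<^bsub>T\<^esub> proj_pure n y d"
    using hom_mult[OF proj_pure_hom[OF d] x y] .
next
  fix x d e assume x: "x \<in> carrier M" and d: "d \<in> carrier (rmod D)" and e: "e \<in> carrier (rmod D)"
  show "proj_pure n x (d \<otimes>\<^bsub>rmod D\<^esub> e) = proj_pure n x d \<otimes>\<^bsub>T\<^esub> proj_pure n x e"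
    using x
  proof (induction x rule: M.graded_induct)
    case (homogeneous i x)
    then show ?case using d e
      by (simp add: proj_pure_homogeneous D.gcomp_mult pure_add_right M.deg_closed D.gcomp_closed)
  next
    case (mult x y)
    then show ?case using d e hom_in_carrier[OF proj_pure_hom]
      by (simp add: hom_mult[OF proj_pure_hom] Tg.m_ac)
  qed
next
  fix x r d i j k assume h: "x \<in> deg M i" "r \<in> rdeg R j" "d \<in> deg (rmod D) k"
  then have "x \<in> carrier M" "r \<in> carrier R" "d \<in> carrier (rmod D)"
    by (auto simp: M.deg_closed D.deg_closed M.R.rdeg_closed)
  then show "proj_pure n (ract M x r) d = proj_pure n x (lact D r d)"
    using h proj_pure_homogeneous2[OF M.degree_ract[OF h(1,2)] h(3)]
      proj_pure_homogeneous2[OF h(1) D.degree_lact[OF h(2,3)]]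
    by (simp add: pure_balanced add.assoc)
qed

lemma T_generate_subgroup: "subgroup (TG n) T"
  by (rule Tg.generate_is_subgroup) (auto simp: pure_closed M.deg_closed D.deg_closed)

text \<open>The lifted degree projections certify that the sum of the subgroups \<open>TG n\<close>
  is direct; homogeneous pure tensors generate everything.\<close>

lemma T_graded_group: "graded_group T TG"
proof (rule graded_groupI[OF T_comm_group T_generate_subgroup])
  let ?p = "\<lambda>n. tensor_lift U R M D T (proj_pure n)"
  note hom = tensor_lift_hom[OF T_comm_group proj_pure_balanced]
  note val = tensor_lift_pure[OF T_comm_group proj_pure_balanced]
  show "?p n \<in> hom T T" for n by (rule hom)
  interpret p: group_hom T T "?p n" for n
    by (intro group_hom.intro group_hom_axioms.intro Tg.is_group hom)
  have sub: "TG m \<subseteq> carrier T" for m using subgroup.subset[OF T_generate_subgroup] .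
  have "?p n t = (if n = m then t else \<one>\<^bsub>T\<^esub>)" if "t \<in> TG m" for m n t
    using that
  proof (induction rule: generate.induct)
    case (incl t)
    then show ?case
      by (auto simp: val M.deg_closed D.deg_closed proj_pure_homogeneous2)
  next
    case (inv t)
    then show ?case
      by (auto simp: pure_closed val M.deg_closed D.deg_closed proj_pure_homogeneous2)
  next
    case (eng s t)
    then have "s \<in> carrier T" "t \<in> carrier T" using sub by auto
    with eng show ?case by simp
  qed simp
  then show "x \<in> TG i \<Longrightarrow> ?p i x = x" "x \<in> TG j \<Longrightarrow> i \<noteq> j \<Longrightarrow> ?p i x = \<one>\<^bsub>T\<^esub>" for x i j
    by auto
  show "carrier T \<subseteq> generate T (\<Union>i. TG i)"
  proof
    fix t assume "t \<in> carrier T"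
    then show "t \<in> generate T (\<Union>i. TG i)"
    proof (induction rule: tensor_induct_homogeneous)
      case (pure x d i j)
      then have "x \<odot> d \<in> TG (i + j)" by (intro generate.incl) blast
      then show ?case by (intro generate.incl) blast
    qed (rule generate.eng)
  qed
qed

lemma ract_balanced: "r \<in> carrier R \<Longrightarrow> balanced R M D T (\<lambda>x d. x \<odot> ract (rmod D) d r)"
  by (rule balancedI)
    (simp_all add: pure_closed D.ract_closed pure_add_left pure_add_right D.ract_add_left pure_balanced D.lact_ract)

lemma tensor_ract_hom: "r \<in> carrier R \<Longrightarrow> (\<lambda>t. ract TM t r) \<in> hom T T"
  unfolding TM_ract by (rule tensor_lift_hom[OF T_comm_group ract_balanced])

lemma tensor_ract_pure:
  "x \<in> carrier M \<Longrightarrow> d \<in> carrier (rmod D) \<Longrightarrow> r \<in> carrier R \<Longrightarrow>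
    ract TM (x \<odot> d) r = x \<odot> ract (rmod D) d r"
  by (simp add: TM_ract tensor_lift_pure[OF T_comm_group ract_balanced])

lemma TM_graded_module: "graded_module R TM"
proof -
  have ract_closed: "ract TM t r \<in> carrier T" if "t \<in> carrier T" "r \<in> carrier R" for t r
    using hom_in_carrier[OF tensor_ract_hom] that by blast
  have ract_mult: "ract TM (s \<otimes>\<^bsub>T\<^esub> t) r = ract TM s r \<otimes>\<^bsub>T\<^esub> ract TM t r"
    if "s \<in> carrier T" "t \<in> carrier T" "r \<in> carrier R" for s t r
    using hom_mult[OF tensor_ract_hom] that by blast
  interpret TM: graded_group T TG by (rule T_graded_group)
  have eqs: "carrier TM = carrier T" "mult TM = mult T" "one TM = one T" "deg TM = TG"
    by (simp_all add: TM_deg)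
  show ?thesis
  proof (intro graded_module.intro graded_module_axioms.intro, unfold eqs)
    show "graded_ring R" by (rule M.R.graded_ring_axioms)
    show "graded_group TM TG"
      by (rule same_graded_group[OF T_graded_group]) simp_all
    fix t r assume t: "t \<in> carrier T"
    show "ract TM t \<one>\<^bsub>R\<^esub> = t" using t
    proof (induction rule: tensor_induct)
      case (pure x d)
      then show ?case
        by (subst tensor_ract_pure) (simp_all add: D.ract_one)
    qed (simp add: ract_mult)
    assume r: "r \<in> carrier R"
    then show "ract TM t r \<in> carrier T" by (rule ract_closed[OF t])
    fix s assume s: "s \<in> carrier R"
    show "ract TM t (r \<oplus>\<^bsub>R\<^esub> s) = ract TM t r \<otimes>\<^bsub>T\<^esub> ract TM t s" using t
    proof (induction rule: tensor_induct)
      case (pure x d)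
      then show ?case using r s
        by (simp add: tensor_ract_pure D.ract_add_right pure_add_right D.ract_closed)
    qed (use r s ract_closed in \<open>simp add: ract_mult Tg.m_ac\<close>)
    show "ract TM t (r \<otimes>\<^bsub>R\<^esub> s) = ract TM (ract TM t r) s" using t
    proof (induction rule: tensor_induct)
      case (pure x d)
      then show ?case using r s
        by (simp add: tensor_ract_pure D.ract_mult D.ract_closed)
    qed (use r s ract_closed in \<open>simp add: ract_mult\<close>)
  next
    fix s t r assume "s \<in> carrier T" "t \<in> carrier T" "r \<in> carrier R"
    then show "ract TM (s \<otimes>\<^bsub>T\<^esub> t) r = ract TM s r \<otimes>\<^bsub>T\<^esub> ract TM t r" by (rule ract_mult)
  next
    fix t r i j assume t: "t \<in> TG i" and r: "r \<in> rdeg R j"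
    then have rc: "r \<in> carrier R" by (simp add: M.R.rdeg_closed)
    interpret p: group_hom T T "\<lambda>t. ract TM t r"
      by (intro group_hom.intro group_hom_axioms.intro Tg.is_group tensor_ract_hom rc)
    have pure: "ract TM (x \<odot> d) r \<in> TG (i + j)"
      if "x \<in> deg M k" "d \<in> deg (rmod D) l" "k + l = i" for x d k l
    proof -
      have "ract TM (x \<odot> d) r = x \<odot> ract (rmod D) d r"
        using that rc by (intro tensor_ract_pure) (simp_all add: M.deg_closed D.deg_closed)
      also have "\<dots> \<in> TG (i + j)"
        using that D.degree_ract[OF that(2) r] by (intro generate.incl) (auto, metis add.assoc)
      finally show ?thesis .
    qed
    from t show "ract TM t r \<in> TG (i + j)"
    proof (induction rule: generate.induct)
      case one
      show ?case by (subst p.hom_one) (rule TM.deg_one)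
    next
      case (incl h)
      then show ?case using pure by blast
    next
      case (inv h)
      then have "h \<in> carrier T" "ract TM h r \<in> TG (i + j)" 
        using pure by (auto simp: M.deg_closed D.deg_closed pure_closed)
      then show ?case by (subst p.hom_inv) (assumption | rule TM.deg_inv)+
    next
      case (eng h1 h2)
      then have "h1 \<in> carrier T" "h2 \<in> carrier T"
        using subgroup.subset[OF T_generate_subgroup] by auto
      with eng show ?case by (subst ract_mult[OF _ _ rc]) (assumption | rule TM.deg_mult)+
    qed
  qed
qed

lemma pure_degree: "x \<in> deg M i \<Longrightarrow> d \<in> deg (rmod D) j \<Longrightarrow> x \<odot> d \<in> deg TM (i + j)"
  unfolding TM_deg by (intro generate.incl) blast

text \<open>The reindexing \<open>f\<close> covers maps that shift degrees, such as the left action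
  of a homogeneous ring element or tensoring with a fixed homogeneous element.\<close>

lemma tensor_hom_degree:
  assumes B: "graded_group B G" and h: "h \<in> hom T B"
    and deg: "\<And>x d i j. x \<in> deg M i \<Longrightarrow> d \<in> deg (rmod D) j \<Longrightarrow> h (x \<odot> d) \<in> G (f (i + j))"
    and t: "t \<in> TG n"
  shows "h t \<in> G (f n)"
proof -
  interpret B: graded_group B G by (rule B)
  interpret h: group_hom T B h
    by (intro group_hom.intro group_hom_axioms.intro Tg.is_group B.is_group h)
  from t show ?thesis
  proof (induction rule: generate.induct)
    case one
    show ?case using B.deg_one by simp
  next
    case (incl t)
    then show ?case using deg by blast
  next
    case (inv t)
    then have "t \<in> carrier T" "h t \<in> G (f n)"
      using deg by (auto simp: pure_closed M.deg_closed D.deg_closed)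
    then show ?case using B.deg_inv by simp
  next
    case (eng s t)
    then have "s \<in> carrier T" "t \<in> carrier T" using subgroup.subset[OF T_generate_subgroup] by auto
    with eng show ?case using B.deg_mult by simp
  qed
qed

lemma graded_map_from_tensor:
  assumes B: "graded_module R B" and h: "h \<in> hom T B"
    and lin: "\<And>x d r. x \<in> carrier M \<Longrightarrow> d \<in> carrier (rmod D) \<Longrightarrow> r \<in> carrier R \<Longrightarrow>
      h (x \<odot> ract (rmod D) d r) = ract B (h (x \<odot> d)) r"
    and deg: "\<And>x d i j. x \<in> deg M i \<Longrightarrow> d \<in> deg (rmod D) j \<Longrightarrow> h (x \<odot> d) \<in> deg B (i + j)"
  shows "is_graded_map R TM B h"
proof -
  interpret TM: graded_module R TM by (rule TM_graded_module)
  interpret B: graded_module R B by (rule B)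
  interpret h: group_hom T B h
    by (intro group_hom.intro group_hom_axioms.intro Tg.is_group B.is_group h)
  have ract_closed: "ract TM t r \<in> carrier T" if "t \<in> carrier T" "r \<in> carrier R" for t r
    using TM.ract_closed that by simp
  have ract_mult: "ract TM (s \<otimes>\<^bsub>T\<^esub> t) r = ract TM s r \<otimes>\<^bsub>T\<^esub> ract TM t r"
    if "s \<in> carrier T" "t \<in> carrier T" "r \<in> carrier R" for s t r
    using hom_mult[OF tensor_ract_hom] that by blast
  have "h (ract TM t r) = ract B (h t) r" if "t \<in> carrier T" "r \<in> carrier R" for t r
    using that(1)
  proof (induction rule: tensor_induct)
    case (pure x d)
    then show ?case using that(2) by (simp add: tensor_ract_pure lin)
  next
    case (mult s t)
    then show ?case using that(2)
      by (simp add: ract_mult ract_closed B.ract_add_left)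
  qed
  moreover have "h t \<in> deg B n" if "t \<in> TG n" for t n
    using tensor_hom_degree[OF B.graded_group_axioms h, of "\<lambda>n. n"] deg that by blast
  moreover have "h \<in> hom TM B" using h by (simp add: hom_def)
  ultimately show ?thesis by (auto simp: is_graded_map_def TM_deg)
qed

end

section \<open>The monoidal structure\<close>

lemma reg_mod_simps [simp]: "carrier (reg_mod R) = carrier R" "mult (reg_mod R) = add R"
  "one (reg_mod R) = \<zero>\<^bsub>R\<^esub>" "ract (reg_mod R) = mult R" "deg (reg_mod R) = rdeg R"
  by (simp_all add: reg_mod_def)

lemma reg_bimod_simps [simp]: "rmod (reg_bimod R) = reg_mod R" "lact (reg_bimod R) = mult R"
  by (simp_all add: reg_bimod_def)

lemma reg_mod_graded_module: "graded_ring R \<Longrightarrow> graded_module R (reg_mod R)"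
proof -
  assume "graded_ring R"
  then interpret graded_ring R .
  show ?thesis
    by (intro graded_module.intro graded_module_axioms.intro graded_ring_axioms)
      (simp_all add: l_distr r_distr m_assoc degree_mult same_graded_group[OF graded_group_axioms])
qed

lemma reg_bimod_graded_bimodule: "graded_ring R \<Longrightarrow> graded_bimodule R (reg_bimod R)"
proof -
  assume R: "graded_ring R"
  then interpret graded_ring R .
  show ?thesis
    by (intro graded_bimodule.intro graded_bimodule_axioms.intro)
      (simp_all add: reg_mod_graded_module[OF R] l_distr r_distr m_assoc degree_mult)
qed

locale graded_setting = small_universe U + R: graded_ring R
  for U :: "'u set set" and R :: "'u gring" +
  assumes R_small: "carrier R \<in> U"
begin

abbreviation "A \<equiv> GrMod U R"
abbreviation comp_A (infixl "\<bullet>" 70) where "g \<bullet> f \<equiv> g \<bullet>\<^bsub>GrMod U R\<^esub> f"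

sublocale A: category A by (rule GrMod_category)

definition bimod :: "'u gbimod \<Rightarrow> bool" where
  "bimod D \<longleftrightarrow> graded_bimodule R D \<and> carrier (rmod D) \<in> U"

definition bimod_map :: "'u gbimod \<Rightarrow> 'u gbimod \<Rightarrow> ('u \<Rightarrow> 'u) \<Rightarrow> bool" where
  "bimod_map D E g \<longleftrightarrow> is_graded_map R (rmod D) (rmod E) g \<and> is_left_linear R D E g"

abbreviation tns (infixl "\<boxtimes>" 75) where "M \<boxtimes> D \<equiv> tensor U R M D"
abbreviation bim_tns (infixl "\<boxtimes>\<boxtimes>" 75) where "D \<boxtimes>\<boxtimes> E \<equiv> tensor_bimod U R D E"
abbreviation pu where "pu \<equiv> pure U R"

lemma Obj_bimod: "bimod D \<Longrightarrow> rmod D \<in> Obj A"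
  by (simp add: bimod_def graded_bimodule_def)

lemma reg_Obj: "reg_mod R \<in> Obj A"
  by (simp add: reg_mod_graded_module R.graded_ring_axioms R_small)

lemma reg_bimod: "bimod (reg_bimod R)"
  by (simp add: bimod_def reg_bimod_graded_bimodule R.graded_ring_axioms R_small)

lemma Obj_comm_group: "M \<in> Obj A \<Longrightarrow> comm_group M"
  by (simp add: graded_module_def graded_group_def)

lemma bimod_map_facts:
  assumes "bimod_map D E g"
  shows bimod_map_closed: "d \<in> carrier (rmod D) \<Longrightarrow> g d \<in> carrier (rmod E)"
    and bimod_map_mult: "d \<in> carrier (rmod D) \<Longrightarrow> e \<in> carrier (rmod D) \<Longrightarrow>
      g (d \<otimes>\<^bsub>rmod D\<^esub> e) = g d \<otimes>\<^bsub>rmod E\<^esub> g e"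
    and bimod_map_ract: "d \<in> carrier (rmod D) \<Longrightarrow> r \<in> carrier R \<Longrightarrow>
      g (ract (rmod D) d r) = ract (rmod E) (g d) r"
    and bimod_map_deg: "d \<in> deg (rmod D) i \<Longrightarrow> g d \<in> deg (rmod E) i"
    and bimod_map_lact: "d \<in> carrier (rmod D) \<Longrightarrow> r \<in> carrier R \<Longrightarrow>
      g (lact D r d) = lact E r (g d)"
proof -
  have g: "is_graded_map R (rmod D) (rmod E) g" "is_left_linear R D E g"
    using assms by (simp_all add: bimod_map_def)
  show "d \<in> carrier (rmod D) \<Longrightarrow> g d \<in> carrier (rmod E)"
    "d \<in> carrier (rmod D) \<Longrightarrow> e \<in> carrier (rmod D) \<Longrightarrow>
      g (d \<otimes>\<^bsub>rmod D\<^esub> e) = g d \<otimes>\<^bsub>rmod E\<^esub> g e"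
    using g(1) by (auto simp: is_graded_map_def hom_def)
  show "d \<in> deg (rmod D) i \<Longrightarrow> g d \<in> deg (rmod E) i"
    using g(1) unfolding is_graded_map_def by blast
  show "d \<in> carrier (rmod D) \<Longrightarrow> r \<in> carrier R \<Longrightarrow>
      g (ract (rmod D) d r) = ract (rmod E) (g d) r"
    "d \<in> carrier (rmod D) \<Longrightarrow> r \<in> carrier R \<Longrightarrow> g (lact D r d) = lact E r (g d)"
    using g by (auto simp: is_graded_map_def is_left_linear_def)
qed

lemma bimod_map_id: "bimod_map D D (\<lambda>d. d)"
  by (auto simp: bimod_map_def is_graded_map_def hom_def is_left_linear_def)

context
  fixes M D
  assumes M: "M \<in> Obj A" and D: "bimod D"
begin

lemma setting: "tensor_setting U R M D"
  using M D by (simp add: tensor_setting_def tensor_setting_axioms_def small_universe_axioms bimod_def)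

interpretation tensor_setting U R M D by (rule setting)

lemma tns_Obj: "M \<boxtimes> D \<in> Obj A"
  by (simp add: TM_graded_module T_small)

lemma pu_closed: "x \<in> carrier M \<Longrightarrow> d \<in> carrier (rmod D) \<Longrightarrow> pu M D x d \<in> carrier (M \<boxtimes> D)"
  by (simp add: pure_closed)

lemma pu_mult_left: "x \<in> carrier M \<Longrightarrow> y \<in> carrier M \<Longrightarrow> d \<in> carrier (rmod D) \<Longrightarrow>
    pu M D (x \<otimes>\<^bsub>M\<^esub> y) d = pu M D x d \<otimes>\<^bsub>M \<boxtimes> D\<^esub> pu M D y d"
  by (simp add: pure_add_left)

lemma pu_mult_right: "x \<in> carrier M \<Longrightarrow> d \<in> carrier (rmod D) \<Longrightarrow> e \<in> carrier (rmod D) \<Longrightarrow>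
    pu M D x (d \<otimes>\<^bsub>rmod D\<^esub> e) = pu M D x d \<otimes>\<^bsub>M \<boxtimes> D\<^esub> pu M D x e"
  by (simp add: pure_add_right)

lemma pu_balanced: "x \<in> carrier M \<Longrightarrow> r \<in> carrier R \<Longrightarrow> d \<in> carrier (rmod D) \<Longrightarrow>
    pu M D (ract M x r) d = pu M D x (lact D r d)"
  by (rule pure_balanced)

lemma pu_one_left: "d \<in> carrier (rmod D) \<Longrightarrow> pu M D \<one>\<^bsub>M\<^esub> d = \<one>\<^bsub>M \<boxtimes> D\<^esub>"
  by (simp add: pure_one_left)

lemma pu_ract: "x \<in> carrier M \<Longrightarrow> d \<in> carrier (rmod D) \<Longrightarrow> r \<in> carrier R \<Longrightarrow>
    ract (M \<boxtimes> D) (pu M D x d) r = pu M D x (ract (rmod D) d r)"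
  by (rule tensor_ract_pure)

lemma pu_deg: "x \<in> deg M i \<Longrightarrow> d \<in> deg (rmod D) j \<Longrightarrow> pu M D x d \<in> deg (M \<boxtimes> D) (i + j)"
  by (rule pure_degree)

lemma tns_induct [consumes 1, case_names pure mult]:
  assumes "t \<in> carrier (M \<boxtimes> D)"
    "\<And>x d. x \<in> carrier M \<Longrightarrow> d \<in> carrier (rmod D) \<Longrightarrow> P (pu M D x d)"
    "\<And>s t. s \<in> carrier (M \<boxtimes> D) \<Longrightarrow> t \<in> carrier (M \<boxtimes> D) \<Longrightarrow> P s \<Longrightarrow> P t \<Longrightarrow> P (s \<otimes>\<^bsub>M \<boxtimes> D\<^esub> t)"
  shows "P t"
  by (rule tensor_induct[of t P]) (use assms in auto)

lemma tns_induct_homogeneous [consumes 1, case_names pure mult]: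
  assumes "t \<in> carrier (M \<boxtimes> D)"
    "\<And>x d i j. x \<in> deg M i \<Longrightarrow> d \<in> deg (rmod D) j \<Longrightarrow> P (pu M D x d)"
    "\<And>s t. s \<in> carrier (M \<boxtimes> D) \<Longrightarrow> t \<in> carrier (M \<boxtimes> D) \<Longrightarrow> P s \<Longrightarrow> P t \<Longrightarrow> P (s \<otimes>\<^bsub>M \<boxtimes> D\<^esub> t)"
  shows "P t"
  by (rule tensor_induct_homogeneous[of t P]) (use assms in auto)

lemma hom_tns: "hom (M \<boxtimes> D) B = hom T B"
  by (simp add: hom_def)

lemma tns_hom_degree:
  assumes "graded_group B G" "h \<in> hom (M \<boxtimes> D) B"
    "\<And>x d i j. x \<in> deg M i \<Longrightarrow> d \<in> deg (rmod D) j \<Longrightarrow> h (pu M D x d) \<in> G (f (i + j))"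
    "t \<in> deg (M \<boxtimes> D) n"
  shows "h t \<in> G (f n)"
  using assms tensor_hom_degree[of B G h f t n] by (simp add: hom_tns TM_deg)

lemma lift_tns:
  assumes "comm_group B" "balanced R M D B g"
  shows lift_hom: "tensor_lift U R M D B g \<in> hom (M \<boxtimes> D) B"
    and lift_extensional: "tensor_lift U R M D B g \<in> extensional (carrier (M \<boxtimes> D))"
    and lift_pu: "x \<in> carrier M \<Longrightarrow> d \<in> carrier (rmod D) \<Longrightarrow>
      tensor_lift U R M D B g (pu M D x d) = g x d"
  using tensor_lift[OF assms] by (simp_all add: hom_tns)

lemma Hom_from_tns:
  assumes B: "B \<in> Obj A" and h: "h \<in> hom (M \<boxtimes> D) B" "h \<in> extensional (carrier (M \<boxtimes> D))"
    and lin: "\<And>x d r. x \<in> carrier M \<Longrightarrow> d \<in> carrier (rmod D) \<Longrightarrow> r \<in> carrier R \<Longrightarrow>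
      h (pu M D x (ract (rmod D) d r)) = ract B (h (pu M D x d)) r"
    and deg: "\<And>x d i j. x \<in> deg M i \<Longrightarrow> d \<in> deg (rmod D) j \<Longrightarrow> h (pu M D x d) \<in> deg B (i + j)"
  shows "Arrow (M \<boxtimes> D) B h \<in> Hom A (M \<boxtimes> D) B"
  by (rule Arrow_Hom[OF tns_Obj B graded_map_from_tensor h(2)])
    (use B h lin deg in \<open>simp_all add: hom_tns\<close>)

end

lemma tns_Hom_eqI:
  assumes "M \<in> Obj A" "bimod D" "f \<in> Hom A (M \<boxtimes> D) B" "g \<in> Hom A (M \<boxtimes> D) B"
    "\<And>x d. x \<in> carrier M \<Longrightarrow> d \<in> carrier (rmod D) \<Longrightarrow> mor f (pu M D x d) = mor g (pu M D x d)"
  shows "f = g"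
proof (rule Hom_eqI[OF assms(3,4)])
  fix t assume "t \<in> carrier (M \<boxtimes> D)"
  then show "mor f t = mor g t"
  proof (induction rule: tns_induct[OF assms(1,2), consumes 1, case_names pure mult])
    case (mult s t)
    then show ?case by (simp add: Hom_mult[OF assms(3)] Hom_mult[OF assms(4)])
  qed (rule assms(5))
qed

lemma lift_Hom:
  assumes M: "M \<in> Obj A" and D: "bimod D" and B: "B \<in> Obj A" and bal: "balanced R M D B g"
    and lin: "\<And>x d r. x \<in> carrier M \<Longrightarrow> d \<in> carrier (rmod D) \<Longrightarrow> r \<in> carrier R \<Longrightarrow>
      g x (ract (rmod D) d r) = ract B (g x d) r"
    and deg: "\<And>x d i j. x \<in> deg M i \<Longrightarrow> d \<in> deg (rmod D) j \<Longrightarrow> g x d \<in> deg B (i + j)"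
  shows "Arrow (M \<boxtimes> D) B (tensor_lift U R M D B g) \<in> Hom A (M \<boxtimes> D) B"
proof (rule Hom_from_tns[OF M D B])
  interpret M: graded_module R M using M by simp
  interpret D: graded_bimodule R D using D by (simp add: bimod_def)
  note lift = lift_tns[OF M D Obj_comm_group[OF B] bal]
  show "tensor_lift U R M D B g \<in> hom (M \<boxtimes> D) B"
    "tensor_lift U R M D B g \<in> extensional (carrier (M \<boxtimes> D))"
    by (rule lift)+
  show "tensor_lift U R M D B g (pu M D x (ract (rmod D) d r)) =
      ract B (tensor_lift U R M D B g (pu M D x d)) r"
    if "x \<in> carrier M" "d \<in> carrier (rmod D)" "r \<in> carrier R" for x d r
    using that lin by (simp add: lift(3) D.ract_closed)
  show "tensor_lift U R M D B g (pu M D x d) \<in> deg B (i + j)"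
    if "x \<in> deg M i" "d \<in> deg (rmod D) j" for x d i j
    using that deg by (simp add: lift(3) M.deg_closed D.deg_closed)
qed

lemma tensor_arr:
  assumes f: "f \<in> Hom A M N" and D: "bimod D" and E: "bimod E" and g: "bimod_map D E g"
  shows tensor_arr_Hom: "tensor_arr U R f D E g \<in> Hom A (M \<boxtimes> D) (N \<boxtimes> E)"
    and tensor_arr_pu: "x \<in> carrier M \<Longrightarrow> d \<in> carrier (rmod D) \<Longrightarrow>
      mor (tensor_arr U R f D E g) (pu M D x d) = pu N E (mor f x) (g d)"
proof -
  have M: "M \<in> Obj A" and N: "N \<in> Obj A" using Hom_objs[OF f] by auto
  interpret D: graded_bimodule R D using D by (simp add: bimod_def)
  have st: "source f = M" "target f = N" using f by (simp_all add: GrMod_Hom)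
  have bal: "balanced R M D (N \<boxtimes> E) (\<lambda>x d. pu N E (mor f x) (g d))"
    by (rule balancedI)
      (simp_all add: pu_closed[OF N E] pu_mult_left[OF N E] pu_mult_right[OF N E] pu_balanced[OF N E]
        Hom_closed[OF f] Hom_mult[OF f] Hom_ract[OF f] bimod_map_closed[OF g] bimod_map_mult[OF g]
        bimod_map_lact[OF g])
  show "tensor_arr U R f D E g \<in> Hom A (M \<boxtimes> D) (N \<boxtimes> E)"
    unfolding tensor_arr_def st
    by (rule lift_Hom[OF M D tns_Obj[OF N E] bal])
      (simp_all add: pu_ract[OF N E] Hom_closed[OF f] bimod_map_closed[OF g] bimod_map_ract[OF g]
        pu_deg[OF N E] Hom_deg[OF f] bimod_map_deg[OF g])
  show "x \<in> carrier M \<Longrightarrow> d \<in> carrier (rmod D) \<Longrightarrow>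
      mor (tensor_arr U R f D E g) (pu M D x d) = pu N E (mor f x) (g d)"
    unfolding tensor_arr_def st by (simp add: lift_pu[OF M D Obj_comm_group[OF tns_Obj[OF N E]] bal])
qed

lemma tensor_bimod_rmod [simp]: "rmod (D \<boxtimes>\<boxtimes> E) = rmod D \<boxtimes> E"
  by (simp add: tensor_bimod_def)

context
  fixes D E
  assumes D: "bimod D" and E: "bimod E"
begin

interpretation D: graded_bimodule R D using D by (simp add: bimod_def)
interpretation E: graded_bimodule R E using E by (simp add: bimod_def)
interpretation tensor_setting U R "rmod D" E by (rule setting[OF Obj_bimod[OF D] E])

lemma lact_balanced: "r \<in> carrier R \<Longrightarrow> balanced R (rmod D) E T (\<lambda>d e. pu (rmod D) E (lact D r d) e)"
  by (rule balancedI)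
    (simp_all add: pure_closed D.lact_closed pure_add_left pure_add_right D.lact_add_right
      D.ract_closed D.lact_ract[symmetric] pure_balanced)

lemma tns_lact_hom: "r \<in> carrier R \<Longrightarrow> lact (D \<boxtimes>\<boxtimes> E) r \<in> hom (rmod D \<boxtimes> E) (rmod D \<boxtimes> E)"
  using tensor_lift_hom[OF T_comm_group lact_balanced] by (simp add: tensor_bimod_def hom_def)

lemma tns_lact_pu: "r \<in> carrier R \<Longrightarrow> d \<in> carrier (rmod D) \<Longrightarrow> e \<in> carrier (rmod E) \<Longrightarrow>
    lact (D \<boxtimes>\<boxtimes> E) r (pu (rmod D) E d e) = pu (rmod D) E (lact D r d) e"
  using tensor_lift_pure[OF T_comm_group lact_balanced] by (simp add: tensor_bimod_def)

lemma tensor_bimod: "bimod (D \<boxtimes>\<boxtimes> E)"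
proof -
  note DO = Obj_bimod[OF D]
  interpret TM: graded_module R "rmod D \<boxtimes> E" by (rule TM_graded_module)
  have closed: "lact (D \<boxtimes>\<boxtimes> E) r t \<in> carrier (rmod D \<boxtimes> E)"
    if "r \<in> carrier R" "t \<in> carrier (rmod D \<boxtimes> E)" for r t
    using hom_in_carrier[OF tns_lact_hom] that by blast
  have mult_lact: "lact (D \<boxtimes>\<boxtimes> E) r (s \<otimes>\<^bsub>rmod D \<boxtimes> E\<^esub> t) =
      lact (D \<boxtimes>\<boxtimes> E) r s \<otimes>\<^bsub>rmod D \<boxtimes> E\<^esub> lact (D \<boxtimes>\<boxtimes> E) r t"
    if "r \<in> carrier R" "s \<in> carrier (rmod D \<boxtimes> E)" "t \<in> carrier (rmod D \<boxtimes> E)" for r s t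
    using hom_mult[OF tns_lact_hom] that by blast
  note induct = tns_induct[OF DO E, consumes 1, case_names pure mult]
  note simps = tns_lact_pu pu_closed[OF DO E] pu_ract[OF DO E] D.lact_closed E.ract_closed
  note [simp del] = TM_simps
  show ?thesis
    unfolding bimod_def
  proof (intro conjI graded_bimodule.intro graded_bimodule_axioms.intro, unfold tensor_bimod_rmod)
    show "graded_module R (rmod D \<boxtimes> E)" by (rule TM_graded_module)
    show "carrier (rmod D \<boxtimes> E) \<in> U" using tns_Obj[OF DO E] by simp
    fix r t assume r: "r \<in> carrier R" and t: "t \<in> carrier (rmod D \<boxtimes> E)"
    show "lact (D \<boxtimes>\<boxtimes> E) r t \<in> carrier (rmod D \<boxtimes> E)" by (rule closed[OF r t])
    {
      fix s assume "s \<in> carrier (rmod D \<boxtimes> E)"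
      then show "lact (D \<boxtimes>\<boxtimes> E) r (t \<otimes>\<^bsub>rmod D \<boxtimes> E\<^esub> s) =
          lact (D \<boxtimes>\<boxtimes> E) r t \<otimes>\<^bsub>rmod D \<boxtimes> E\<^esub> lact (D \<boxtimes>\<boxtimes> E) r s"
        by (rule mult_lact[OF r t])
    }
    fix s assume s: "s \<in> carrier R"
    show "lact (D \<boxtimes>\<boxtimes> E) (r \<oplus>\<^bsub>R\<^esub> s) t =
        lact (D \<boxtimes>\<boxtimes> E) r t \<otimes>\<^bsub>rmod D \<boxtimes> E\<^esub> lact (D \<boxtimes>\<boxtimes> E) s t"
      using t
    proof (induction rule: induct)
      case (pure d e)
      then show ?case using r s by (simp add: simps D.lact_add_left pu_mult_left[OF DO E])
    next
      case (mult t t')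
      then show ?case using r s by (simp add: mult_lact closed TM.m_ac)
    qed
    show "lact (D \<boxtimes>\<boxtimes> E) (r \<otimes>\<^bsub>R\<^esub> s) t = lact (D \<boxtimes>\<boxtimes> E) r (lact (D \<boxtimes>\<boxtimes> E) s t)"
      using t
    proof (induction rule: induct)
      case (pure d e)
      then show ?case using r s by (simp add: simps D.lact_mult)
    next
      case (mult t t')
      then show ?case using r s by (simp add: mult_lact closed)
    qed
    show "ract (rmod D \<boxtimes> E) (lact (D \<boxtimes>\<boxtimes> E) r t) s = lact (D \<boxtimes>\<boxtimes> E) r (ract (rmod D \<boxtimes> E) t s)"
      using t
    proof (induction rule: induct)
      case (pure d e)
      then show ?case using r s by (simp add: simps)
    next
      case (mult t t')
      then show ?case using r s by (simp add: mult_lact closed TM.ract_add_left TM.ract_closed)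
    qed
  next
    fix t assume "t \<in> carrier (rmod D \<boxtimes> E)"
    then show "lact (D \<boxtimes>\<boxtimes> E) \<one>\<^bsub>R\<^esub> t = t"
    proof (induction rule: induct)
      case (pure d e)
      then show ?case by (simp add: simps D.lact_one)
    next
      case (mult t t')
      then show ?case by (simp add: mult_lact)
    qed
  next
    fix r i t j assume r: "r \<in> rdeg R i" and t: "t \<in> deg (rmod D \<boxtimes> E) j"
    have rc: "r \<in> carrier R" by (rule R.rdeg_closed[OF r])
    show "lact (D \<boxtimes>\<boxtimes> E) r t \<in> deg (rmod D \<boxtimes> E) (i + j)"
    proof (rule tns_hom_degree[OF DO E TM.graded_group_axioms tns_lact_hom[OF rc] _ t])
      fix d e k l assume d: "d \<in> deg (rmod D) k" and e: "e \<in> deg (rmod E) l"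
      have "pu (rmod D) E (lact D r d) e \<in> deg (rmod D \<boxtimes> E) (i + k + l)"
        by (rule pu_deg[OF DO E D.degree_lact[OF r d] e])
      then show "lact (D \<boxtimes>\<boxtimes> E) r (pu (rmod D) E d e) \<in> deg (rmod D \<boxtimes> E) (i + (k + l))"
        using d e rc by (simp add: simps D.deg_closed E.deg_closed add.assoc)
    qed
  qed
qed

end

lemma right_unitor:
  assumes M: "M \<in> Obj A"
  shows right_unitor_Hom: "right_unitor U R M \<in> Hom A (M \<boxtimes> reg_bimod R) M"
    and right_unitor_pu: "x \<in> carrier M \<Longrightarrow> r \<in> carrier R \<Longrightarrow>
      mor (right_unitor U R M) (pu M (reg_bimod R) x r) = ract M x r"
proof -
  interpret M: graded_module R M using M by simp
  have bal: "balanced R M (reg_bimod R) M (ract M)"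
    by (rule balancedI) (simp_all add: M.ract_closed M.ract_add_left M.ract_add_right M.ract_mult)
  show "right_unitor U R M \<in> Hom A (M \<boxtimes> reg_bimod R) M"
    unfolding right_unitor_def
    by (rule lift_Hom[OF M reg_bimod M bal]) (simp_all add: M.ract_mult M.degree_ract)
  show "x \<in> carrier M \<Longrightarrow> r \<in> carrier R \<Longrightarrow>
      mor (right_unitor U R M) (pu M (reg_bimod R) x r) = ract M x r"
    unfolding right_unitor_def
    by (simp add: lift_pu[OF M reg_bimod Obj_comm_group[OF M] bal])
qed

lemma left_unitor:
  assumes D: "bimod D"
  shows left_unitor_Hom: "left_unitor U R D \<in> Hom A (reg_mod R \<boxtimes> D) (rmod D)"
    and left_unitor_pu: "r \<in> carrier R \<Longrightarrow> d \<in> carrier (rmod D) \<Longrightarrow>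
      mor (left_unitor U R D) (pu (reg_mod R) D r d) = lact D r d"
proof -
  interpret D: graded_bimodule R D using D by (simp add: bimod_def)
  have bal: "balanced R (reg_mod R) D (rmod D) (lact D)"
    by (rule balancedI) (simp_all add: D.lact_closed D.lact_add_left D.lact_add_right D.lact_mult)
  show "left_unitor U R D \<in> Hom A (reg_mod R \<boxtimes> D) (rmod D)"
    unfolding left_unitor_def
    by (rule lift_Hom[OF reg_Obj D Obj_bimod[OF D] bal]) (simp_all add: D.lact_ract D.degree_lact)
  show "r \<in> carrier R \<Longrightarrow> d \<in> carrier (rmod D) \<Longrightarrow>
      mor (left_unitor U R D) (pu (reg_mod R) D r d) = lact D r d"
    unfolding left_unitor_def
    by (simp add: lift_pu[OF reg_Obj D Obj_comm_group[OF Obj_bimod[OF D]] bal])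
qed

end

context graded_setting
begin

lemma tns_hom_eqI:
  assumes "M \<in> Obj A" "bimod D" "h \<in> hom (M \<boxtimes> D) B" "k \<in> hom (M \<boxtimes> D) B"
    "\<And>x d. x \<in> carrier M \<Longrightarrow> d \<in> carrier (rmod D) \<Longrightarrow> h (pu M D x d) = k (pu M D x d)"
    "t \<in> carrier (M \<boxtimes> D)"
  shows "h t = k t"
  using assms(6)
proof (induction rule: tns_induct[OF assms(1,2), consumes 1, case_names pure mult])
  case (mult s t)
  then show ?case using hom_mult[OF assms(3)] hom_mult[OF assms(4)] by simp
qed (rule assms(5))

section \<open>Associativity of the tensor product\<close>

context
  fixes M D E
  assumes M: "M \<in> Obj A" and D: "bimod D" and E: "bimod E"
begin

interpretation M: graded_module R M using M by simp
interpretation D: graded_bimodule R D using D by (simp add: bimod_def)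
interpretation E: graded_bimodule R E using E by (simp add: bimod_def)

abbreviation (input) "S \<equiv> (M \<boxtimes> D) \<boxtimes> E"
abbreviation (input) "S' \<equiv> M \<boxtimes> (D \<boxtimes>\<boxtimes> E)"

lemma MD: "M \<boxtimes> D \<in> Obj A" by (rule tns_Obj[OF M D])
lemma DE: "rmod D \<boxtimes> E \<in> Obj A" by (rule tns_Obj[OF Obj_bimod[OF D] E])
lemma bDE: "bimod (D \<boxtimes>\<boxtimes> E)" by (rule tensor_bimod[OF D E])
lemma S_Obj: "S \<in> Obj A" by (rule tns_Obj[OF MD E])
lemma S'_Obj: "S' \<in> Obj A" by (rule tns_Obj[OF M bDE])

interpretation MD: graded_module R "M \<boxtimes> D" using MD by simp
interpretation S: graded_module R S using S_Obj by simp
interpretation S': graded_module R S' using S'_Obj by simp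

lemmas pu_simps =
  pu_closed[OF M D] pu_closed[OF Obj_bimod[OF D] E] pu_closed[OF MD E] pu_closed[OF M bDE, simplified]
  pu_mult_left[OF M D] pu_mult_left[OF Obj_bimod[OF D] E] pu_mult_left[OF MD E]
  pu_mult_left[OF M bDE, simplified]
  pu_mult_right[OF M D] pu_mult_right[OF Obj_bimod[OF D] E] pu_mult_right[OF MD E]
  pu_mult_right[OF M bDE, simplified]
  pu_ract[OF M D] pu_ract[OF Obj_bimod[OF D] E] pu_ract[OF MD E] pu_ract[OF M bDE, simplified]
  D.lact_closed E.lact_closed D.ract_closed E.ract_closed M.ract_closed
  tns_lact_pu[OF D E]

text \<open>The associator in curried form: a map out of a double tensor product is lifted in two
  variables with the third one, \<open>e\<close>, held fixed.\<close>

definition assoc_in :: "'u \<Rightarrow> 'u \<Rightarrow> 'u" where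
  "assoc_in e = tensor_lift U R M D S' (\<lambda>x d. pu M (D \<boxtimes>\<boxtimes> E) x (pu (rmod D) E d e))"

lemma assoc_in:
  assumes e: "e \<in> carrier (rmod E)"
  shows assoc_in_hom: "assoc_in e \<in> hom (M \<boxtimes> D) S'"
    and assoc_in_pu: "x \<in> carrier M \<Longrightarrow> d \<in> carrier (rmod D) \<Longrightarrow>
      assoc_in e (pu M D x d) = pu M (D \<boxtimes>\<boxtimes> E) x (pu (rmod D) E d e)"
proof -
  have bal: "balanced R M D S' (\<lambda>x d. pu M (D \<boxtimes>\<boxtimes> E) x (pu (rmod D) E d e))"
    by (rule balancedI) (use e in \<open>simp_all add: pu_simps pu_balanced[OF M bDE]\<close>)
  show "assoc_in e \<in> hom (M \<boxtimes> D) S'"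
    "x \<in> carrier M \<Longrightarrow> d \<in> carrier (rmod D) \<Longrightarrow>
      assoc_in e (pu M D x d) = pu M (D \<boxtimes>\<boxtimes> E) x (pu (rmod D) E d e)"
    unfolding assoc_in_def using lift_tns[OF M D Obj_comm_group[OF S'_Obj] bal] by auto
qed

text \<open>Each law is an equality of two homomorphisms in \<open>t\<close>, hence needs checking
  on pure tensors only.\<close>

lemma assoc_balanced: "balanced R (M \<boxtimes> D) E S' (\<lambda>t e. assoc_in e t)"
proof (rule balancedI)
  fix t e assume t: "t \<in> carrier (M \<boxtimes> D)" and e: "e \<in> carrier (rmod E)"
  show "assoc_in e t \<in> carrier S'" using hom_in_carrier[OF assoc_in_hom[OF e] t] .
  {
    fix s assume "s \<in> carrier (M \<boxtimes> D)"
    then show "assoc_in e (t \<otimes>\<^bsub>M \<boxtimes> D\<^esub> s) = assoc_in e t \<otimes>\<^bsub>S'\<^esub> assoc_in e s"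
      using hom_mult[OF assoc_in_hom[OF e] t] by blast
  }
  {
    fix e' assume e': "e' \<in> carrier (rmod E)"
    show "assoc_in (e \<otimes>\<^bsub>rmod E\<^esub> e') t = assoc_in e t \<otimes>\<^bsub>S'\<^esub> assoc_in e' t"
      by (rule tns_hom_eqI[OF M D assoc_in_hom
            hom_mult_hom[OF S'.comm_group_axioms assoc_in_hom[OF e] assoc_in_hom[OF e']] _ t])
        (use e e' in \<open>simp_all add: assoc_in_pu pu_simps\<close>)
  }
  {
    fix r assume r: "r \<in> carrier R"
    have "(\<lambda>t. ract (M \<boxtimes> D) t r) \<in> hom (M \<boxtimes> D) (M \<boxtimes> D)"
      using r by (auto simp: hom_def MD.ract_closed MD.ract_add_left)
    from hom_compose[OF this assoc_in_hom[OF e]]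
    have h: "(\<lambda>t. assoc_in e (ract (M \<boxtimes> D) t r)) \<in> hom (M \<boxtimes> D) S'" by (simp add: comp_def)
    show "assoc_in e (ract (M \<boxtimes> D) t r) = assoc_in (lact E r e) t"
      by (rule tns_hom_eqI[OF M D h assoc_in_hom _ t])
        (use e r in \<open>simp_all add: assoc_in_pu pu_simps pu_balanced[OF Obj_bimod[OF D] E]\<close>)
  }
qed

lemma assoc_unique:
  assumes "h \<in> hom S B" "k \<in> hom S B"
    "\<And>x d e. x \<in> carrier M \<Longrightarrow> d \<in> carrier (rmod D) \<Longrightarrow> e \<in> carrier (rmod E) \<Longrightarrow>
      h (pu (M \<boxtimes> D) E (pu M D x d) e) = k (pu (M \<boxtimes> D) E (pu M D x d) e)"
    "t \<in> carrier S"
  shows "h t = k t"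
proof (rule tns_hom_eqI[OF MD E assms(1,2) _ assms(4)])
  fix s e assume s: "s \<in> carrier (M \<boxtimes> D)" and e: "e \<in> carrier (rmod E)"
  from s show "h (pu (M \<boxtimes> D) E s e) = k (pu (M \<boxtimes> D) E s e)"
  proof (induction rule: tns_induct[OF M D, consumes 1, case_names pure mult])
    case (mult s t)
    then show ?case using e
      by (simp add: pu_simps hom_mult[OF assms(1)] hom_mult[OF assms(2)])
  qed (use assms(3) e in blast)
qed

text \<open>Lifting the curried map in the remaining variable satisfies the defining description,
  and threefold pure tensors generate the source, which gives uniqueness.\<close>

lemma associator_eq: "associator U R M D E = Arrow S S' (tensor_lift U R (M \<boxtimes> D) E S' (\<lambda>t e. assoc_in e t))"
proof -
  note lift = lift_tns[OF MD E Obj_comm_group[OF S'_Obj] assoc_balanced]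
  have "(THE h. h \<in> hom S S' \<and> h \<in> extensional (carrier S) \<and>
             (\<forall>x\<in>carrier M. \<forall>d\<in>carrier (rmod D). \<forall>e\<in>carrier (rmod E).
                h (pu (M \<boxtimes> D) E (pu M D x d) e) = pu M (D \<boxtimes>\<boxtimes> E) x (pu (rmod D) E d e))) =
      tensor_lift U R (M \<boxtimes> D) E S' (\<lambda>t e. assoc_in e t)"
    (is "_ = ?L")
  proof (rule the_equality, intro conjI ballI)
    show val: "?L (pu (M \<boxtimes> D) E (pu M D x d) e) = pu M (D \<boxtimes>\<boxtimes> E) x (pu (rmod D) E d e)"
      if "x \<in> carrier M" "d \<in> carrier (rmod D)" "e \<in> carrier (rmod E)" for x d e
      using that by (simp add: lift(3) pu_simps assoc_in_pu)
    fix h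
    assume h: "h \<in> hom S S' \<and> h \<in> extensional (carrier S) \<and>
             (\<forall>x\<in>carrier M. \<forall>d\<in>carrier (rmod D). \<forall>e\<in>carrier (rmod E).
                h (pu (M \<boxtimes> D) E (pu M D x d) e) = pu M (D \<boxtimes>\<boxtimes> E) x (pu (rmod D) E d e))"
    show "h = ?L"
    proof (rule extensionalityI)
      show "h \<in> extensional (carrier S)" using h by blast
      show "?L \<in> extensional (carrier S)" by (rule lift(2))
      fix t assume t: "t \<in> carrier S"
      show "h t = ?L t"
        by (rule assoc_unique[OF conjunct1[OF h] lift(1) _ t]) (use h val in simp)
    qed
  qed (rule lift(1,2))+
  then show ?thesis by (simp only: associator_def Let_def)
qed

lemma associator_pu:
  "x \<in> carrier M \<Longrightarrow> d \<in> carrier (rmod D) \<Longrightarrow> e \<in> carrier (rmod E) \<Longrightarrow>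
    mor (associator U R M D E) (pu (M \<boxtimes> D) E (pu M D x d) e) = pu M (D \<boxtimes>\<boxtimes> E) x (pu (rmod D) E d e)"
  by (simp add: associator_eq lift_pu[OF MD E Obj_comm_group[OF S'_Obj] assoc_balanced] pu_simps assoc_in_pu)

lemma associator_Hom: "associator U R M D E \<in> Hom A S S'"
  unfolding associator_eq
proof (rule lift_Hom[OF MD E S'_Obj assoc_balanced])
  fix t e r assume t: "t \<in> carrier (M \<boxtimes> D)" and e: "e \<in> carrier (rmod E)" and r: "r \<in> carrier R"
  have "(\<lambda>t. ract S' t r) \<in> hom S' S'"
    using r by (auto simp: hom_def S'.ract_closed S'.ract_add_left)
  from hom_compose[OF assoc_in_hom[OF e] this]
  have h: "(\<lambda>t. ract S' (assoc_in e t) r) \<in> hom (M \<boxtimes> D) S'" by (simp add: comp_def)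
  show "assoc_in (ract (rmod E) e r) t = ract S' (assoc_in e t) r"
    by (rule tns_hom_eqI[OF M D assoc_in_hom h _ t]) (use e r in \<open>simp_all add: assoc_in_pu pu_simps\<close>)
next
  fix t e i j assume t: "t \<in> deg (M \<boxtimes> D) i" and e: "e \<in> deg (rmod E) j"
  then have ec: "e \<in> carrier (rmod E)" by (simp add: E.deg_closed)
  show "assoc_in e t \<in> deg S' (i + j)"
  proof (rule tns_hom_degree[OF M D S'.graded_group_axioms assoc_in_hom[OF ec] _ t])
    fix x d k l assume x: "x \<in> deg M k" and d: "d \<in> deg (rmod D) l"
    have "pu M (D \<boxtimes>\<boxtimes> E) x (pu (rmod D) E d e) \<in> deg S' (k + (l + j))"
      by (rule pu_deg[OF M bDE x]) (simp add: pu_deg[OF Obj_bimod[OF D] E d e])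
    then show "assoc_in e (pu M D x d) \<in> deg S' (k + l + j)"
      using x d ec by (simp add: assoc_in_pu M.deg_closed D.deg_closed add.assoc)
  qed
qed

text \<open>The mirror image of \<open>assoc_in\<close>, with \<open>x\<close> held fixed; lifting
  it in \<open>x\<close> gives the inverse of the associator.\<close>

definition coassoc_in :: "'u \<Rightarrow> 'u \<Rightarrow> 'u" where
  "coassoc_in x = tensor_lift U R (rmod D) E S (\<lambda>d e. pu (M \<boxtimes> D) E (pu M D x d) e)"

lemma coassoc_in:
  assumes x: "x \<in> carrier M"
  shows coassoc_in_hom: "coassoc_in x \<in> hom (rmod D \<boxtimes> E) S"
    and coassoc_in_pu: "d \<in> carrier (rmod D) \<Longrightarrow> e \<in> carrier (rmod E) \<Longrightarrow>
      coassoc_in x (pu (rmod D) E d e) = pu (M \<boxtimes> D) E (pu M D x d) e"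
proof -
  have bal: "balanced R (rmod D) E S (\<lambda>d e. pu (M \<boxtimes> D) E (pu M D x d) e)"
    by (rule balancedI)
      (use x in \<open>simp_all add: pu_simps pu_ract[OF M D, symmetric] pu_balanced[OF MD E] del: pu_ract[OF M D]\<close>)
  show "coassoc_in x \<in> hom (rmod D \<boxtimes> E) S"
    "d \<in> carrier (rmod D) \<Longrightarrow> e \<in> carrier (rmod E) \<Longrightarrow>
      coassoc_in x (pu (rmod D) E d e) = pu (M \<boxtimes> D) E (pu M D x d) e"
    unfolding coassoc_in_def using lift_tns[OF Obj_bimod[OF D] E Obj_comm_group[OF S_Obj] bal] by auto
qed

lemma coassoc_balanced: "balanced R M (D \<boxtimes>\<boxtimes> E) S coassoc_in"
proof (rule balancedI, unfold tensor_bimod_rmod)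
  fix x u assume x: "x \<in> carrier M" and u: "u \<in> carrier (rmod D \<boxtimes> E)"
  show "coassoc_in x u \<in> carrier S" using hom_in_carrier[OF coassoc_in_hom[OF x] u] .
  {
    fix v assume "v \<in> carrier (rmod D \<boxtimes> E)"
    then show "coassoc_in x (u \<otimes>\<^bsub>rmod D \<boxtimes> E\<^esub> v) = coassoc_in x u \<otimes>\<^bsub>S\<^esub> coassoc_in x v"
      using hom_mult[OF coassoc_in_hom[OF x] u] by blast
  }
  {
    fix y assume y: "y \<in> carrier M"
    show "coassoc_in (x \<otimes>\<^bsub>M\<^esub> y) u = coassoc_in x u \<otimes>\<^bsub>S\<^esub> coassoc_in y u"
      by (rule tns_hom_eqI[OF Obj_bimod[OF D] E coassoc_in_hom
            hom_mult_hom[OF S.comm_group_axioms coassoc_in_hom[OF x] coassoc_in_hom[OF y]] _ u])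
        (use x y in \<open>simp_all add: coassoc_in_pu pu_simps\<close>)
  }
  {
    fix r assume r: "r \<in> carrier R"
    from hom_compose[OF tns_lact_hom[OF D E r] coassoc_in_hom[OF x]]
    have h: "(\<lambda>u. coassoc_in x (lact (D \<boxtimes>\<boxtimes> E) r u)) \<in> hom (rmod D \<boxtimes> E) S" by (simp add: comp_def)
    show "coassoc_in (ract M x r) u = coassoc_in x (lact (D \<boxtimes>\<boxtimes> E) r u)"
      by (rule tns_hom_eqI[OF Obj_bimod[OF D] E coassoc_in_hom h _ u])
        (use x r in \<open>simp_all add: coassoc_in_pu pu_simps pu_balanced[OF M D]\<close>)
  }
qed

text \<open>The lifts of \<open>assoc_in\<close> and \<open>coassoc_in\<close> exchange the two
  kinds of threefold pure tensors, and these generate source and target.\<close>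

lemma associator_iso: "is_iso A (associator U R M D E)"
  and inverse_associator_pu:
    "x \<in> carrier M \<Longrightarrow> d \<in> carrier (rmod D) \<Longrightarrow> e \<in> carrier (rmod E) \<Longrightarrow>
      mor (inverse_arr A (associator U R M D E)) (pu M (D \<boxtimes>\<boxtimes> E) x (pu (rmod D) E d e)) =
      pu (M \<boxtimes> D) E (pu M D x d) e"
proof -
  let ?a = "associator U R M D E"
  let ?b = "Arrow S' S (tensor_lift U R M (D \<boxtimes>\<boxtimes> E) S coassoc_in)"
  note lift = lift_tns[OF M bDE Obj_comm_group[OF S_Obj] coassoc_balanced]
  have b: "?b \<in> Hom A S' S"
  proof (rule lift_Hom[OF M bDE S_Obj coassoc_balanced], unfold tensor_bimod_rmod)
    fix x u r assume x: "x \<in> carrier M" and u: "u \<in> carrier (rmod D \<boxtimes> E)" and r: "r \<in> carrier R"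
    interpret DE: graded_module R "rmod D \<boxtimes> E" using DE by simp
    have "(\<lambda>t. ract (rmod D \<boxtimes> E) t r) \<in> hom (rmod D \<boxtimes> E) (rmod D \<boxtimes> E)"
      "(\<lambda>t. ract S t r) \<in> hom S S"
      using r by (auto simp: hom_def S.ract_closed S.ract_add_left DE.ract_closed DE.ract_add_left)
    from hom_compose[OF this(1) coassoc_in_hom[OF x]] hom_compose[OF coassoc_in_hom[OF x] this(2)]
    have h: "(\<lambda>t. coassoc_in x (ract (rmod D \<boxtimes> E) t r)) \<in> hom (rmod D \<boxtimes> E) S"
      "(\<lambda>t. ract S (coassoc_in x t) r) \<in> hom (rmod D \<boxtimes> E) S" by (simp_all add: comp_def)
    show "coassoc_in x (ract (rmod D \<boxtimes> E) u r) = ract S (coassoc_in x u) r"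
      by (rule tns_hom_eqI[OF Obj_bimod[OF D] E h _ u])
        (use x r in \<open>simp_all add: coassoc_in_pu pu_simps\<close>)
  next
    fix x u i j assume x: "x \<in> deg M i" and u: "u \<in> deg (rmod D \<boxtimes> E) j"
    then have xc: "x \<in> carrier M" by (simp add: M.deg_closed)
    show "coassoc_in x u \<in> deg S (i + j)"
    proof (rule tns_hom_degree[OF Obj_bimod[OF D] E S.graded_group_axioms coassoc_in_hom[OF xc] _ u])
      fix d e k l assume d: "d \<in> deg (rmod D) k" and e: "e \<in> deg (rmod E) l"
      have "pu (M \<boxtimes> D) E (pu M D x d) e \<in> deg S (i + k + l)"
        by (rule pu_deg[OF MD E pu_deg[OF M D x d] e])
      then show "coassoc_in x (pu (rmod D) E d e) \<in> deg S (i + (k + l))"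
        using d e xc by (simp add: coassoc_in_pu E.deg_closed D.deg_closed add.assoc)
    qed
  qed
  have bp: "mor ?b (pu M (D \<boxtimes>\<boxtimes> E) x (pu (rmod D) E d e)) = pu (M \<boxtimes> D) E (pu M D x d) e"
    if "x \<in> carrier M" "d \<in> carrier (rmod D)" "e \<in> carrier (rmod E)" for x d e
    using that by (simp add: lift(3) pu_simps coassoc_in_pu)
  have ba: "?b \<bullet> ?a \<in> Hom A S S" and ab: "?a \<bullet> ?b \<in> Hom A S' S'"
    using GrMod_Comp_Hom associator_Hom b by blast+
  have 1: "mor ?b (mor ?a t) = t" if t: "t \<in> carrier S" for t
  proof -
    have "mor (?b \<bullet> ?a) t = mor (Id A S) t"
      by (rule assoc_unique[OF Hom_hom[OF ba] Hom_hom[OF GrMod_Id_Hom[OF S_Obj]] _ t])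
        (simp add: mor_Comp[OF associator_Hom] pu_simps mor_Id associator_pu bp del: arrow.sel)
    then show ?thesis using t by (simp add: mor_Comp[OF associator_Hom] mor_Id)
  qed
  \<comment> \<open>Pure tensors of \<open>S'\<close> have an arbitrary element of
    \<open>rmod D \<boxtimes> E\<close> as second factor, so a further induction over that element
    is required.\<close>
  have 2: "mor ?a (mor ?b u) = u" if u: "u \<in> carrier S'" for u
  proof -
    have "?a \<bullet> ?b = Id A S'"
    proof (rule tns_Hom_eqI[OF M bDE ab GrMod_Id_Hom[OF S'_Obj]], unfold tensor_bimod_rmod)
      fix x t assume x: "x \<in> carrier M" and t: "t \<in> carrier (rmod D \<boxtimes> E)"
      have "mor (?a \<bullet> ?b) (pu M (D \<boxtimes>\<boxtimes> E) x t) = pu M (D \<boxtimes>\<boxtimes> E) x t"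
        using t
      proof (induction rule: tns_induct[OF Obj_bimod[OF D] E, consumes 1, case_names pure mult])
        case (pure d e)
        then show ?case using x
          by (simp add: mor_Comp[OF b] pu_simps associator_pu bp del: arrow.sel)
      next
        case (mult s t)
        then show ?case using x by (simp add: pu_simps Hom_mult[OF ab])
      qed
      then show "mor (?a \<bullet> ?b) (pu M (D \<boxtimes>\<boxtimes> E) x t) = mor (Id A S') (pu M (D \<boxtimes>\<boxtimes> E) x t)"
        using x t by (simp add: mor_Id pu_simps)
    qed
    then show ?thesis using u by (metis mor_Comp[OF b] mor_Id)
  qed
  note inv = GrMod_is_inverseI[OF associator_Hom b 1 2]
  show "is_iso A ?a" by (rule inv)
  have "?a \<in> Arr A" using associator_Hom by (simp add: Hom_def)
  from A.inverse_arrI[OF this inv(1)]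
  show "x \<in> carrier M \<Longrightarrow> d \<in> carrier (rmod D) \<Longrightarrow> e \<in> carrier (rmod E) \<Longrightarrow>
      mor (inverse_arr A ?a) (pu M (D \<boxtimes>\<boxtimes> E) x (pu (rmod D) E d e)) =
      pu (M \<boxtimes> D) E (pu M D x d) e"
    using bp by simp
qed

end

end

section \<open>Colimits of bipartite diagrams\<close>

text \<open>The sources of the arrows \<open>f k\<close> and \<open>g k\<close> do not occur: they are objects of the diagram, but the
  components of a cocone there are determined by the others.\<close>

definition is_copres_cocone ::
    "('o, 'a) cat \<Rightarrow> 'i set \<Rightarrow> 'k set \<Rightarrow> ('i \<Rightarrow> 'o) \<Rightarrow> ('k \<Rightarrow> 'i) \<Rightarrow> ('k \<Rightarrow> 'i) \<Rightarrow> ('k \<Rightarrow> 'a) \<Rightarrow> ('k \<Rightarrow> 'a)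
      \<Rightarrow> 'o \<Rightarrow> ('i \<Rightarrow> 'a) \<Rightarrow> bool" where
  "is_copres_cocone A I K G s t f g X c \<longleftrightarrow> X \<in> Obj A \<and> (\<forall>i\<in>I. c i \<in> Hom A (G i) X) \<and>
     (\<forall>k\<in>K. c (s k) \<bullet>\<^bsub>A\<^esub> f k = c (t k) \<bullet>\<^bsub>A\<^esub> g k)"

definition is_presentation ::
    "('o, 'a) cat \<Rightarrow> 'i set \<Rightarrow> 'k set \<Rightarrow> ('i \<Rightarrow> 'o) \<Rightarrow> ('k \<Rightarrow> 'i) \<Rightarrow> ('k \<Rightarrow> 'i) \<Rightarrow> ('k \<Rightarrow> 'a) \<Rightarrow> ('k \<Rightarrow> 'a)
      \<Rightarrow> 'o \<Rightarrow> ('i \<Rightarrow> 'a) \<Rightarrow> bool" where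
  "is_presentation A I K G s t f g X c \<longleftrightarrow> is_copres_cocone A I K G s t f g X c \<and>
     (\<forall>Y d. is_copres_cocone A I K G s t f g Y d \<longrightarrow>
        (\<exists>!h. h \<in> Hom A X Y \<and> (\<forall>i\<in>I. h \<bullet>\<^bsub>A\<^esub> c i = d i)))"

text \<open>Names for the index category: \<open>Gen i\<close> and \<open>Rel k\<close> are objects
  and double as their own identities, while \<open>Fst k\<close> and \<open>Snd k\<close> are the
  two arrows that leave \<open>Rel k\<close>.\<close>

datatype ('i, 'k) bip = Gen 'i | Rel 'k | Fst 'k | Snd 'k

text \<open>The encoding \<open>e\<close> moves these names into \<open>'u\<close>, because
  \<open>preserves_colimits\<close> quantifies over categories whose objects and arrows live in that
  type.\<close>

locale bipartite =
  fixes I :: "'i set" and K :: "'k set" and s t :: "'k \<Rightarrow> 'i" and e :: "('i, 'k) bip \<Rightarrow> 'u"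
  assumes s: "k \<in> K \<Longrightarrow> s k \<in> I" and t: "k \<in> K \<Longrightarrow> t k \<in> I"
    and e: "inj_on e (Gen ` I \<union> Rel ` K \<union> Fst ` K \<union> Snd ` K)"
begin

abbreviation "S \<equiv> Gen ` I \<union> Rel ` K \<union> Fst ` K \<union> Snd ` K"

definition dec :: "'u \<Rightarrow> ('i, 'k) bip" where "dec = inv_into S e"

lemma dec_e: "z \<in> S \<Longrightarrow> dec (e z) = z"
  unfolding dec_def using e by (rule inv_into_f_f)

lemma dec_simps [simp]: "i \<in> I \<Longrightarrow> dec (e (Gen i)) = Gen i" "k \<in> K \<Longrightarrow> dec (e (Rel k)) = Rel k"
  "k \<in> K \<Longrightarrow> dec (e (Fst k)) = Fst k" "k \<in> K \<Longrightarrow> dec (e (Snd k)) = Snd k"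
  by (simp_all add: dec_e)

text \<open>All arrows other than identities run from a \<open>Rel\<close> to a \<open>Gen\<close>,
  so two of them never compose. In a composite, \<open>u\<close> is the result if it is
  \<open>Fst\<close> or \<open>Snd\<close>; otherwise \<open>u\<close> is an identity and
  \<open>v\<close> is the result.\<close>

definition J :: "('u, 'u) cat" where
  "J = \<lparr>Obj = e ` (Gen ` I \<union> Rel ` K), Arr = e ` S,
        Dom = (\<lambda>u. case dec u of Fst k \<Rightarrow> e (Rel k) | Snd k \<Rightarrow> e (Rel k) | _ \<Rightarrow> u),
        Cod = (\<lambda>u. case dec u of Fst k \<Rightarrow> e (Gen (s k)) | Snd k \<Rightarrow> e (Gen (t k)) | _ \<Rightarrow> u),
        Id = (\<lambda>x. x),
        Comp = (\<lambda>v u. case dec u of Fst k \<Rightarrow> u | Snd k \<Rightarrow> u | _ \<Rightarrow> v)\<rparr>"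

lemma J_Hom: "u \<in> Hom J x y \<longleftrightarrow>
    (\<exists>i\<in>I. u = e (Gen i) \<and> x = e (Gen i) \<and> y = e (Gen i)) \<or>
    (\<exists>k\<in>K. u = e (Rel k) \<and> x = e (Rel k) \<and> y = e (Rel k)) \<or>
    (\<exists>k\<in>K. u = e (Fst k) \<and> x = e (Rel k) \<and> y = e (Gen (s k))) \<or>
    (\<exists>k\<in>K. u = e (Snd k) \<and> x = e (Rel k) \<and> y = e (Gen (t k)))"
  by (auto simp: Hom_def J_def)

lemma e_eq [simp]: "i \<in> I \<Longrightarrow> j \<in> I \<Longrightarrow> e (Gen i) = e (Gen j) \<longleftrightarrow> i = j"
  "k \<in> K \<Longrightarrow> l \<in> K \<Longrightarrow> e (Rel k) = e (Rel l) \<longleftrightarrow> k = l"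
  "i \<in> I \<Longrightarrow> k \<in> K \<Longrightarrow> e (Gen i) \<noteq> e (Rel k)" "i \<in> I \<Longrightarrow> k \<in> K \<Longrightarrow> e (Rel k) \<noteq> e (Gen i)"
  using dec_simps by (metis bip.inject bip.distinct(1))+

lemma J_category: "category J"
proof
  show "f \<in> Arr J \<Longrightarrow> Dom J f \<in> Obj J" "f \<in> Arr J \<Longrightarrow> Cod J f \<in> Obj J" for f
    by (auto simp: J_def s t)
  show "x \<in> Obj J \<Longrightarrow> Id J x \<in> Hom J x x" for x
    unfolding J_Hom by (auto simp: J_def)
  fix f x y assume f: "f \<in> Hom J x y"
  show "f \<bullet>\<^bsub>J\<^esub> Id J x = f" "Id J y \<bullet>\<^bsub>J\<^esub> f = f"
    using f unfolding J_Hom by (auto simp: J_def)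
next
  fix f g x y z assume "f \<in> Hom J x y" "g \<in> Hom J y z"
  then show "g \<bullet>\<^bsub>J\<^esub> f \<in> Hom J x z"
    unfolding J_Hom by (auto simp: J_def s t)
next
  fix f g h w x y z assume "f \<in> Hom J w x" "g \<in> Hom J x y" "h \<in> Hom J y z"
  then show "h \<bullet>\<^bsub>J\<^esub> g \<bullet>\<^bsub>J\<^esub> f = h \<bullet>\<^bsub>J\<^esub> (g \<bullet>\<^bsub>J\<^esub> f)"
    unfolding J_Hom by (auto simp: J_def s t)
qed

context
  fixes B :: "('o, 'a) cat" and D :: "('u, 'u, 'o, 'a) fctr"
  assumes D: "cat_functor J B D"
begin

interpretation D: cat_functor J B D by (rule D)

abbreviation "is_pcc \<equiv> is_copres_cocone B I K (\<lambda>i. fobj D (e (Gen i))) s t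
    (\<lambda>k. farr D (e (Fst k))) (\<lambda>k. farr D (e (Snd k)))"

lemma D_Id: "i \<in> I \<Longrightarrow> farr D (e (Gen i)) = Id B (fobj D (e (Gen i)))"
  "k \<in> K \<Longrightarrow> farr D (e (Rel k)) = Id B (fobj D (e (Rel k)))"
  using D.farr_Id by (auto simp: J_def)

lemma D_Fst: "k \<in> K \<Longrightarrow> farr D (e (Fst k)) \<in> Hom B (fobj D (e (Rel k))) (fobj D (e (Gen (s k))))"
  "k \<in> K \<Longrightarrow> farr D (e (Snd k)) \<in> Hom B (fobj D (e (Rel k))) (fobj D (e (Gen (t k))))"
  by (rule D.farr_Hom; auto simp: J_Hom)+

text \<open>Naturality along \<open>Fst k\<close> fixes the component at \<open>Rel k\<close>;
  naturality along \<open>Snd k\<close> then becomes the coequalising condition of a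
  presentation.\<close>

lemma cocone_iff: "is_cocone J B D Y d \<longleftrightarrow> is_pcc Y (\<lambda>i. d (e (Gen i))) \<and>
    (\<forall>k\<in>K. d (e (Rel k)) = d (e (Gen (s k))) \<bullet>\<^bsub>B\<^esub> farr D (e (Fst k)))"
    (is "_ \<longleftrightarrow> ?R")
proof
  assume c: "is_cocone J B D Y d"
  have "d (e (Rel k)) = d (e (Gen (s k))) \<bullet>\<^bsub>B\<^esub> farr D (e (Fst k))"
    "d (e (Rel k)) = d (e (Gen (t k))) \<bullet>\<^bsub>B\<^esub> farr D (e (Snd k))" if k: "k \<in> K" for k
  proof -
    have nat: "u \<in> Arr J \<Longrightarrow> d (Cod J u) \<bullet>\<^bsub>B\<^esub> farr D u = d (Dom J u)" for u
      using c by (simp add: is_cocone_def)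
    show "d (e (Rel k)) = d (e (Gen (s k))) \<bullet>\<^bsub>B\<^esub> farr D (e (Fst k))"
      using nat[of "e (Fst k)"] k by (simp add: J_def)
    show "d (e (Rel k)) = d (e (Gen (t k))) \<bullet>\<^bsub>B\<^esub> farr D (e (Snd k))"
      using nat[of "e (Snd k)"] k by (simp add: J_def)
  qed
  then show ?R using c by (auto simp: is_copres_cocone_def is_cocone_def J_def)
next
  assume R: ?R
  have Gen: "d (e (Gen i)) \<in> Hom B (fobj D (e (Gen i))) Y" if "i \<in> I" for i
    using R that by (auto simp: is_copres_cocone_def)
  have Rel: "d (e (Rel k)) \<in> Hom B (fobj D (e (Rel k))) Y" if "k \<in> K" for k
    using R that D.B.Comp_Hom[OF D_Fst(1)[OF that] Gen[OF s[OF that]]] by simp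
  show "is_cocone J B D Y d"
    unfolding is_cocone_def
  proof (intro conjI ballI D)
    show "Y \<in> Obj B" using R by (simp add: is_copres_cocone_def)
    show "j \<in> Obj J \<Longrightarrow> d j \<in> Hom B (fobj D j) Y" for j
      using Gen Rel by (auto simp: J_def)
    fix u assume "u \<in> Arr J"
    then consider i where "i \<in> I" "u = e (Gen i)" | k where "k \<in> K" "u = e (Rel k)"
      | k where "k \<in> K" "u = e (Fst k)" | k where "k \<in> K" "u = e (Snd k)"
      by (auto simp: J_def)
    then show "d (Cod J u) \<bullet>\<^bsub>B\<^esub> farr D u = d (Dom J u)"
    proof cases
      case 1
      then show ?thesis using D.B.Comp_Id[OF Gen] by (simp add: J_def D_Id)
    next
      case 2
      then show ?thesis using D.B.Comp_Id[OF Rel] by (simp add: J_def D_Id)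
    next
      case 3
      then show ?thesis using R by (simp add: J_def)
    next
      case 4
      then show ?thesis using R by (simp add: J_def is_copres_cocone_def)
    qed
  qed
qed

lemma colimit_iff: "is_colimit J B D X c \<longleftrightarrow>
    is_presentation B I K (\<lambda>i. fobj D (e (Gen i))) s t (\<lambda>k. farr D (e (Fst k))) (\<lambda>k. farr D (e (Snd k)))
      X (\<lambda>i. c (e (Gen i))) \<and>
    (\<forall>k\<in>K. c (e (Rel k)) = c (e (Gen (s k))) \<bullet>\<^bsub>B\<^esub> farr D (e (Fst k)))"
proof -
  \<comment> \<open>A mediating arrow has to be tested at the generators only: at
    \<open>Rel k\<close> the condition follows by composing with the image of
    \<open>Fst k\<close>.\<close>
  have eq: "(\<forall>j\<in>Obj J. h \<bullet>\<^bsub>B\<^esub> c j = d j) \<longleftrightarrow> (\<forall>i\<in>I. h \<bullet>\<^bsub>B\<^esub> c (e (Gen i)) = d (e (Gen i)))"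
    if c: "is_cocone J B D X c" and d: "is_cocone J B D Y d" and h: "h \<in> Hom B X Y" for h Y d
  proof -
    have "h \<bullet>\<^bsub>B\<^esub> c (e (Rel k)) = d (e (Rel k))"
      if k: "k \<in> K" and "\<forall>i\<in>I. h \<bullet>\<^bsub>B\<^esub> c (e (Gen i)) = d (e (Gen i))" for k
    proof -
      have "c (e (Gen (s k))) \<in> Hom B (fobj D (e (Gen (s k)))) X"
        using c s[OF k] by (auto simp: cocone_iff is_copres_cocone_def)
      from D.B.Comp_assoc[OF D_Fst(1)[OF k] this h] show ?thesis
        using that c d s[OF k] by (simp add: cocone_iff)
    qed
    then show ?thesis by (auto simp: J_def)
  qed
  show ?thesis
  proof
    assume L: "is_colimit J B D X c"
    then have c: "is_cocone J B D X c" by (simp add: is_colimit_def)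
    have "\<exists>!h. h \<in> Hom B X Y \<and> (\<forall>i\<in>I. h \<bullet>\<^bsub>B\<^esub> c (e (Gen i)) = d i)" if "is_pcc Y d" for Y d
    proof -
      \<comment> \<open>A cocone on the generators is extended to \<open>Rel k\<close> along
        \<open>Fst k\<close>; the remaining names are not objects.\<close>
      let ?d = "\<lambda>x. case dec x of Gen i \<Rightarrow> d i | Rel k \<Rightarrow> d (s k) \<bullet>\<^bsub>B\<^esub> farr D (e (Fst k)) | _ \<Rightarrow> undefined"
      have dd: "is_cocone J B D Y ?d"
        using that by (simp add: cocone_iff is_copres_cocone_def s t)
      then have "\<exists>!h. h \<in> Hom B X Y \<and> (\<forall>j\<in>Obj J. h \<bullet>\<^bsub>B\<^esub> c j = ?d j)"
        using L unfolding is_colimit_def by blast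
      then show ?thesis using eq[OF c dd] by (simp cong: conj_cong)
    qed
    then show "is_presentation B I K (\<lambda>i. fobj D (e (Gen i))) s t (\<lambda>k. farr D (e (Fst k)))
        (\<lambda>k. farr D (e (Snd k))) X (\<lambda>i. c (e (Gen i))) \<and>
      (\<forall>k\<in>K. c (e (Rel k)) = c (e (Gen (s k))) \<bullet>\<^bsub>B\<^esub> farr D (e (Fst k)))"
      using c unfolding is_presentation_def cocone_iff by blast
  next
    assume R: "is_presentation B I K (\<lambda>i. fobj D (e (Gen i))) s t (\<lambda>k. farr D (e (Fst k)))
        (\<lambda>k. farr D (e (Snd k))) X (\<lambda>i. c (e (Gen i))) \<and>
      (\<forall>k\<in>K. c (e (Rel k)) = c (e (Gen (s k))) \<bullet>\<^bsub>B\<^esub> farr D (e (Fst k)))"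
    then have c: "is_cocone J B D X c" by (simp add: is_presentation_def cocone_iff)
    have "\<exists>!h. h \<in> Hom B X Y \<and> (\<forall>j\<in>Obj J. h \<bullet>\<^bsub>B\<^esub> c j = d j)" if d: "is_cocone J B D Y d" for Y d
    proof -
      have "is_pcc Y (\<lambda>i. d (e (Gen i)))" using d by (simp add: cocone_iff)
      then have "\<exists>!h. h \<in> Hom B X Y \<and> (\<forall>i\<in>I. h \<bullet>\<^bsub>B\<^esub> c (e (Gen i)) = d (e (Gen i)))"
        using R unfolding is_presentation_def by blast
      then show ?thesis using eq[OF c d] by (simp cong: conj_cong)
    qed
    then show "is_colimit J B D X c" using c by (simp add: is_colimit_def)
  qed
qed

end

end

lemma is_presentation_cong:
  assumes "\<And>i. i \<in> I \<Longrightarrow> G i = G' i \<and> c i = c' i" "\<And>k. k \<in> K \<Longrightarrow> f k = f' k \<and> g k = g' k \<and> s k \<in> I \<and> t k \<in> I"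
  shows "is_presentation A I K G s t f g X c \<longleftrightarrow> is_presentation A I K G' s t f' g' X c'"
  using assms by (simp add: is_presentation_def is_copres_cocone_def cong: conj_cong ball_cong)

lemma Un_lepoll_infinite: "A \<lesssim> Z \<Longrightarrow> B \<lesssim> Z \<Longrightarrow> infinite Z \<Longrightarrow> A \<union> B \<lesssim> Z"
  unfolding lepoll_def card_of_ordLeq by (rule card_of_Un_ordLeq_infinite)

text \<open>The presentation is rewritten as a colimit over \<open>J\<close>, the functor is
  applied, and the result is read back. The index sets may have any type as long as they inject into
  a small infinite set \<open>Z\<close>.\<close>

lemma preserves_presentation:
  fixes U :: "'u set set" and A :: "('o, 'a) cat" and B :: "('p, 'b) cat"
    and F :: "('o, 'a, 'p, 'b, 'm) fctr_scheme" and I :: "'i set" and K :: "'k set"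
  assumes U: "small_universe U" and F: "cat_functor A B F" and pres: "preserves_colimits U A B F"
    and I: "I \<lesssim> Z" and K: "K \<lesssim> Z" and Z: "(Z :: 'u set) \<in> U" "infinite Z"
    and st: "\<And>k. k \<in> K \<Longrightarrow> s k \<in> I \<and> t k \<in> I"
    and G: "\<And>i. i \<in> I \<Longrightarrow> G i \<in> Obj A" and P: "\<And>k. k \<in> K \<Longrightarrow> P k \<in> Obj A"
    and f: "\<And>k. k \<in> K \<Longrightarrow> f k \<in> Hom A (P k) (G (s k))"
    and g: "\<And>k. k \<in> K \<Longrightarrow> g k \<in> Hom A (P k) (G (t k))"
    and p: "is_presentation A I K G s t f g X c"
  shows "is_presentation B I K (\<lambda>i. fobj F (G i)) s t (\<lambda>k. farr F (f k)) (\<lambda>k. farr F (g k))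
    (fobj F X) (\<lambda>i. farr F (c i))"
proof -
  interpret small_universe U by (rule U)
  interpret F: cat_functor A B F by (rule F)
  let ?S = "Gen ` I \<union> Rel ` K \<union> Fst ` K \<union> Snd ` K :: ('i, 'k) bip set"
  have "?S \<lesssim> Z"
    by (intro Un_lepoll_infinite lepoll_trans[OF image_lepoll I] lepoll_trans[OF image_lepoll K] Z(2))
  then obtain e :: "('i, 'k) bip \<Rightarrow> 'u" where e_inj: "inj_on e ?S" and e_U: "e ` ?S \<in> U"
    using small_code[OF Z(1)] by blast
  interpret bipartite I K s t e
    using st e_inj by unfold_locales auto
  have small: "small_category U J"
    using J_category e_U small_subset[OF e_U, of "Obj J"] by (auto simp: small_category_def J_def)
  define D :: "('u, 'u, 'o, 'a) fctr" where
    "D = \<lparr>fobj = (\<lambda>x. case dec x of Gen i \<Rightarrow> G i | Rel k \<Rightarrow> P k | _ \<Rightarrow> undefined),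
          farr = (\<lambda>u. case dec u of Gen i \<Rightarrow> Id A (G i) | Rel k \<Rightarrow> Id A (P k) | Fst k \<Rightarrow> f k | Snd k \<Rightarrow> g k)\<rparr>"
  have D: "cat_functor J A D"
  proof (intro cat_functor.intro cat_functor_axioms.intro J_category F.A.category_axioms)
    show "x \<in> Obj J \<Longrightarrow> fobj D x \<in> Obj A" for x
      using G P by (auto simp: J_def D_def)
    show "x \<in> Obj J \<Longrightarrow> farr D (Id J x) = Id A (fobj D x)" for x
      by (auto simp: J_def D_def)
    show h: "u \<in> Hom J x y \<Longrightarrow> farr D u \<in> Hom A (fobj D x) (fobj D y)" for u x y
      unfolding J_Hom using G P f g F.A.Id_Hom st by (auto simp: D_def)
    show "farr D (v \<bullet>\<^bsub>J\<^esub> u) = farr D v \<bullet>\<^bsub>A\<^esub> farr D u"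
      if u: "u \<in> Hom J x y" and v: "v \<in> Hom J y z" for u v x y z
    proof -
      \<comment> \<open>One of two composable arrows of \<open>J\<close> is an identity, so
        functoriality reduces to the unit laws.\<close>
      have "(v = y \<and> y = z \<and> farr D v = Id A (fobj D z) \<and> v \<bullet>\<^bsub>J\<^esub> u = u) \<or>
        (u = x \<and> x = y \<and> farr D u = Id A (fobj D x) \<and> v \<bullet>\<^bsub>J\<^esub> u = v)"
        using u v st unfolding J_Hom by (auto simp: J_def D_def)
      then show ?thesis
        using F.A.Id_Comp[OF h[OF u]] F.A.Comp_Id[OF h[OF v]] by auto
    qed
  qed
  let ?c = "\<lambda>x. case dec x of Gen i \<Rightarrow> c i | Rel k \<Rightarrow> c (s k) \<bullet>\<^bsub>A\<^esub> f k | _ \<Rightarrow> undefined"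
  have "is_colimit J A D X ?c"
    unfolding colimit_iff[OF D]
    using p by (subst is_presentation_cong[where G' = G and f' = f and g' = g and c' = c])
      (auto simp: D_def st)
  then have col: "is_colimit J B (comp_functor F D) (fobj F X) (\<lambda>j. farr F (?c j))"
    using pres small unfolding preserves_colimits_def by blast
  have FD: "cat_functor J B (comp_functor F D)"
    using col by (simp add: is_colimit_def is_cocone_def)
  show ?thesis
    using conjunct1[OF col[unfolded colimit_iff[OF FD]]]
    by (subst (asm) is_presentation_cong[where G' = "\<lambda>i. fobj F (G i)" and f' = "\<lambda>k. farr F (f k)"
          and g' = "\<lambda>k. farr F (g k)" and c' = "\<lambda>i. farr F (c i)"])
      (auto simp: D_def st comp_functor_def)
qed

section \<open>Morphisms of comonads\<close>

context category
begin

lemma Hom_iff: "f \<in> Hom A x y \<longleftrightarrow> f \<in> Arr A \<and> Dom A f = x \<and> Cod A f = y"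
  by (simp add: Hom_def)

lemma arr_simps [simp]:
  assumes "f \<in> Arr A" "g \<in> Arr A" "Cod A f = Dom A g"
  shows "g \<bullet> f \<in> Arr A" "Dom A (g \<bullet> f) = Dom A f" "Cod A (g \<bullet> f) = Cod A g"
  using Comp_Hom[of f "Dom A f" "Cod A f" g "Cod A g"] assms by (simp_all add: Hom_iff)

lemma id_simps [simp]:
  assumes "x \<in> Obj A"
  shows "Id A x \<in> Arr A" "Dom A (Id A x) = x" "Cod A (Id A x) = x"
  using Id_Hom[OF assms] by (simp_all add: Hom_iff)

lemma obj_simps [simp]: "f \<in> Arr A \<Longrightarrow> Dom A f \<in> Obj A" "f \<in> Arr A \<Longrightarrow> Cod A f \<in> Obj A"
  by (rule Dom_Obj Cod_Obj; assumption)+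

lemma id_comp [simp]: "f \<in> Arr A \<Longrightarrow> Cod A f = x \<Longrightarrow> Id A x \<bullet> f = f"
  "f \<in> Arr A \<Longrightarrow> Dom A f = x \<Longrightarrow> f \<bullet> Id A x = f"
  using Id_Comp[of f "Dom A f" x] Comp_Id[of f x "Cod A f"] by (simp_all add: Hom_iff)

lemma comp_assoc [simp]:
  "f \<in> Arr A \<Longrightarrow> g \<in> Arr A \<Longrightarrow> h \<in> Arr A \<Longrightarrow> Cod A f = Dom A g \<Longrightarrow> Cod A g = Dom A h \<Longrightarrow>
    (h \<bullet> g) \<bullet> f = h \<bullet> (g \<bullet> f)"
  using Comp_assoc[of f "Dom A f" "Cod A f" g "Cod A g" h "Cod A h"] by (simp add: Hom_iff)

text \<open>Composites are normalised to right-nested form, where \<open>g \<bullet> f\<close> is no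
  longer a subterm of a longer composite. This form of the equation still applies there.\<close>

lemma comp_extend:
  assumes "g \<bullet> f = h \<bullet> k" "f \<in> Arr A" "g \<in> Arr A" "h \<in> Arr A" "k \<in> Arr A" "Cod A f = Dom A g"
    "Cod A k = Dom A h" "u \<in> Arr A" "Cod A u = Dom A f"
  shows "g \<bullet> (f \<bullet> u) = h \<bullet> (k \<bullet> u)"
proof -
  have "Dom A f = Dom A k" using assms(1-7) by (metis arr_simps(2))
  then show ?thesis using assms by (simp flip: comp_assoc)
qed

lemma comp_extend':
  assumes "g \<bullet> f = h" "f \<in> Arr A" "g \<in> Arr A" "Cod A f = Dom A g" "u \<in> Arr A" "Cod A u = Dom A f"
  shows "g \<bullet> (f \<bullet> u) = h \<bullet> u"
  using assms by (simp flip: comp_assoc)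

lemma iso_cancel_right:
  assumes "is_iso A f" "g \<in> Arr A" "h \<in> Arr A" "Dom A g = Cod A f" "Dom A h = Cod A f" "g \<bullet> f = h \<bullet> f"
  shows "g = h"
proof -
  have f: "f \<in> Arr A" using assms(1) by (simp add: is_iso_def)
  note inv = inverse_arr[OF assms(1), of "Dom A f" "Cod A f"]
  have i: "inverse_arr A f \<in> Arr A" "Cod A (inverse_arr A f) = Dom A f"
    using inv(1) f by (simp_all add: Hom_iff)
  have inv_r: "f \<bullet> inverse_arr A f = Id A (Cod A f)" using inv(3) f by (simp add: Hom_iff)
  have "k = (k \<bullet> f) \<bullet> inverse_arr A f" if "k \<in> Arr A" "Dom A k = Cod A f" for k
    using that f i by (simp add: inv_r)
  then show ?thesis using assms by metis
qed

end

context cat_functor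
begin

lemma farr_simps [simp]:
  assumes "f \<in> Arr A"
  shows "farr F f \<in> Arr B" "Dom B (farr F f) = fobj F (Dom A f)" "Cod B (farr F f) = fobj F (Cod A f)"
  using farr_Hom[of f "Dom A f" "Cod A f"] assms by (simp_all add: Hom_def)

lemma farr_comp: "f \<in> Arr A \<Longrightarrow> g \<in> Arr A \<Longrightarrow> Cod A f = Dom A g \<Longrightarrow>
    farr F (g \<bullet>\<^bsub>A\<^esub> f) = farr F g \<bullet>\<^bsub>B\<^esub> farr F f"
  using farr_Comp[of f "Dom A f" "Cod A f" g "Cod A g"] by (simp add: Hom_def)

lemmas fobj_simps [simp] = fobj_Obj

end

context nat_trans
begin

lemma component_simps [simp]:
  assumes "x \<in> Obj A"
  shows "t x \<in> Arr B" "Dom B (t x) = fobj F x" "Cod B (t x) = fobj G x"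
  using component_Hom[OF assms] by (simp_all add: Hom_def)

lemma natural: "f \<in> Arr A \<Longrightarrow> t (Cod A f) \<bullet>\<^bsub>B\<^esub> farr F f = farr G f \<bullet>\<^bsub>B\<^esub> t (Dom A f)"
  using naturality[of f "Dom A f" "Cod A f"] by (simp add: Hom_def)

end

lemma functor_simps [simp]: "fobj (comp_functor G F) x = fobj G (fobj F x)"
  "farr (comp_functor G F) f = farr G (farr F f)" "fobj id_functor x = x" "farr id_functor f = f"
  by (simp_all add: comp_functor_def id_functor_def)

lemma comp_functor: "cat_functor A B F \<Longrightarrow> cat_functor B D G \<Longrightarrow> cat_functor A D (comp_functor G F)"
proof -
  assume F: "cat_functor A B F" and G: "cat_functor B D G"
  interpret F: cat_functor A B F by (rule F)
  interpret G: cat_functor B D G by (rule G)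
  show ?thesis
    using F.farr_Comp G.farr_Comp[OF F.farr_Hom F.farr_Hom]
    by (intro cat_functor.intro cat_functor_axioms.intro F.A.category_axioms G.B.category_axioms)
      (simp_all add: F.farr_Id G.farr_Id F.farr_Hom G.farr_Hom)
qed

lemma id_functor: "category A \<Longrightarrow> cat_functor A A id_functor"
  by (simp add: cat_functor_def cat_functor_axioms_def category.Id_Hom)

text \<open>The functors in question are identities only on genuine objects and arrows of
  \<open>A\<close>, not as functions, so the comparison has identity arrows as components.\<close>

lemma identity_nat_iso:
  assumes H: "cat_functor A A H" and obj: "\<And>x. x \<in> Obj A \<Longrightarrow> fobj H x = x"
    and arr: "\<And>f. f \<in> Arr A \<Longrightarrow> farr H f = f"
  shows "nat_iso A A id_functor H (Id A)" and "nat_iso A A H id_functor (Id A)"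
proof -
  interpret H: cat_functor A A H by (rule H)
  have id: "cat_functor A A id_functor" by (rule id_functor[OF H.A.category_axioms])
  have iso: "is_iso A (Id A x)" if "x \<in> Obj A" for x
    using that unfolding is_iso_def is_inverse_def
    by (intro conjI exI[of _ "Id A x"]) (simp_all add: H.A.Hom_iff)
  show "nat_iso A A id_functor H (Id A)" "nat_iso A A H id_functor (Id A)"
    unfolding nat_iso_def nat_iso_axioms_def nat_trans_def nat_trans_axioms_def
    using H id iso obj arr by (auto simp: H.A.Hom_iff)
qed

text \<open>Functor and typed structure arrows without the comonad laws: the tensor functor starts
  with only this much, and its laws are derived.\<close>

locale comonad_data = category A + C: cat_functor A A C
  for A :: "('o, 'a) cat" (structure) and C :: "('o, 'a) comonad" +
  assumes comult_Hom: "x \<in> Obj A \<Longrightarrow> comult C x \<in> Hom A (fobj C x) (fobj C (fobj C x))"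
    and counit_Hom: "x \<in> Obj A \<Longrightarrow> counit C x \<in> Hom A (fobj C x) x"
begin

lemma comonad_simps [simp]:
  assumes "x \<in> Obj A"
  shows "comult C x \<in> Arr A" "Dom A (comult C x) = fobj C x" "Cod A (comult C x) = fobj C (fobj C x)"
    "counit C x \<in> Arr A" "Dom A (counit C x) = fobj C x" "Cod A (counit C x) = x"
  using comult_Hom[OF assms] counit_Hom[OF assms] by (simp_all add: Hom_iff)

end

lemma is_comonad_data:
  assumes "is_comonad A C" shows "comonad_data A C"
proof -
  interpret is_comonad A C by fact
  show ?thesis
    using comult.component_Hom counit.component_Hom
    by (intro comonad_data.intro comonad_data_axioms.intro comult.F.A.category_axioms
        comult.F.cat_functor_axioms) auto
qed

text \<open>Laws are assumed for \<open>C\<close> only. Invertibility of \<open>\<theta>\<close> and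
  the two compatibilities carry them over to \<open>T\<close>.\<close>

locale comonad_transport = category A + C: is_comonad A C + T: comonad_data A T + \<theta>: nat_iso A A C T \<theta>
  for A :: "('o, 'a) cat" (structure) and C T :: "('o, 'a) comonad" and \<theta> :: "'o \<Rightarrow> 'a" +
  assumes counit_compat: "x \<in> Obj A \<Longrightarrow> counit T x \<bullet> \<theta> x = counit C x"
    and comult_compat: "x \<in> Obj A \<Longrightarrow>
      comult T x \<bullet> \<theta> x = farr T (\<theta> x) \<bullet> (\<theta> (fobj C x) \<bullet> comult C x)"
begin

sublocale C: comonad_data A C by (rule is_comonad_data[OF C.is_comonad_axioms])

text \<open>Each law of \<open>T\<close> is an equation between arrows out of
  \<open>fobj T x\<close>; after precomposition with \<open>\<theta> x\<close> it turns into a law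
  of \<open>C\<close>.\<close>

lemma cancel:
  assumes "x \<in> Obj A" "g \<in> Arr A" "h \<in> Arr A" "Dom A g = fobj T x" "Dom A h = fobj T x"
    "g \<bullet> \<theta> x = h \<bullet> \<theta> x"
  shows "g = h"
  using iso_cancel_right[OF \<theta>.component_iso[OF assms(1)] assms(2,3)] assms by simp

lemma counit_compat': "x \<in> Obj A \<Longrightarrow> u \<in> Arr A \<Longrightarrow> Cod A u = fobj C x \<Longrightarrow>
    counit T x \<bullet> (\<theta> x \<bullet> u) = counit C x \<bullet> u"
  using comp_extend'[OF counit_compat] by simp

lemma comult_compat': "x \<in> Obj A \<Longrightarrow> u \<in> Arr A \<Longrightarrow> Cod A u = fobj C x \<Longrightarrow>
    comult T x \<bullet> (\<theta> x \<bullet> u) = farr T (\<theta> x) \<bullet> (\<theta> (fobj C x) \<bullet> (comult C x \<bullet> u))"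
  using comp_extend'[OF comult_compat, of x u] by simp

lemma theta_natural: "f \<in> Arr A \<Longrightarrow> Dom A f = x \<Longrightarrow> farr T f \<bullet> \<theta> x = \<theta> (Cod A f) \<bullet> farr C f"
  using \<theta>.natural[of f] by simp

lemma theta_natural': "f \<in> Arr A \<Longrightarrow> Dom A f = x \<Longrightarrow> u \<in> Arr A \<Longrightarrow> Cod A u = fobj C x \<Longrightarrow>
    farr T f \<bullet> (\<theta> x \<bullet> u) = \<theta> (Cod A f) \<bullet> (farr C f \<bullet> u)"
  using comp_extend[OF theta_natural, of f x u] obj_simps(1)[of f] by simp

lemma delta_natural: "f \<in> Arr A \<Longrightarrow> Cod A f = y \<Longrightarrow>
    comult C y \<bullet> farr C f = farr C (farr C f) \<bullet> comult C (Dom A f)"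
  using C.comult.natural[of f] by simp

text \<open>Precomposing with \<open>\<theta>\<close> moves the comultiplication over to
  \<open>C\<close>, where it is natural; naturality of \<open>\<theta>\<close> then brings the
  arrows back.\<close>

lemma comult_T_natural:
  assumes f: "f \<in> Arr A"
  shows "comult T (Cod A f) \<bullet> farr T f = farr T (farr T f) \<bullet> comult T (Dom A f)"
proof -
  let ?x = "Dom A f" and ?y = "Cod A f"
  have x: "?x \<in> Obj A" and y: "?y \<in> Obj A" using f by simp_all
  show ?thesis
  proof (rule cancel[OF x])
    have "(comult T ?y \<bullet> farr T f) \<bullet> \<theta> ?x = comult T ?y \<bullet> (\<theta> ?y \<bullet> farr C f)"
      using f by (simp add: theta_natural)
    also have "\<dots> = farr T (\<theta> ?y) \<bullet> (\<theta> (fobj C ?y) \<bullet> (farr C (farr C f) \<bullet> comult C ?x))"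
      using f by (simp add: comult_compat' delta_natural)
    also have "\<dots> = farr T (\<theta> ?y) \<bullet> (farr T (farr C f) \<bullet> (\<theta> (fobj C ?x) \<bullet> comult C ?x))"
      using f by (simp add: theta_natural')
    also have "\<dots> = farr T (\<theta> ?y \<bullet> farr C f) \<bullet> (\<theta> (fobj C ?x) \<bullet> comult C ?x)"
      using f by (simp add: T.C.farr_comp)
    also have "\<dots> = farr T (farr T f \<bullet> \<theta> ?x) \<bullet> (\<theta> (fobj C ?x) \<bullet> comult C ?x)"
      using f by (simp add: theta_natural)
    also have "\<dots> = (farr T (farr T f) \<bullet> comult T ?x) \<bullet> \<theta> ?x"
      using f by (simp add: comult_compat T.C.farr_comp)
    finally show "(comult T ?y \<bullet> farr T f) \<bullet> \<theta> ?x = (farr T (farr T f) \<bullet> comult T ?x) \<bullet> \<theta> ?x" .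
  qed (use f in simp_all)
qed

lemma counit_T_natural:
  assumes f: "f \<in> Arr A"
  shows "counit T (Cod A f) \<bullet> farr T f = f \<bullet> counit T (Dom A f)"
proof (rule cancel[of "Dom A f"])
  show "(counit T (Cod A f) \<bullet> farr T f) \<bullet> \<theta> (Dom A f) = (f \<bullet> counit T (Dom A f)) \<bullet> \<theta> (Dom A f)"
    using f C.counit.natural[OF f] by (simp add: theta_natural counit_compat counit_compat')
qed (use f in simp_all)

lemma comult_coassoc_T:
  assumes x: "x \<in> Obj A"
  shows "farr T (comult T x) \<bullet> comult T x = comult T (fobj T x) \<bullet> comult T x"
proof (rule cancel[OF x])
  have "(farr T (comult T x) \<bullet> comult T x) \<bullet> \<theta> x =
      farr T (comult T x \<bullet> \<theta> x) \<bullet> (\<theta> (fobj C x) \<bullet> comult C x)"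
    using x by (subst T.C.farr_comp) (simp_all add: comult_compat)
  also have "\<dots> = farr T (farr T (\<theta> x)) \<bullet> (farr T (\<theta> (fobj C x)) \<bullet>
      (farr T (comult C x) \<bullet> (\<theta> (fobj C x) \<bullet> comult C x)))"
    unfolding comult_compat[OF x] using x by (simp add: T.C.farr_comp)
  also have "\<dots> = farr T (farr T (\<theta> x)) \<bullet> (farr T (\<theta> (fobj C x)) \<bullet>
      (\<theta> (fobj C (fobj C x)) \<bullet> (comult C (fobj C x) \<bullet> comult C x)))"
    using x C.comult_coassoc[OF x] by (simp add: theta_natural')
  also have "\<dots> = farr T (farr T (\<theta> x)) \<bullet> (comult T (fobj C x) \<bullet> (\<theta> (fobj C x) \<bullet> comult C x))"
    using x by (simp add: comult_compat')
  \<comment> \<open>Naturality of the comultiplication of \<open>T\<close>, already established, at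
    the arrow \<open>\<theta> x\<close>.\<close>
  also have "\<dots> = comult T (fobj T x) \<bullet> (farr T (\<theta> x) \<bullet> (\<theta> (fobj C x) \<bullet> comult C x))"
    using x comp_extend[OF comult_T_natural[of "\<theta> x", symmetric], of "\<theta> (fobj C x) \<bullet> comult C x"]
    by simp
  also have "\<dots> = (comult T (fobj T x) \<bullet> comult T x) \<bullet> \<theta> x"
    using x by (simp add: comult_compat)
  finally show "(farr T (comult T x) \<bullet> comult T x) \<bullet> \<theta> x = (comult T (fobj T x) \<bullet> comult T x) \<bullet> \<theta> x" .
qed (use x in simp_all)

text \<open>For the left law the counit of \<open>T\<close> is moved past
  \<open>farr T (\<theta> x)\<close> by its naturality; for the right law the compatibility is
  applied under \<open>farr T\<close>. Both then reduce to the law of \<open>C\<close> after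
  \<open>\<theta> x\<close>.\<close>

lemma counit_T:
  assumes x: "x \<in> Obj A"
  shows counit_left_T: "counit T (fobj T x) \<bullet> comult T x = Id A (fobj T x)"
    and counit_right_T: "farr T (counit T x) \<bullet> comult T x = Id A (fobj T x)"
proof -
  have "(counit T (fobj T x) \<bullet> comult T x) \<bullet> \<theta> x =
      counit T (fobj T x) \<bullet> (farr T (\<theta> x) \<bullet> (\<theta> (fobj C x) \<bullet> comult C x))"
    using x by (simp add: comult_compat)
  also have "\<dots> = \<theta> x \<bullet> (counit C (fobj C x) \<bullet> comult C x)"
    using x comp_extend[OF counit_T_natural[of "\<theta> x"], of "\<theta> (fobj C x) \<bullet> comult C x"]
    by (simp add: counit_compat')
  finally have *: "(counit T (fobj T x) \<bullet> comult T x) \<bullet> \<theta> x = \<theta> x"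
    using x C.counit_left[OF x] by simp
  show "counit T (fobj T x) \<bullet> comult T x = Id A (fobj T x)"
    by (rule cancel[OF x]) (use x * in simp_all)
  have "(farr T (counit T x) \<bullet> comult T x) \<bullet> \<theta> x =
      farr T (counit T x \<bullet> \<theta> x) \<bullet> (\<theta> (fobj C x) \<bullet> comult C x)"
    using x by (simp add: comult_compat T.C.farr_comp)
  also have "\<dots> = \<theta> x \<bullet> (farr C (counit C x) \<bullet> comult C x)"
    using x by (simp add: counit_compat theta_natural')
  finally have *: "(farr T (counit T x) \<bullet> comult T x) \<bullet> \<theta> x = \<theta> x"
    using x C.counit_right[OF x] by simp
  show "farr T (counit T x) \<bullet> comult T x = Id A (fobj T x)"
    by (rule cancel[OF x]) (use x * in simp_all)
qed

lemma T_comonad: "is_comonad A T"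
proof -
  have TT: "cat_functor A A (comp_functor T T)"
    by (rule comp_functor[OF T.C.cat_functor_axioms T.C.cat_functor_axioms])
  have id: "cat_functor A A id_functor" by (rule id_functor[OF category_axioms])
  have "nat_trans A A T (comp_functor T T) (comult T)"
    using comult_T_natural
    by (intro nat_trans.intro nat_trans_axioms.intro T.C.cat_functor_axioms TT) (auto simp: Hom_iff)
  moreover have "nat_trans A A T id_functor (counit T)"
    using counit_T_natural
    by (intro nat_trans.intro nat_trans_axioms.intro T.C.cat_functor_axioms id) (auto simp: Hom_iff)
  ultimately show ?thesis
    by (intro is_comonad.intro is_comonad_axioms.intro comult_coassoc_T counit_T)
qed

lemma T_comonad_iso: "comonad_iso A C T \<theta>"
  by (intro comonad_iso.intro comonad_iso_axioms.intro C.is_comonad_axioms T_comonad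
      \<theta>.nat_iso_axioms counit_compat comult_compat)

lemma comodule_forward:
  assumes "is_comodule A C (x, r)" shows "is_comodule A T (x, \<theta> x \<bullet> r)"
proof -
  have x: "x \<in> Obj A" and r: "r \<in> Arr A" "Dom A r = x" "Cod A r = fobj C x"
    and co: "farr C r \<bullet> r = comult C x \<bullet> r" "counit C x \<bullet> r = Id A x"
    using assms by (auto simp: is_comodule_def Hom_iff)
  have "farr T (\<theta> x \<bullet> r) \<bullet> (\<theta> x \<bullet> r) = farr T (\<theta> x) \<bullet> (\<theta> (fobj C x) \<bullet> (farr C r \<bullet> r))"
    using x r by (simp add: T.C.farr_comp theta_natural')
  also have "\<dots> = comult T x \<bullet> (\<theta> x \<bullet> r)"
    using x r co by (simp add: comult_compat')
  finally show ?thesis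
    using x r co by (simp add: is_comodule_def Hom_iff counit_compat')
qed

abbreviation "\<phi> x \<equiv> inverse_arr A (\<theta> x)"

lemma phi_simps [simp]:
  assumes "x \<in> Obj A"
  shows "\<phi> x \<in> Arr A" "Dom A (\<phi> x) = fobj T x" "Cod A (\<phi> x) = fobj C x"
    "\<phi> x \<bullet> \<theta> x = Id A (fobj C x)" "\<theta> x \<bullet> \<phi> x = Id A (fobj T x)"
  using inverse_arr[OF \<theta>.component_iso[OF assms] \<theta>.component_Hom[OF assms]] by (simp_all add: Hom_iff)

lemma phi_simps' [simp]:
  assumes "x \<in> Obj A" "u \<in> Arr A"
  shows "Cod A u = fobj C x \<Longrightarrow> \<phi> x \<bullet> (\<theta> x \<bullet> u) = u" "Cod A u = fobj T x \<Longrightarrow> \<theta> x \<bullet> (\<phi> x \<bullet> u) = u"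
  using assms by (simp_all flip: comp_assoc)

text \<open>Writing \<open>r = \<theta> x \<bullet> q\<close>, both sides of the coassociativity of
  \<open>r\<close> are images under the same composite of isomorphisms, which is cancelled.\<close>

lemma comodule_backward:
  assumes "is_comodule A T (x, r)" shows "is_comodule A C (x, \<phi> x \<bullet> r)"
proof -
  have x: "x \<in> Obj A" and r: "r \<in> Arr A" "Dom A r = x" "Cod A r = fobj T x"
    and co: "farr T r \<bullet> r = comult T x \<bullet> r" "counit T x \<bullet> r = Id A x"
    using assms by (auto simp: is_comodule_def Hom_iff)
  define q where "q = \<phi> x \<bullet> r"
  have q: "q \<in> Arr A" "Dom A q = x" "Cod A q = fobj C x" and r_q: "r = \<theta> x \<bullet> q"
    using x r by (simp_all add: q_def)
  have "farr T (\<theta> x) \<bullet> (\<theta> (fobj C x) \<bullet> (farr C q \<bullet> q)) = farr T (\<theta> x \<bullet> q) \<bullet> (\<theta> x \<bullet> q)"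
    using x q by (simp add: T.C.farr_comp theta_natural')
  also have "\<dots> = farr T (\<theta> x) \<bullet> (\<theta> (fobj C x) \<bullet> (comult C x \<bullet> q))"
    using x q co by (simp add: r_q comult_compat')
  finally have eq: "farr T (\<theta> x) \<bullet> (\<theta> (fobj C x) \<bullet> (farr C q \<bullet> q)) =
    farr T (\<theta> x) \<bullet> (\<theta> (fobj C x) \<bullet> (comult C x \<bullet> q))" .
  \<comment> \<open>An explicit left inverse of
    \<open>farr T (\<theta> x) \<bullet> \<theta> (fobj C x)\<close>, the composite through which
    the two sides are compared.\<close>
  have left: "\<phi> (fobj C x) \<bullet> (farr T (\<phi> x) \<bullet> (farr T (\<theta> x) \<bullet> (\<theta> (fobj C x) \<bullet> u))) = u"
    if "u \<in> Arr A" "Cod A u = fobj C (fobj C x)" for u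
  proof -
    have "farr T (\<phi> x) \<bullet> (farr T (\<theta> x) \<bullet> (\<theta> (fobj C x) \<bullet> u)) = farr T (\<phi> x \<bullet> \<theta> x) \<bullet> (\<theta> (fobj C x) \<bullet> u)"
      using x that by (subst T.C.farr_comp) (simp_all del: phi_simps(4))
    then show ?thesis using x that by (simp add: T.C.farr_Id)
  qed
  have "farr C q \<bullet> q = \<phi> (fobj C x) \<bullet> (farr T (\<phi> x) \<bullet> (farr T (\<theta> x) \<bullet> (\<theta> (fobj C x) \<bullet> (farr C q \<bullet> q))))"
    using x q by (intro left[symmetric]) simp_all
  also have "\<dots> = comult C x \<bullet> q"
    unfolding eq using x q by (intro left) simp_all
  finally have "farr C q \<bullet> q = comult C x \<bullet> q" .
  then show ?thesis
    using x q co unfolding q_def[symmetric] by (simp add: is_comodule_def Hom_iff r_q counit_compat')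
qed

end

lemma Comod_Hom: "f \<in> Hom (Comod A C) X Y \<longleftrightarrow> source f = X \<and> target f = Y \<and>
    is_comodule A C X \<and> is_comodule A C Y \<and> mor f \<in> Hom A (fst X) (fst Y) \<and>
    farr C (mor f) \<bullet>\<^bsub>A\<^esub> snd X = snd Y \<bullet>\<^bsub>A\<^esub> mor f"
  by (auto simp: Comod_def Hom_def)

lemma Comod_category:
  fixes A :: "('o, 'a) cat" (structure)
  assumes "comonad_data A C" shows "category (Comod A C)"
proof -
  interpret comonad_data A C by fact
  show ?thesis
  proof
    show "f \<in> Arr (Comod A C) \<Longrightarrow> Dom (Comod A C) f \<in> Obj (Comod A C)"
      "f \<in> Arr (Comod A C) \<Longrightarrow> Cod (Comod A C) f \<in> Obj (Comod A C)" for f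
      by (auto simp: Comod_def)
    show "X \<in> Obj (Comod A C) \<Longrightarrow> Id (Comod A C) X \<in> Hom (Comod A C) X X" for X
      unfolding Comod_Hom by (auto simp: Comod_def is_comodule_def Hom_iff C.farr_Id split: prod.splits)
    fix f X Y assume f: "f \<in> Hom (Comod A C) X Y"
    then show "f \<bullet>\<^bsub>Comod A C\<^esub> Id (Comod A C) X = f" "Id (Comod A C) Y \<bullet>\<^bsub>Comod A C\<^esub> f = f"
      unfolding Comod_Hom by (auto simp: Comod_def Hom_iff)
    fix g Z assume g: "g \<in> Hom (Comod A C) Y Z"
    have m: "mor f \<in> Arr A" "mor g \<in> Arr A" "Dom A (mor f) = fst X" "Cod A (mor f) = fst Y"
      "Dom A (mor g) = fst Y" "Cod A (mor g) = fst Z"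
      "farr C (mor f) \<bullet> snd X = snd Y \<bullet> mor f" "farr C (mor g) \<bullet> snd Y = snd Z \<bullet> mor g"
      using f g unfolding Comod_Hom by (auto simp: Hom_iff)
    have obj: "snd X \<in> Arr A" "Dom A (snd X) = fst X" "Cod A (snd X) = fobj C (fst X)"
      "snd Y \<in> Arr A" "Dom A (snd Y) = fst Y" "Cod A (snd Y) = fobj C (fst Y)"
      "snd Z \<in> Arr A" "Dom A (snd Z) = fst Z" "Cod A (snd Z) = fobj C (fst Z)"
      using f g unfolding Comod_Hom by (auto simp: is_comodule_def Hom_iff split: prod.splits)
    have "farr C (mor g \<bullet> mor f) \<bullet> snd X = farr C (mor g) \<bullet> (farr C (mor f) \<bullet> snd X)"
      using m obj by (simp add: C.farr_comp)
    also have "\<dots> = snd Z \<bullet> (mor g \<bullet> mor f)"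
      using m obj comp_extend[OF m(8), of "mor f"] by simp
    finally show "g \<bullet>\<^bsub>Comod A C\<^esub> f \<in> Hom (Comod A C) X Z"
      using f g m unfolding Comod_Hom by (auto simp: Comod_def Hom_iff)
  next
    fix f g h W X Y Z assume "f \<in> Hom (Comod A C) W X" "g \<in> Hom (Comod A C) X Y" "h \<in> Hom (Comod A C) Y Z"
    then show "h \<bullet>\<^bsub>Comod A C\<^esub> g \<bullet>\<^bsub>Comod A C\<^esub> f = h \<bullet>\<^bsub>Comod A C\<^esub> (g \<bullet>\<^bsub>Comod A C\<^esub> f)"
      unfolding Comod_Hom by (auto simp: Comod_def Hom_iff)
  qed
qed

section \<open>Equivalence of the comodule categories along the isomorphism\<close>

context comonad_transport
begin

definition push :: "('o \<Rightarrow> 'a) \<Rightarrow> 'o \<times> 'a \<Rightarrow> 'o \<times> 'a" where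
  "push s X = (fst X, s (fst X) \<bullet> snd X)"

definition push_functor where
  "push_functor s = \<lparr>fobj = push s, farr = (\<lambda>f. Arrow (push s (source f)) (push s (target f)) (mor f))\<rparr>"

text \<open>Stated for two arbitrary structures and a natural family \<open>s\<close>, so that it
  serves \<open>\<theta>\<close> and its inverse alike. Underlying arrows are kept; only coactions
  change.\<close>

lemma push_functorI:
  assumes C1: "comonad_data A C1" and C2: "comonad_data A C2"
    and co: "\<And>X. is_comodule A C1 X \<Longrightarrow> is_comodule A C2 (push s X)"
    and s: "\<And>x. x \<in> Obj A \<Longrightarrow> s x \<in> Hom A (fobj C1 x) (fobj C2 x)"
    and nat: "\<And>f. f \<in> Arr A \<Longrightarrow> farr C2 f \<bullet> s (Dom A f) = s (Cod A f) \<bullet> farr C1 f"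
  shows "cat_functor (Comod A C1) (Comod A C2) (push_functor s)"
proof (intro cat_functor.intro cat_functor_axioms.intro Comod_category C1 C2)
  interpret C1: comonad_data A C1 by (rule C1)
  interpret C2: comonad_data A C2 by (rule C2)
  have s_simps [simp]: "s x \<in> Arr A" "Dom A (s x) = fobj C1 x" "Cod A (s x) = fobj C2 x"
    if "x \<in> Obj A" for x using s[OF that] by (simp_all add: Hom_iff)
  show "X \<in> Obj (Comod A C1) \<Longrightarrow> fobj (push_functor s) X \<in> Obj (Comod A C2)" for X
    using co by (simp add: Comod_def push_functor_def)
  show "farr (push_functor s) f \<in> Hom (Comod A C2) (fobj (push_functor s) X) (fobj (push_functor s) Y)"
    if f: "f \<in> Hom (Comod A C1) X Y" for f X Y
  proof -
    have m: "mor f \<in> Arr A" "Dom A (mor f) = fst X" "Cod A (mor f) = fst Y"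
      "farr C1 (mor f) \<bullet> snd X = snd Y \<bullet> mor f"
      using f unfolding Comod_Hom by (auto simp: Hom_iff)
    have obj: "fst X \<in> Obj A" "snd X \<in> Arr A" "Dom A (snd X) = fst X" "Cod A (snd X) = fobj C1 (fst X)"
      "fst Y \<in> Obj A" "snd Y \<in> Arr A" "Dom A (snd Y) = fst Y" "Cod A (snd Y) = fobj C1 (fst Y)"
      using f unfolding Comod_Hom by (auto simp: is_comodule_def Hom_iff split: prod.splits)
    have "farr C2 (mor f) \<bullet> (s (fst X) \<bullet> snd X) = s (fst Y) \<bullet> (farr C1 (mor f) \<bullet> snd X)"
      using comp_extend[OF nat[of "mor f"], of "snd X"] m obj by simp
    also have "\<dots> = (s (fst Y) \<bullet> snd Y) \<bullet> mor f"
      using m obj by simp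
    finally show ?thesis
      using f m co unfolding Comod_Hom by (auto simp: push_functor_def push_def Hom_iff)
  qed
qed (auto simp: push_functor_def push_def Comod_def)

text \<open>Changing a coaction by \<open>\<theta>\<close> and then by its inverse returns the same
  coaction, so both round trips are identities and the categories are even isomorphic.\<close>

lemma comodules_equivalent: "equivalent_categories (Comod A C) (Comod A T)"
proof -
  have C1: "comonad_data A C" and T1: "comonad_data A T"
    by (rule C.comonad_data_axioms T.comonad_data_axioms)+
  have F: "cat_functor (Comod A C) (Comod A T) (push_functor \<theta>)"
    by (rule push_functorI[OF C1 T1])
      (auto simp: push_def comodule_forward Hom_iff theta_natural)
  have phi_nat: "farr C f \<bullet> \<phi> (Dom A f) = \<phi> (Cod A f) \<bullet> farr T f" if f: "f \<in> Arr A" for f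
  proof (rule cancel[of "Dom A f"])
    show "(farr C f \<bullet> \<phi> (Dom A f)) \<bullet> \<theta> (Dom A f) = (\<phi> (Cod A f) \<bullet> farr T f) \<bullet> \<theta> (Dom A f)"
      using f by (simp add: theta_natural)
  qed (use f in simp_all)
  have G: "cat_functor (Comod A T) (Comod A C) (push_functor \<phi>)"
    by (rule push_functorI[OF T1 C1])
      (auto simp: push_def comodule_backward Hom_iff phi_nat)
  have GF: "push \<phi> (push \<theta> X) = X" if "is_comodule A C X" for X
    using that by (cases X) (auto simp: push_def is_comodule_def Hom_iff)
  have FG: "push \<theta> (push \<phi> X) = X" if "is_comodule A T X" for X
    using that by (cases X) (auto simp: push_def is_comodule_def Hom_iff)
  have obj: "X \<in> Obj (Comod A E) \<longleftrightarrow> is_comodule A E X" for X E by (simp add: Comod_def)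
  have arr: "f \<in> Arr (Comod A E) \<Longrightarrow> is_comodule A E (source f) \<and> is_comodule A E (target f)" for f E
    by (simp add: Comod_def)
  have "nat_iso (Comod A C) (Comod A C) id_functor (comp_functor (push_functor \<phi>) (push_functor \<theta>))
      (Id (Comod A C))"
    using arr by (intro identity_nat_iso comp_functor[OF F G])
      (auto simp: push_functor_def GF obj intro!: arrow.expand)
  moreover have "nat_iso (Comod A T) (Comod A T) (comp_functor (push_functor \<theta>) (push_functor \<phi>))
      id_functor (Id (Comod A T))"
    using arr by (intro identity_nat_iso comp_functor[OF G F])
      (auto simp: push_functor_def FG obj intro!: arrow.expand)
  ultimately show ?thesis
    unfolding equivalent_categories_def using F G by blast
qed

end

section \<open>The grading shift\<close>

lemma shift_simps [simp]: "carrier (shift i M) = carrier M" "mult (shift i M) = mult M"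
  "one (shift i M) = one M" "ract (shift i M) = ract M" "deg (shift i M) n = deg M (n + i)"
  by (simp_all add: shift_def)

lemma shift_shift [simp]: "shift i (shift j M) = shift (i + j) M"
  by (simp add: shift_def add.assoc)

lemma shift_0 [simp]: "shift 0 M = M"
  by (simp add: shift_def)

text \<open>The component of degree \<open>n + i\<close> in the original grading is the projection
  onto degree \<open>n\<close> of the shifted one.\<close>

lemma shift_graded_module:
  assumes "graded_module R M" shows "graded_module R (shift i M)"
proof -
  interpret M: graded_module R M by fact
  have comm: "comm_group (shift i M)"
    by (rule same_comm_group[OF M.comm_group_axioms]) simp_all
  have sub: "subgroup (deg (shift i M) n) (shift i M)" for n
    using M.degree_subgroup by (simp add: same_subgroup[of "shift i M" M])
  have "graded_group (shift i M) (deg (shift i M))"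
  proof (rule graded_groupI[OF comm sub, where p = "\<lambda>n x. gcomp M (deg M) x (n + i)"])
    show "(\<lambda>x. gcomp M (deg M) x (n + i)) \<in> hom (shift i M) (shift i M)" for n
      by (auto simp: hom_def M.gcomp_mult M.gcomp_closed)
    show "x \<in> deg (shift i M) n \<Longrightarrow> gcomp M (deg M) x (n + i) = x" for n x
      by (simp add: M.gcomp_homogeneous)
    show "x \<in> deg (shift i M) m \<Longrightarrow> n \<noteq> m \<Longrightarrow> gcomp M (deg M) x (n + i) = \<one>\<^bsub>shift i M\<^esub>" for n m x
      by (simp add: M.gcomp_homogeneous)
    show "carrier (shift i M) \<subseteq> generate (shift i M) (\<Union>n. deg (shift i M) n)"
    proof
      fix x assume "x \<in> carrier (shift i M)"
      then have "x \<in> carrier M" by simp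
      then show "x \<in> generate (shift i M) (\<Union>n. deg (shift i M) n)"
      proof (induction rule: M.graded_induct)
        case (homogeneous k x)
        then have "x \<in> deg (shift i M) (k - i)" by simp
        then show ?case by (blast intro: generate.incl)
      next
        case (mult x y)
        then show ?case using generate.eng[of x "shift i M" _ y] by simp
      qed
    qed
  qed
  then show ?thesis
    using M.degree_ract[of _ "_ + i"]
    by (intro graded_module.intro graded_module_axioms.intro M.R.graded_ring_axioms)
      (simp_all add: M.ract_closed M.ract_add_left M.ract_add_right M.ract_mult M.ract_one add_ac)
qed

lemma shift_Obj [simp]: "M \<in> Obj (GrMod U R) \<Longrightarrow> shift i M \<in> Obj (GrMod U R)"
  by (simp add: shift_graded_module)

lemma shift_arr_mor [simp]: "mor (shift_arr i f) = mor f"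
  by (simp add: shift_arr_def)

lemma shift_arr_Hom: "f \<in> Hom (GrMod U R) M N \<Longrightarrow> shift_arr i f \<in> Hom (GrMod U R) (shift i M) (shift i N)"
  by (auto simp: GrMod_Hom shift_arr_def shift_graded_module is_graded_map_def hom_def)

lemma shift_arr_shift_arr [simp]: "shift_arr i (shift_arr j f) = shift_arr (i + j) f"
  by (simp add: shift_arr_def)

lemma shift_arr_0 [simp]: "shift_arr 0 f = f"
  by (simp add: shift_arr_def)

lemma shift_arr_comp: "shift_arr i (g \<bullet>\<^bsub>GrMod U R\<^esub> f) = shift_arr i g \<bullet>\<^bsub>GrMod U R\<^esub> shift_arr i f"
  by (simp add: GrMod_def shift_arr_def)

lemma shift_arr_Id [simp]: "shift_arr i (Id (GrMod U R) M) = Id (GrMod U R) (shift i M)"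
  by (simp add: GrMod_def shift_arr_def)

lemma shift_arr_cancel: "shift_arr i f = shift_arr i g \<longleftrightarrow> f = g"
  using shift_arr_shift_arr[of "-i" i] by (metis add.left_inverse shift_arr_0)

lemma shift_functor_simps [simp]: "fobj shift_functor = shift 1" "farr shift_functor = shift_arr 1"
  by (simp_all add: shift_functor_def)

text \<open>An equivalence as step serves both directions: negative degrees are reached by
  cancelling the same invertible step that leads upwards.\<close>

lemma int_iff_induct:
  fixes P :: "int \<Rightarrow> bool"
  assumes "P 0" "\<And>i. P i \<longleftrightarrow> P (i + 1)" shows "P i"
  by (induction i rule: int_induct[where k = 0]) (use assms in \<open>simp, blast, metis diff_add_cancel\<close>)

section \<open>Shift isomorphisms in all integer degrees\<close>

locale shift_setting = graded_setting U R + shift_preserving U R C \<sigma>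
  for U :: "'u set set" and R :: "'u gring" and C :: "('u gmod, 'u garrow) comonad"
    and \<sigma> :: "'u gmod \<Rightarrow> 'u garrow" +
  assumes C_colimits: "preserves_colimits U (GrMod U R) (GrMod U R) C"
begin

declare GrMod_Obj [simp del]

abbreviation "C0 \<equiv> fobj C"
abbreviation "CC \<equiv> farr C"
abbreviation "sa \<equiv> shift_arr"
abbreviation "si \<equiv> shift_iso U R C \<sigma>"
abbreviation "sn \<equiv> shift_iso_nat U R C \<sigma>"

sublocale Cd: comonad_data A C by (rule is_comonad_data[OF is_comonad_axioms])

lemma sa_simps [simp]:
  assumes "f \<in> Arr A"
  shows "sa i f \<in> Arr A" "Dom A (sa i f) = shift i (Dom A f)" "Cod A (sa i f) = shift i (Cod A f)"
  using shift_arr_Hom[of f U R "Dom A f" "Cod A f" i] assms by (simp_all add: A.Hom_iff)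

lemma sigma_simps [simp]:
  assumes "M \<in> Obj A"
  shows "\<sigma> M \<in> Arr A" "Dom A (\<sigma> M) = C0 (shift 1 M)" "Cod A (\<sigma> M) = shift 1 (C0 M)"
  using component_simps[OF assms] by simp_all

lemma sigma_natural: "f \<in> Arr A \<Longrightarrow> \<sigma> (Cod A f) \<bullet> CC (sa 1 f) = sa 1 (CC f) \<bullet> \<sigma> (Dom A f)"
  using natural[of f] by simp

lemma sa_iso: "is_iso A f \<Longrightarrow> is_iso A (sa i f)"
proof -
  assume f: "is_iso A f"
  then have fa: "f \<in> Arr A" by (simp add: is_iso_def)
  from f obtain g where "is_inverse A f g" by (auto simp: is_iso_def)
  then have "g \<in> Arr A" "Dom A g = Cod A f" "Cod A g = Dom A f" "g \<bullet> f = Id A (Dom A f)" "f \<bullet> g = Id A (Cod A f)"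
    by (auto simp: is_inverse_def A.Hom_iff)
  then have "is_inverse A (sa i f) (sa i g)"
    using fa by (simp add: is_inverse_def A.Hom_iff flip: shift_arr_comp)
  then show ?thesis using fa by (auto simp: is_iso_def)
qed

lemma comp_iso:
  assumes "is_iso A f" "is_iso A g" "Cod A f = Dom A g"
  shows "is_iso A (g \<bullet> f)" and "inverse_arr A (g \<bullet> f) = inverse_arr A f \<bullet> inverse_arr A g"
proof -
  have f: "f \<in> Arr A" and g: "g \<in> Arr A" using assms by (auto simp: is_iso_def)
  note fi = A.inverse_arr[OF assms(1), of "Dom A f" "Cod A f"]
  note gi = A.inverse_arr[OF assms(2), of "Dom A g" "Cod A g"]
  let ?f = "inverse_arr A f" and ?g = "inverse_arr A g"
  have s: "?f \<in> Arr A" "Dom A ?f = Cod A f" "Cod A ?f = Dom A f" "?f \<bullet> f = Id A (Dom A f)"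
    "f \<bullet> ?f = Id A (Cod A f)" "?g \<in> Arr A" "Dom A ?g = Cod A g" "Cod A ?g = Dom A g"
    "?g \<bullet> g = Id A (Dom A g)" "g \<bullet> ?g = Id A (Cod A g)"
    using fi gi f g by (simp_all add: A.Hom_iff)
  have "is_inverse A (g \<bullet> f) (?f \<bullet> ?g)"
    using f g s assms(3) A.comp_extend'[OF s(9), of f] A.comp_extend'[OF s(5), of ?g]
    by (simp add: is_inverse_def A.Hom_iff)
  then show "is_iso A (g \<bullet> f)" "inverse_arr A (g \<bullet> f) = ?f \<bullet> ?g"
    using f g assms(3) A.inverse_arrI by (auto simp: is_iso_def)
qed

lemma inverse_sa: "is_iso A f \<Longrightarrow> inverse_arr A (sa i f) = sa i (inverse_arr A f)"
proof -
  assume f: "is_iso A f"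
  then have fa: "f \<in> Arr A" by (simp add: is_iso_def)
  from A.inverse_arr[OF f, of "Dom A f" "Cod A f"] fa
  have "is_inverse A (sa i f) (sa i (inverse_arr A f))"
    by (simp add: is_inverse_def A.Hom_iff flip: shift_arr_comp)
  then show ?thesis using fa A.inverse_arrI by simp
qed

lemma Id_iso: "M \<in> Obj A \<Longrightarrow> is_iso A (Id A M)" "M \<in> Obj A \<Longrightarrow> inverse_arr A (Id A M) = Id A M"
proof -
  assume M: "M \<in> Obj A"
  then have i: "is_inverse A (Id A M) (Id A M)" by (simp add: is_inverse_def A.Hom_iff)
  then show "is_iso A (Id A M)" using M unfolding is_iso_def by auto
  show "inverse_arr A (Id A M) = Id A M" using A.inverse_arrI[OF _ i] M by simp
qed

lemma sn_facts:
  assumes "M \<in> Obj A"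
  shows sn_arr: "sn n M \<in> Arr A" "Dom A (sn n M) = C0 (shift (int n) M)"
    "Cod A (sn n M) = shift (int n) (C0 M)" and sn_iso: "is_iso A (sn n M)"
proof -
  have "sn n M \<in> Arr A \<and> Dom A (sn n M) = C0 (shift (int n) M) \<and>
    Cod A (sn n M) = shift (int n) (C0 M) \<and> is_iso A (sn n M)"
  proof (induction n)
    case 0
    then show ?case using assms by (simp add: Id_iso)
  next
    case (Suc n)
    then show ?case using assms component_iso[of "shift (int n) M"]
      by (simp add: comp_iso sa_iso add.commute)
  qed
  then show "sn n M \<in> Arr A" "Dom A (sn n M) = C0 (shift (int n) M)"
    "Cod A (sn n M) = shift (int n) (C0 M)" "is_iso A (sn n M)" by auto
qed

declare sn_arr [simp]

text \<open>The recursion applies \<open>\<sigma>\<close> first, at the shifted module; this variant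
  applies it last, at \<open>M\<close> itself. The step for negative degrees needs the second form,
  because there the base module of the iterate changes together with \<open>n\<close>.\<close>

lemma sn_Suc_alt:
  assumes "M \<in> Obj A"
  shows "sn (Suc n) M = sa (int n) (\<sigma> M) \<bullet> sn n (shift 1 M)"
proof (induction n)
  case 0
  then show ?case using assms by simp
next
  case (Suc n)
  have "sn (Suc (Suc n)) M = sa 1 (sn (Suc n) M) \<bullet> \<sigma> (shift (int (Suc n)) M)"
    by simp
  also have "\<dots> = sa (int (Suc n)) (\<sigma> M) \<bullet> (sa 1 (sn n (shift 1 M)) \<bullet> \<sigma> (shift (int (Suc n)) M))"
    unfolding Suc using assms by (simp add: shift_arr_comp add.commute)
  also have "\<dots> = sa (int (Suc n)) (\<sigma> M) \<bullet> sn (Suc n) (shift 1 M)"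
    by (simp add: add.commute)
  finally show ?case .
qed

lemma si_facts:
  assumes M: "M \<in> Obj A"
  shows si_simps [simp]: "si i M \<in> Arr A" "Dom A (si i M) = C0 (shift i M)" "Cod A (si i M) = shift i (C0 M)"
    and si_iso: "is_iso A (si i M)"
proof -
  have "si i M \<in> Arr A \<and> Dom A (si i M) = C0 (shift i M) \<and> Cod A (si i M) = shift i (C0 M) \<and> is_iso A (si i M)"
  proof (cases "0 \<le> i")
    case True
    then show ?thesis using M sn_facts[OF M, of "nat i"] by (simp add: shift_iso_def)
  next
    case False
    let ?s = "sn (nat (- i)) (shift i M)"
    have M': "shift i M \<in> Obj A" using M by simp
    note s = sn_facts[OF M', of "nat (- i)"]
    have "inverse_arr A ?s \<in> Hom A (shift (- i) (C0 (shift i M))) (C0 M)"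
      using s False by (intro A.inverse_arr_Hom) (simp_all add: A.Hom_iff)
    moreover have "is_iso A (inverse_arr A ?s)"
      using A.inverse_arr[OF s(4), of "Dom A ?s" "Cod A ?s"] s(1)
      by (auto simp: is_iso_def is_inverse_def A.Hom_iff)
    ultimately show ?thesis using False by (simp add: shift_iso_def A.Hom_iff sa_iso)
  qed
  then show "si i M \<in> Arr A" "Dom A (si i M) = C0 (shift i M)" "Cod A (si i M) = shift i (C0 M)"
    "is_iso A (si i M)" by auto
qed

lemma si_0 [simp]: "si 0 M = Id A (C0 M)"
  by (simp add: shift_iso_def)

text \<open>One recursion for all integers, which removes the case distinction in
  \<open>shift_iso\<close> from every later argument. For \<open>i = - n - 1\<close> the factor
  \<open>\<sigma>\<close> cancels against its inverse inside \<open>si i M\<close>.\<close>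

lemma si_step:
  assumes M: "M \<in> Obj A"
  shows "si (i + 1) M = sa 1 (si i M) \<bullet> \<sigma> (shift i M)"
proof (cases "0 \<le> i")
  case True
  then have "nat (i + 1) = Suc (nat i)" by simp
  then show ?thesis using True by (simp add: shift_iso_def)
next
  case False
  define n where "n = nat (- i - 1)"
  have i: "i = - int n - 1" using False by (simp add: n_def)
  let ?K = "shift i M"
  have K: "?K \<in> Obj A" and K1: "shift 1 ?K = shift (- int n) M" using M by (simp_all add: i)
  have sig: "is_iso A (\<sigma> ?K)" using component_iso[OF K] .
  have n: "nat (- i) = Suc n" by (simp add: i)
  have "sn (nat (- i)) ?K = sa (int n) (\<sigma> ?K) \<bullet> sn n (shift 1 ?K)"
    unfolding n by (rule sn_Suc_alt[OF K])
  then have "si i M = sa i (inverse_arr A (sa (int n) (\<sigma> ?K) \<bullet> sn n (shift 1 ?K)))"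
    using False by (simp only: shift_iso_def if_False)
  also have "\<dots> = sa i (inverse_arr A (sn n (shift 1 ?K))) \<bullet> sa (i + int n) (inverse_arr A (\<sigma> ?K))"
    using sn_facts[of "shift 1 ?K" n] M sig
    by (subst comp_iso(2)) (simp_all add: sa_iso inverse_sa shift_arr_comp add.commute)
  finally have "sa 1 (si i M) = sa (i + 1) (inverse_arr A (sn n (shift 1 ?K))) \<bullet> inverse_arr A (\<sigma> ?K)"
    by (simp add: shift_arr_comp i add.commute)
  moreover have "sa (i + 1) (inverse_arr A (sn n (shift 1 ?K))) = si (i + 1) M"
  proof -
    have "i + 1 = - int n" by (simp add: i)
    \<comment> \<open>For \<open>n = 0\<close> the degree \<open>- n\<close> falls into the
      nonnegative branch of \<open>shift_iso\<close>, where both sides are identities.\<close>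
    moreover have "sa (- int n) (inverse_arr A (sn n (shift (- int n) M))) = si (- int n) M"
      using M by (cases "n = 0") (simp_all add: shift_iso_def Id_iso)
    ultimately show ?thesis unfolding K1 by simp
  qed
  ultimately have "sa 1 (si i M) \<bullet> \<sigma> ?K = (si (i + 1) M \<bullet> inverse_arr A (\<sigma> ?K)) \<bullet> \<sigma> ?K"
    by simp
  also have "\<dots> = si (i + 1) M"
    using A.inverse_arr[OF sig, of "Dom A (\<sigma> ?K)" "Cod A (\<sigma> ?K)"] K M
    by (simp add: A.Hom_iff add.commute)
  finally show ?thesis by simp
qed

lemma si_step': "M \<in> Obj A \<Longrightarrow> si (1 + i) M = sa 1 (si i M) \<bullet> \<sigma> (shift i M)"
  using si_step[of M i] by (simp add: add.commute)

text \<open>Shifting is invertible and \<open>\<sigma> M\<close> is an isomorphism. This supplies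
  the equivalence that the integer inductions below require.\<close>

lemma step_cancel:
  assumes "M \<in> Obj A" "f \<in> Arr A" "g \<in> Arr A" "Dom A f = C0 M" "Dom A g = C0 M"
  shows "sa 1 f \<bullet> \<sigma> M = sa 1 g \<bullet> \<sigma> M \<longleftrightarrow> f = g"
  using A.iso_cancel_right[OF component_iso[OF assms(1)], of "sa 1 f" "sa 1 g"] assms
  by (auto simp: shift_arr_cancel)

text \<open>By \<open>si_step\<close> both sides in degree \<open>i + 1\<close> arise from those in
  degree \<open>i\<close> by the same cancellable operation, so the equation passes up and down from
  \<open>i = 0\<close>.\<close>

lemma si_cocycle:
  assumes M: "M \<in> Obj A"
  shows "si (i + j) M = sa i (si j M) \<bullet> si i (shift j M)"
proof (induction i rule: int_iff_induct)
  case 1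
  then show ?case using M by simp
next
  case (2 i)
  have "si (i + 1 + j) M = sa 1 (si (i + j) M) \<bullet> \<sigma> (shift (i + j) M)"
    using si_step[OF M, of "i + j"] by (simp add: algebra_simps)
  moreover have "sa (i + 1) (si j M) \<bullet> si (i + 1) (shift j M) =
      sa 1 (sa i (si j M) \<bullet> si i (shift j M)) \<bullet> \<sigma> (shift (i + j) M)"
    using M by (simp add: si_step si_step' shift_arr_comp add.commute)
  ultimately show ?case
    using M step_cancel[of "shift (i + j) M" "si (i + j) M" "sa i (si j M) \<bullet> si i (shift j M)"] by simp
qed

lemma si_natural:
  assumes g: "g \<in> Arr A"
  shows "si i (Cod A g) \<bullet> CC (sa i g) = sa i (CC g) \<bullet> si i (Dom A g)"
proof (induction i rule: int_iff_induct)
  case 1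
  then show ?case using g by simp
next
  case (2 i)
  let ?X = "Dom A g" and ?Y = "Cod A g"
  have obj: "?X \<in> Obj A" "?Y \<in> Obj A" using g by simp_all
  have "si (i + 1) ?Y \<bullet> CC (sa (i + 1) g) = sa 1 (si i ?Y) \<bullet> (\<sigma> (shift i ?Y) \<bullet> CC (sa 1 (sa i g)))"
    using g obj by (simp add: si_step si_step' add.commute)
  also have "\<dots> = sa 1 (si i ?Y \<bullet> CC (sa i g)) \<bullet> \<sigma> (shift i ?X)"
    using g obj sigma_natural[of "sa i g"] by (simp add: shift_arr_comp)
  finally have 1: "si (i + 1) ?Y \<bullet> CC (sa (i + 1) g) = sa 1 (si i ?Y \<bullet> CC (sa i g)) \<bullet> \<sigma> (shift i ?X)" .
  have 2: "sa (i + 1) (CC g) \<bullet> si (i + 1) ?X = sa 1 (sa i (CC g) \<bullet> si i ?X) \<bullet> \<sigma> (shift i ?X)"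
    using g obj by (simp add: si_step si_step' shift_arr_comp add.commute)
  show ?case
    unfolding 1 2 using g obj by (subst step_cancel) simp_all
qed

lemma si_counit:
  assumes M: "M \<in> Obj A"
  shows "sa i (counit C M) \<bullet> si i M = counit C (shift i M)"
proof (induction i rule: int_iff_induct)
  case 1
  then show ?case using M by simp
next
  case (2 i)
  have 1: "sa (i + 1) (counit C M) \<bullet> si (i + 1) M = sa 1 (sa i (counit C M) \<bullet> si i M) \<bullet> \<sigma> (shift i M)"
    using M by (simp add: si_step si_step' shift_arr_comp add.commute)
  have 2: "counit C (shift (i + 1) M) = sa 1 (counit C (shift i M)) \<bullet> \<sigma> (shift i M)"
    using shift_counit[of "shift i M"] M by (simp add: add.commute)
  show ?case
    unfolding 1 2 using M by (subst step_cancel) simp_all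
qed

text \<open>The same induction; the step combines \<open>shift_comult\<close> with naturality of
  \<open>\<sigma>\<close> at \<open>si i M\<close>.\<close>

lemma si_comult:
  assumes M: "M \<in> Obj A"
  shows "sa i (comult C M) \<bullet> si i M = si i (C0 M) \<bullet> (CC (si i M) \<bullet> comult C (shift i M))"
proof (induction i rule: int_iff_induct)
  case 1
  then show ?case using M by (simp add: comult.F.farr_Id)
next
  case (2 i)
  let ?N = "shift i M"
  have N: "?N \<in> Obj A" and N1: "shift (i + 1) M = shift 1 ?N" using M by (simp_all add: add.commute)
  have 1: "sa (i + 1) (comult C M) \<bullet> si (i + 1) M = sa 1 (sa i (comult C M) \<bullet> si i M) \<bullet> \<sigma> ?N"
    using M by (simp add: si_step si_step' shift_arr_comp add.commute)
  have "si (i + 1) (C0 M) \<bullet> (CC (si (i + 1) M) \<bullet> comult C (shift (i + 1) M)) =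
      sa 1 (si i (C0 M)) \<bullet> (\<sigma> (shift i (C0 M)) \<bullet> (CC (sa 1 (si i M)) \<bullet> (CC (\<sigma> ?N) \<bullet> comult C (shift 1 ?N))))"
    using M N by (simp add: si_step si_step' N1 comult.F.farr_comp add.commute)
  also have "\<dots> = sa 1 (si i (C0 M)) \<bullet> (sa 1 (CC (si i M)) \<bullet> (\<sigma> (C0 ?N) \<bullet> (CC (\<sigma> ?N) \<bullet> comult C (shift 1 ?N))))"
    using M N A.comp_extend[OF sigma_natural[of "si i M"], of "CC (\<sigma> ?N) \<bullet> comult C (shift 1 ?N)"]
    by (simp add: add.commute)
  also have "\<dots> = sa 1 (si i (C0 M) \<bullet> (CC (si i M) \<bullet> comult C ?N)) \<bullet> \<sigma> ?N"
    using M N shift_comult[OF N] by (simp add: shift_arr_comp)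
  finally have 2: "si (i + 1) (C0 M) \<bullet> (CC (si (i + 1) M) \<bullet> comult C (shift (i + 1) M)) =
    sa 1 (si i (C0 M) \<bullet> (CC (si i M) \<bullet> comult C ?N)) \<bullet> \<sigma> ?N" .
  show ?case
    unfolding 1 2 using M by (subst step_cancel) simp_all
qed

text \<open>The enriched functor on an arrow of degree \<open>i\<close> from \<open>M\<close> to \<open>N\<close>, that is, from \<open>M\<close> to
  \<open>N(i)\<close>.\<close>

definition Chat :: "int \<Rightarrow> 'u gmod \<Rightarrow> 'u garrow \<Rightarrow> 'u garrow" where
  "Chat i N f = si i N \<bullet> CC f"

context
  fixes i M N f
  assumes f: "f \<in> Arr A" "Dom A f = M" "Cod A f = shift i N" and N: "N \<in> Obj A"
begin

lemma Chat_simps: "Chat i N f \<in> Arr A" "Dom A (Chat i N f) = C0 M" "Cod A (Chat i N f) = shift i (C0 N)"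
  using f N by (simp_all add: Chat_def)

lemma Chat_counit: "sa i (counit C N) \<bullet> Chat i N f = f \<bullet> counit C M"
proof -
  have "sa i (counit C N) \<bullet> Chat i N f = counit C (shift i N) \<bullet> CC f"
    unfolding Chat_def using f N A.comp_extend'[OF si_counit[OF N, of i], of "CC f"] by simp
  then show ?thesis using counit.natural[OF f(1)] f by simp
qed

lemma Chat_comult: "sa i (comult C N) \<bullet> Chat i N f = Chat i (C0 N) (Chat i N f) \<bullet> comult C M"
proof -
  have "sa i (comult C N) \<bullet> Chat i N f =
      si i (C0 N) \<bullet> (CC (si i N) \<bullet> (comult C (shift i N) \<bullet> CC f))"
    unfolding Chat_def using f N A.comp_extend'[OF si_comult[OF N, of i], of "CC f"] by simp
  also have "comult C (shift i N) \<bullet> CC f = CC (CC f) \<bullet> comult C M"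
    using comult.natural[OF f(1)] f by simp
  finally show ?thesis
    unfolding Chat_def using f N A.obj_simps(1)[OF f(1)] by (simp add: comult.F.farr_comp)
qed

text \<open>Functoriality on arrows of arbitrary degree. The cocycle law splits
  \<open>si (i + j)\<close>, and naturality of \<open>si i\<close> moves it past \<open>g\<close>,
  which has to be shifted by \<open>i\<close> to be composable with \<open>f\<close>.\<close>

lemma Chat_comp:
  assumes g: "g \<in> Arr A" "Dom A g = N" "Cod A g = shift j K" and K: "K \<in> Obj A"
  shows "Chat (i + j) K (sa i g \<bullet> f) = sa i (Chat j K g) \<bullet> Chat i N f"
proof -
  have "Chat (i + j) K (sa i g \<bullet> f) = sa i (si j K) \<bullet> (si i (shift j K) \<bullet> (CC (sa i g) \<bullet> CC f))"
    unfolding Chat_def si_cocycle[OF K] using f g K by (simp add: comult.F.farr_comp)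
  also have "si i (shift j K) \<bullet> (CC (sa i g) \<bullet> CC f) = sa i (CC g) \<bullet> (si i N \<bullet> CC f)"
    using A.comp_extend[OF si_natural[OF g(1), of i], of "CC f"] f g K N by simp
  finally show ?thesis
    unfolding Chat_def using f g K N by (simp add: shift_arr_comp)
qed

end

lemma Chat_0: "f \<in> Arr A \<Longrightarrow> Cod A f = N \<Longrightarrow> Chat 0 N f = CC f"
  by (auto simp: Chat_def)

end

section \<open>Additivity\<close>

context graded_setting
begin

text \<open>The initial object. Its only element is borrowed from \<open>R\<close>, since carriers
  must be small sets of type \<open>'u\<close>.\<close>

definition zero_mod :: "'u gmod" where
  "zero_mod = \<lparr>carrier = {\<zero>\<^bsub>R\<^esub>}, mult = add R, one = \<zero>\<^bsub>R\<^esub>, ract = mult R, deg = (\<lambda>n. {\<zero>\<^bsub>R\<^esub>})\<rparr>"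

lemma zero_mod_simps [simp]: "carrier zero_mod = {\<zero>\<^bsub>R\<^esub>}" "mult zero_mod = add R"
  "one zero_mod = \<zero>\<^bsub>R\<^esub>" "ract zero_mod = mult R" "deg zero_mod n = {\<zero>\<^bsub>R\<^esub>}"
  by (simp_all add: zero_mod_def)

lemma zero_mod_Obj: "zero_mod \<in> Obj A"
proof -
  have c: "comm_group zero_mod" by (rule comm_groupI) auto
  then interpret Z: comm_group zero_mod .
  have "graded_group zero_mod (deg zero_mod)"
  proof (rule graded_groupI[OF c, where p = "\<lambda>n x. x"])
    have "subgroup {\<one>\<^bsub>zero_mod\<^esub>} zero_mod" by (rule Z.triv_subgroup)
    then show "subgroup (deg zero_mod i) zero_mod" for i by simp
    show "carrier zero_mod \<subseteq> generate zero_mod (\<Union>i. deg zero_mod i)"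
      using generate.one[of zero_mod] by auto
  qed (auto simp: hom_def)
  moreover have "{\<zero>\<^bsub>R\<^esub>} \<in> U"
    using small_subset[OF R_small, of "{\<zero>\<^bsub>R\<^esub>}"] by simp
  ultimately show ?thesis
    using R.rdeg_closed
    by (auto intro!: graded_module.intro graded_module_axioms.intro R.graded_ring_axioms)
qed

definition zero_arr :: "'u gmod \<Rightarrow> 'u gmod \<Rightarrow> 'u garrow" where
  "zero_arr M N = Arrow M N (\<lambda>x\<in>carrier M. \<one>\<^bsub>N\<^esub>)"

lemma zero_arr_Hom:
  assumes M: "M \<in> Obj A" and N: "N \<in> Obj A"
  shows "zero_arr M N \<in> Hom A M N"
proof -
  interpret N: graded_module R N using N by simp
  show ?thesis
    unfolding zero_arr_def
    by (rule restrict_Hom[OF M N]) (auto simp: is_graded_map_def hom_def N.ract_one_left N.deg_one)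
qed

lemma zero_arr_mor [simp]: "x \<in> carrier M \<Longrightarrow> mor (zero_arr M N) x = \<one>\<^bsub>N\<^esub>"
  by (simp add: zero_arr_def)

definition add_arr :: "'u garrow \<Rightarrow> 'u garrow \<Rightarrow> 'u garrow" where
  "add_arr f g = Arrow (source f) (target f)
     (\<lambda>x\<in>carrier (source f). mor f x \<otimes>\<^bsub>target f\<^esub> mor g x)"

lemma add_arr:
  assumes f: "f \<in> Hom A M N" and g: "g \<in> Hom A M N"
  shows add_arr_Hom: "add_arr f g \<in> Hom A M N"
    and add_arr_mor: "x \<in> carrier M \<Longrightarrow> mor (add_arr f g) x = mor f x \<otimes>\<^bsub>N\<^esub> mor g x"
proof -
  have M: "M \<in> Obj A" and N: "N \<in> Obj A" using Hom_objs[OF f] by auto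
  interpret N: graded_module R N using N by simp
  have st: "source f = M" "target f = N" using f by (auto simp: GrMod_Hom)
  have "is_graded_map R M N (\<lambda>x. mor f x \<otimes>\<^bsub>N\<^esub> mor g x)"
    using Hom_facts[OF f] Hom_facts[OF g] hom_mult_hom[OF N.comm_group_axioms Hom_hom[OF f] Hom_hom[OF g]]
    by (auto simp: is_graded_map_def N.ract_add_left N.deg_mult)
  then show "add_arr f g \<in> Hom A M N"
    unfolding add_arr_def st by (rule restrict_Hom[OF M N])
  show "x \<in> carrier M \<Longrightarrow> mor (add_arr f g) x = mor f x \<otimes>\<^bsub>N\<^esub> mor g x"
    by (simp add: add_arr_def st)
qed

lemma infinite_UNIV: "infinite (UNIV :: 'u set)"
proof -
  obtain X :: "'u set" where "infinite X" using small_infinite by blast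
  then show ?thesis using finite_subset[OF subset_UNIV] by metis
qed

definition upair :: "'u \<times> 'u \<Rightarrow> 'u" where "upair = (SOME p. inj p)"

lemma inj_upair: "inj upair"
proof -
  have "(UNIV :: 'u set) \<times> (UNIV :: 'u set) \<lesssim> (UNIV :: 'u set)"
    by (rule times_lepoll_infinite[OF infinite_UNIV lepoll_refl lepoll_refl])
  then have "\<exists>p :: 'u \<times> 'u \<Rightarrow> 'u. inj p" by (auto simp: lepoll_def)
  then show ?thesis unfolding upair_def by (rule someI_ex)
qed

definition q1 :: "'u \<Rightarrow> 'u" where "q1 u = fst (inv_into UNIV upair u)"
definition q2 :: "'u \<Rightarrow> 'u" where "q2 u = snd (inv_into UNIV upair u)"

lemma q_upair [simp]: "q1 (upair (a, b)) = a" "q2 (upair (a, b)) = b"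
  by (simp_all add: q1_def q2_def inv_f_f[OF inj_upair])

lemma upair_eq [simp]: "upair x = upair y \<longleftrightarrow> x = y"
  by (rule inj_eq[OF inj_upair])

text \<open>\<open>R \<oplus> R\<close>, with pairs coded as elements of \<open>'u\<close> because objects have carriers in that type.\<close>

definition pair_mod :: "'u gmod" where
  "pair_mod = \<lparr>carrier = upair ` (carrier R \<times> carrier R),
     mult = (\<lambda>u v. upair (q1 u \<oplus>\<^bsub>R\<^esub> q1 v, q2 u \<oplus>\<^bsub>R\<^esub> q2 v)), one = upair (\<zero>\<^bsub>R\<^esub>, \<zero>\<^bsub>R\<^esub>),
     ract = (\<lambda>u r. upair (q1 u \<otimes>\<^bsub>R\<^esub> r, q2 u \<otimes>\<^bsub>R\<^esub> r)), deg = (\<lambda>n. upair ` (rdeg R n \<times> rdeg R n))\<rparr>"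

lemma pair_mod_simps [simp]: "carrier pair_mod = upair ` (carrier R \<times> carrier R)"
  "mult pair_mod u v = upair (q1 u \<oplus>\<^bsub>R\<^esub> q1 v, q2 u \<oplus>\<^bsub>R\<^esub> q2 v)" "one pair_mod = upair (\<zero>\<^bsub>R\<^esub>, \<zero>\<^bsub>R\<^esub>)"
  "ract pair_mod u r = upair (q1 u \<otimes>\<^bsub>R\<^esub> r, q2 u \<otimes>\<^bsub>R\<^esub> r)" "deg pair_mod n = upair ` (rdeg R n \<times> rdeg R n)"
  by (simp_all add: pair_mod_def)

lemma rdeg_zero: "\<zero>\<^bsub>R\<^esub> \<in> rdeg R n"
  using R.deg_one[of n] by simp

lemma rdeg_add: "r \<in> rdeg R n \<Longrightarrow> s \<in> rdeg R n \<Longrightarrow> r \<oplus>\<^bsub>R\<^esub> s \<in> rdeg R n"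
  using R.deg_mult[of r n s] by simp

lemma pair_mod_Obj: "pair_mod \<in> Obj A"
proof -
  let ?G = "gcomp (add_monoid R) (rdeg R)"
  have c: "comm_group pair_mod"
  proof (rule comm_groupI)
    show "\<exists>v\<in>carrier pair_mod. v \<otimes>\<^bsub>pair_mod\<^esub> u = \<one>\<^bsub>pair_mod\<^esub>" if "u \<in> carrier pair_mod" for u
    proof -
      from that obtain a b where "u = upair (a, b)" "a \<in> carrier R" "b \<in> carrier R" by auto
      then show ?thesis
        by (intro bexI[of _ "upair (\<ominus>\<^bsub>R\<^esub> a, \<ominus>\<^bsub>R\<^esub> b)"]) (simp_all add: R.l_neg)
    qed
  qed (auto simp: R.a_ac)
  interpret P: comm_group pair_mod by (rule c)
  have gc1: "?G a n \<in> carrier R" if "a \<in> carrier R" for a n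
    using R.gcomp_closed[of a n] that by simp
  have gc2: "?G (a \<oplus>\<^bsub>R\<^esub> b) n = ?G a n \<oplus>\<^bsub>R\<^esub> ?G b n" if "a \<in> carrier R" "b \<in> carrier R" for a b n
    using R.gcomp_mult[of a b] that by (simp add: fun_eq_iff)
  have gc3: "?G a n = (if n = i then a else \<zero>\<^bsub>R\<^esub>)" if "a \<in> rdeg R i" for a i n
    using R.gcomp_homogeneous[OF that] by (simp add: fun_eq_iff)
  note gc = gc1 gc2 gc3
  have "graded_group pair_mod (deg pair_mod)"
  proof (rule graded_groupI[OF c, where p = "\<lambda>n u. upair (?G (q1 u) n, ?G (q2 u) n)"])
    fix i
    show "subgroup (deg pair_mod i) pair_mod"
    proof (rule P.subgroupI)
      show "deg pair_mod i \<subseteq> carrier pair_mod" using R.rdeg_closed by auto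
      show "deg pair_mod i \<noteq> {}" using rdeg_zero by auto
      fix u assume u: "u \<in> deg pair_mod i"
      show "v \<in> deg pair_mod i \<Longrightarrow> u \<otimes>\<^bsub>pair_mod\<^esub> v \<in> deg pair_mod i" for v
        using u rdeg_add by auto
      from u obtain a b where ab: "u = upair (a, b)" "a \<in> rdeg R i" "b \<in> rdeg R i" by auto
      have neg: "\<ominus>\<^bsub>R\<^esub> a \<in> rdeg R i" "\<ominus>\<^bsub>R\<^esub> b \<in> rdeg R i"
        using R.deg_inv ab by (simp_all add: a_inv_def)
      have "inv\<^bsub>pair_mod\<^esub> u = upair (\<ominus>\<^bsub>R\<^esub> a, \<ominus>\<^bsub>R\<^esub> b)"
        using ab R.rdeg_closed by (intro P.inv_equality) (auto simp: R.l_neg)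
      then show "inv\<^bsub>pair_mod\<^esub> u \<in> deg pair_mod i" using neg by auto
    qed
    show "(\<lambda>u. upair (?G (q1 u) i, ?G (q2 u) i)) \<in> hom pair_mod pair_mod"
      by (auto simp: hom_def gc)
    show "u \<in> deg pair_mod i \<Longrightarrow> upair (?G (q1 u) i, ?G (q2 u) i) = u" for u
      by (auto simp: gc)
    show "u \<in> deg pair_mod j \<Longrightarrow> i \<noteq> j \<Longrightarrow> upair (?G (q1 u) i, ?G (q2 u) i) = \<one>\<^bsub>pair_mod\<^esub>" for u j
      by (auto simp: gc)
  next
    let ?H = "generate pair_mod (\<Union>i. deg pair_mod i)"
    have left: "upair (a, \<zero>\<^bsub>R\<^esub>) \<in> ?H" if "a \<in> carrier R" for a
      using that
    proof (induction a rule: R.ring_graded_induct)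
      case (homogeneous i a)
      then have "upair (a, \<zero>\<^bsub>R\<^esub>) \<in> deg pair_mod i" using rdeg_zero by auto
      then show ?case by (blast intro: generate.incl)
    next
      case (add a b)
      then show ?case using generate.eng[OF add(3,4)] by simp
    qed
    have right: "upair (\<zero>\<^bsub>R\<^esub>, a) \<in> ?H" if "a \<in> carrier R" for a
      using that
    proof (induction a rule: R.ring_graded_induct)
      case (homogeneous i a)
      then have "upair (\<zero>\<^bsub>R\<^esub>, a) \<in> deg pair_mod i" using rdeg_zero by auto
      then show ?case by (blast intro: generate.incl)
    next
      case (add a b)
      then show ?case using generate.eng[OF add(3,4)] by simp
    qed
    show "carrier pair_mod \<subseteq> ?H"
    proof
      fix u assume "u \<in> carrier pair_mod"
      then obtain a b where ab: "u = upair (a, b)" "a \<in> carrier R" "b \<in> carrier R" by auto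
      then show "u \<in> ?H" using generate.eng[OF left[of a] right[of b]] by simp
    qed
  qed
  moreover have "carrier pair_mod \<in> U"
  proof -
    \<comment> \<open>Smallness of the set of pairs: it is a small union of images of
      \<open>carrier R\<close>.\<close>
    have "carrier pair_mod = (\<Union>a\<in>carrier R. (\<lambda>b. upair (a, b)) ` carrier R)" by auto
    then show ?thesis using small_Union[OF R_small] small_image[OF R_small] by metis
  qed
  ultimately show ?thesis
    using R.degree_mult
    by (auto intro!: graded_module.intro graded_module_axioms.intro R.graded_ring_axioms
        simp: R.l_distr R.r_distr R.m_assoc)
qed

abbreviation "Rm \<equiv> reg_mod R"
abbreviation "Pm \<equiv> pair_mod"

definition in1 where "in1 = Arrow Rm Pm (\<lambda>r\<in>carrier Rm. upair (r, \<zero>\<^bsub>R\<^esub>))"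
definition in2 where "in2 = Arrow Rm Pm (\<lambda>r\<in>carrier Rm. upair (\<zero>\<^bsub>R\<^esub>, r))"
definition diag where "diag = Arrow Rm Pm (\<lambda>r\<in>carrier Rm. upair (r, r))"
definition pj1 where "pj1 = Arrow Pm Rm (\<lambda>u\<in>carrier Pm. q1 u)"
definition pj2 where "pj2 = Arrow Pm Rm (\<lambda>u\<in>carrier Pm. q2 u)"

lemma pair_arrows:
  shows in1_Hom: "in1 \<in> Hom A Rm Pm" and in2_Hom: "in2 \<in> Hom A Rm Pm"
    and diag_Hom: "diag \<in> Hom A Rm Pm" and pj1_Hom: "pj1 \<in> Hom A Pm Rm" and pj2_Hom: "pj2 \<in> Hom A Pm Rm"
proof -
  have "is_graded_map R Rm Pm (\<lambda>r. upair (r, \<zero>\<^bsub>R\<^esub>))" "is_graded_map R Rm Pm (\<lambda>r. upair (\<zero>\<^bsub>R\<^esub>, r))"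
    "is_graded_map R Rm Pm (\<lambda>r. upair (r, r))" "is_graded_map R Pm Rm q1" "is_graded_map R Pm Rm q2"
    by (auto simp: is_graded_map_def hom_def rdeg_zero)
  then show "in1 \<in> Hom A Rm Pm" "in2 \<in> Hom A Rm Pm" "diag \<in> Hom A Rm Pm" "pj1 \<in> Hom A Pm Rm" "pj2 \<in> Hom A Pm Rm"
    unfolding in1_def in2_def diag_def pj1_def pj2_def
    using restrict_Hom[OF reg_Obj pair_mod_Obj] restrict_Hom[OF pair_mod_Obj reg_Obj] by blast+
qed

lemma pair_mor [simp]: "r \<in> carrier R \<Longrightarrow> mor in1 r = upair (r, \<zero>\<^bsub>R\<^esub>)"
  "r \<in> carrier R \<Longrightarrow> mor in2 r = upair (\<zero>\<^bsub>R\<^esub>, r)" "r \<in> carrier R \<Longrightarrow> mor diag r = upair (r, r)"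
  "a \<in> carrier R \<Longrightarrow> b \<in> carrier R \<Longrightarrow> mor pj1 (upair (a, b)) = a"
  "a \<in> carrier R \<Longrightarrow> b \<in> carrier R \<Longrightarrow> mor pj2 (upair (a, b)) = b"
  by (simp_all add: in1_def in2_def diag_def pj1_def pj2_def)

text \<open>The arrow induced on a coproduct, provided at every shift \<open>k\<close> because
  generators of a graded module occur in every degree.\<close>

definition copair :: "int \<Rightarrow> 'u gmod \<Rightarrow> 'u garrow \<Rightarrow> 'u garrow \<Rightarrow> 'u garrow" where
  "copair k Y f g = Arrow (shift k Pm) Y (\<lambda>u\<in>carrier Pm. mor f (q1 u) \<otimes>\<^bsub>Y\<^esub> mor g (q2 u))"

lemma copair:
  assumes f: "f \<in> Hom A (shift k Rm) Y" and g: "g \<in> Hom A (shift k Rm) Y"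
  shows copair_Hom: "copair k Y f g \<in> Hom A (shift k Pm) Y"
    and copair_mor: "a \<in> carrier R \<Longrightarrow> b \<in> carrier R \<Longrightarrow>
      mor (copair k Y f g) (upair (a, b)) = mor f a \<otimes>\<^bsub>Y\<^esub> mor g b"
    and copair_in1: "copair k Y f g \<bullet> shift_arr k in1 = f"
    and copair_in2: "copair k Y f g \<bullet> shift_arr k in2 = g"
proof -
  have Y: "Y \<in> Obj A" using Hom_target[OF f] .
  have P: "shift k Pm \<in> Obj A" by (rule shift_Obj[OF pair_mod_Obj])
  interpret Y: graded_module R Y using Y by simp
  note fs = Hom_closed[OF f, simplified] Hom_closed[OF g, simplified] Hom_mult[OF f, simplified]
    Hom_mult[OF g, simplified] Hom_ract[OF f, simplified] Hom_ract[OF g, simplified]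
  have "(\<lambda>u. mor f (q1 u) \<otimes>\<^bsub>Y\<^esub> mor g (q2 u)) \<in> hom (shift k Pm) Y"
    by (auto simp: hom_def fs Y.m_ac)
  moreover have "mor f (q1 (ract Pm u r)) \<otimes>\<^bsub>Y\<^esub> mor g (q2 (ract Pm u r)) =
      ract Y (mor f (q1 u) \<otimes>\<^bsub>Y\<^esub> mor g (q2 u)) r" if "u \<in> carrier Pm" "r \<in> carrier R" for u r
    using that by (auto simp: fs Y.ract_add_left)
  moreover have "mor f a \<otimes>\<^bsub>Y\<^esub> mor g b \<in> deg Y n" if "a \<in> rdeg R (n + k)" "b \<in> rdeg R (n + k)" for a b n
    using that Hom_deg[OF f, of a n] Hom_deg[OF g, of b n] by (simp add: Y.deg_mult)
  ultimately have "is_graded_map R (shift k Pm) Y (\<lambda>u. mor f (q1 u) \<otimes>\<^bsub>Y\<^esub> mor g (q2 u))"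
    unfolding is_graded_map_def by auto
  from restrict_Hom[OF P Y this] show h: "copair k Y f g \<in> Hom A (shift k Pm) Y"
    by (simp add: copair_def)
  show m: "mor (copair k Y f g) (upair (a, b)) = mor f a \<otimes>\<^bsub>Y\<^esub> mor g b"
    if "a \<in> carrier R" "b \<in> carrier R" for a b
    using that by (simp add: copair_def)
  note i1 = shift_arr_Hom[OF in1_Hom, of k] and i2 = shift_arr_Hom[OF in2_Hom, of k]
  have one: "mor f \<zero>\<^bsub>R\<^esub> = \<one>\<^bsub>Y\<^esub>" "mor g \<zero>\<^bsub>R\<^esub> = \<one>\<^bsub>Y\<^esub>"
    using Hom_one[OF f] Hom_one[OF g] by simp_all
  show "copair k Y f g \<bullet> shift_arr k in1 = f"
    by (rule Hom_eqI[OF GrMod_Comp_Hom[OF i1 h] f]) (simp add: mor_Comp[OF i1] m one fs)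
  show "copair k Y f g \<bullet> shift_arr k in2 = g"
    by (rule Hom_eqI[OF GrMod_Comp_Hom[OF i2 h] g]) (simp add: mor_Comp[OF i2] m one fs)
qed

lemma copair_unique:
  assumes h: "h \<in> Hom A (shift k Pm) Y"
    and f: "f \<in> Hom A (shift k Rm) Y" and g: "g \<in> Hom A (shift k Rm) Y"
    and 1: "h \<bullet> shift_arr k in1 = f" and 2: "h \<bullet> shift_arr k in2 = g"
  shows "h = copair k Y f g"
proof (rule Hom_eqI[OF h copair_Hom[OF f g]])
  fix u assume "u \<in> carrier (shift k Pm)"
  then obtain a b where u: "u = upair (a, b)" and ab: "a \<in> carrier R" "b \<in> carrier R" by auto
  note i1 = shift_arr_Hom[OF in1_Hom, of k] and i2 = shift_arr_Hom[OF in2_Hom, of k]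
  have "mor h (upair (a, b)) = mor h (upair (a, \<zero>\<^bsub>R\<^esub>)) \<otimes>\<^bsub>Y\<^esub> mor h (upair (\<zero>\<^bsub>R\<^esub>, b))"
    using Hom_mult[OF h, of "upair (a, \<zero>\<^bsub>R\<^esub>)" "upair (\<zero>\<^bsub>R\<^esub>, b)"] ab by simp
  also have "\<dots> = mor f a \<otimes>\<^bsub>Y\<^esub> mor g b"
    using ab mor_Comp[OF i1, of a h] mor_Comp[OF i2, of b h] 1 2 by simp
  finally show "mor h u = mor (copair k Y f g) u"
    using ab by (simp add: u copair_mor[OF f g])
qed

text \<open>Initiality as the colimit of the empty diagram, brought into the shape to which
  \<open>preserves_presentation\<close> applies; the index type is a placeholder.\<close>

lemma zero_mod_presentation:
  "is_presentation A ({} :: unit set) ({} :: unit set) G s t f g zero_mod c"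
  unfolding is_presentation_def is_copres_cocone_def
proof (intro conjI allI impI zero_mod_Obj ballI; (elim conjE)?)
  fix Y assume Y: "Y \<in> Obj A"
  show "\<exists>!h. h \<in> Hom A zero_mod Y \<and> (\<forall>i\<in>{}. h \<bullet> c i = d i)" for d :: "unit \<Rightarrow> 'u garrow"
  proof (rule ex1I[of _ "zero_arr zero_mod Y"])
    fix h assume "h \<in> Hom A zero_mod Y \<and> (\<forall>i\<in>{}. h \<bullet> c i = d i)"
    then show "h = zero_arr zero_mod Y"
      using Hom_one[of h U R zero_mod Y]
      by (intro Hom_eqI[OF _ zero_arr_Hom[OF zero_mod_Obj Y]]) (auto simp: zero_arr_def)
  qed (simp add: zero_arr_Hom[OF zero_mod_Obj Y])
qed auto

text \<open>A coproduct of two objects is a presentation with two generators and no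
  relations.\<close>

lemma pair_mod_presentation:
  "is_presentation A (UNIV :: bool set) ({} :: unit set) (\<lambda>_. shift k Rm) s t f g (shift k Pm)
    (\<lambda>b. shift_arr k (if b then in1 else in2))"
  unfolding is_presentation_def is_copres_cocone_def
proof (intro conjI allI impI ballI; (elim conjE)?)
  fix Y and d :: "bool \<Rightarrow> 'u garrow" assume d: "\<forall>b\<in>UNIV. d b \<in> Hom A (shift k Rm) Y"
  show "\<exists>!h. h \<in> Hom A (shift k Pm) Y \<and> (\<forall>b\<in>UNIV. h \<bullet> shift_arr k (if b then in1 else in2) = d b)"
  proof (rule ex1I[of _ "copair k Y (d True) (d False)"])
    show "copair k Y (d True) (d False) \<in> Hom A (shift k Pm) Y \<and>
        (\<forall>b\<in>UNIV. copair k Y (d True) (d False) \<bullet> shift_arr k (if b then in1 else in2) = d b)"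
      using d by (auto simp: copair_Hom copair_in1 copair_in2)
    fix h assume h: "h \<in> Hom A (shift k Pm) Y \<and>
      (\<forall>b\<in>UNIV. h \<bullet> shift_arr k (if b then in1 else in2) = d b)"
    show "h = copair k Y (d True) (d False)"
      by (rule copair_unique)
        (use d h bspec[OF conjunct2[OF h], of True] bspec[OF conjunct2[OF h], of False] in simp_all)
  qed
qed (use shift_Obj[OF pair_mod_Obj] shift_arr_Hom[OF in1_Hom] shift_arr_Hom[OF in2_Hom] in auto)

end

section \<open>Additivity of the comonad\<close>

context shift_setting
begin

declare GrMod_Obj [simp]
declare sa_simps [simp del]

lemma C_Hom: "f \<in> Hom A M N \<Longrightarrow> CC f \<in> Hom A (C0 M) (C0 N)"
  by (rule comult.F.farr_Hom)

lemma C_preserves: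
  assumes "I \<lesssim> Z" "K \<lesssim> Z" "(Z :: 'u set) \<in> U" "infinite Z"
    "\<And>k. k \<in> K \<Longrightarrow> s k \<in> I \<and> t k \<in> I"
    "\<And>i. i \<in> I \<Longrightarrow> G i \<in> Obj A" "\<And>k. k \<in> K \<Longrightarrow> P k \<in> Obj A"
    "\<And>k. k \<in> K \<Longrightarrow> f k \<in> Hom A (P k) (G (s k))" "\<And>k. k \<in> K \<Longrightarrow> g k \<in> Hom A (P k) (G (t k))"
    "is_presentation A I K G s t f g X c"
  shows "is_presentation A I K (\<lambda>i. C0 (G i)) s t (\<lambda>k. CC (f k)) (\<lambda>k. CC (g k)) (C0 X) (\<lambda>i. CC (c i))"
  by (rule preserves_presentation[OF small_universe_axioms comult.F.cat_functor_axioms C_colimits,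
        where Z = Z and P = P]) (use assms in \<open>auto simp del: GrMod_Obj\<close>)

text \<open>\<open>C0 zero_mod\<close> is again initial, so its identity equals the zero
  arrow.\<close>

lemma C_zero_mod: "y \<in> carrier (C0 zero_mod) \<Longrightarrow> y = \<one>\<^bsub>C0 zero_mod\<^esub>"
proof -
  obtain Z where Z: "Z \<in> U" "infinite Z" using small_infinite by blast
  have "is_presentation A ({} :: unit set) ({} :: unit set) (\<lambda>i. C0 (undefined i)) undefined undefined
      (\<lambda>k. CC (undefined k)) (\<lambda>k. CC (undefined k)) (C0 zero_mod) (\<lambda>i. CC (undefined i))"
    by (rule C_preserves[OF empty_lepoll empty_lepoll Z _ _ _ _ _ zero_mod_presentation]) auto
  then have "\<exists>!h. h \<in> Hom A (C0 zero_mod) (C0 zero_mod)"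
    using comult.F.fobj_Obj[OF zero_mod_Obj] by (simp add: is_presentation_def is_copres_cocone_def)
  moreover have "Id A (C0 zero_mod) \<in> Hom A (C0 zero_mod) (C0 zero_mod)"
    "zero_arr (C0 zero_mod) (C0 zero_mod) \<in> Hom A (C0 zero_mod) (C0 zero_mod)"
    using comult.F.fobj_Obj[OF zero_mod_Obj] by (simp_all only: GrMod_Id_Hom zero_arr_Hom)
  ultimately have eq: "Id A (C0 zero_mod) = zero_arr (C0 zero_mod) (C0 zero_mod)" by blast
  show "y \<in> carrier (C0 zero_mod) \<Longrightarrow> ?thesis"
    using mor_Id[of y "C0 zero_mod" U R] unfolding eq zero_arr_def by simp
qed

text \<open>A zero arrow factors through the zero object, whose image under \<open>C\<close> is
  zero.\<close>

lemma C_zero: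
  assumes f: "f \<in> Hom A M N" and 0: "\<And>x. x \<in> carrier M \<Longrightarrow> mor f x = \<one>\<^bsub>N\<^esub>"
    and y: "y \<in> carrier (C0 M)"
  shows "mor (CC f) y = \<one>\<^bsub>C0 N\<^esub>"
proof -
  let ?a = "zero_arr M zero_mod" and ?b = "zero_arr zero_mod N"
  have a: "?a \<in> Hom A M zero_mod" and b: "?b \<in> Hom A zero_mod N"
    using Hom_objs[OF f] zero_mod_Obj by (auto intro!: zero_arr_Hom simp del: GrMod_Obj)
  have "f = ?b \<bullet> ?a"
    by (rule Hom_eqI[OF f GrMod_Comp_Hom[OF a b]]) (simp add: mor_Comp[OF a] 0)
  then have "mor (CC f) y = mor (CC ?b) (mor (CC ?a) y)"
    using comult.F.farr_Comp[OF a b] mor_Comp[OF C_Hom[OF a] y] by simp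
  also have "\<dots> = mor (CC ?b) \<one>\<^bsub>C0 zero_mod\<^esub>"
    using C_zero_mod[OF Hom_closed[OF C_Hom[OF a] y]] by simp
  also have "\<dots> = \<one>\<^bsub>C0 N\<^esub>" by (rule Hom_one[OF C_Hom[OF b]])
  finally show ?thesis .
qed

text \<open>The images of the two injections are a coproduct again, so \<open>CC u\<close> is
  determined by its composites with them. The sum formed with the images of the projections has the
  same composites.\<close>

lemma C_split:
  assumes u: "u \<in> Hom A (shift k Pm) Y" and y: "y \<in> carrier (C0 (shift k Pm))"
  shows "mor (CC u) y = mor (CC (u \<bullet> sa k in1)) (mor (CC (sa k pj1)) y) \<otimes>\<^bsub>C0 Y\<^esub>
    mor (CC (u \<bullet> sa k in2)) (mor (CC (sa k pj2)) y)"
proof -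
  note homs = shift_arr_Hom[OF in1_Hom, of k] shift_arr_Hom[OF in2_Hom, of k]
    shift_arr_Hom[OF pj1_Hom, of k] shift_arr_Hom[OF pj2_Hom, of k]
  obtain Z where Z: "Z \<in> U" "infinite Z" using small_infinite by blast
  have Y: "Y \<in> Obj A" and R: "shift k Rm \<in> Obj A" and P: "shift k Pm \<in> Obj A"
    using Hom_objs[OF u] Hom_objs[OF homs(1)] by auto
  have fin: "(UNIV :: bool set) \<lesssim> Z" using Z(2) by (intro finite_lepoll_infinite) auto
  have pres: "is_presentation A (UNIV :: bool set) ({} :: unit set) (\<lambda>_. C0 (shift k Rm)) undefined undefined
      (\<lambda>k. CC (undefined k)) (\<lambda>k. CC (undefined k)) (C0 (shift k Pm))
      (\<lambda>b. CC (sa k (if b then in1 else in2)))"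
    by (rule C_preserves[OF fin empty_lepoll Z _ _ _ _ _ pair_mod_presentation]) (use R in auto)
  let ?u1 = "CC (u \<bullet> sa k in1)" and ?u2 = "CC (u \<bullet> sa k in2)"
  let ?p1 = "CC (sa k pj1)" and ?p2 = "CC (sa k pj2)"
  note uh = C_Hom[OF GrMod_Comp_Hom[OF homs(1) u]] C_Hom[OF GrMod_Comp_Hom[OF homs(2) u]]
  note ph = C_Hom[OF homs(3)] C_Hom[OF homs(4)] and ih = C_Hom[OF homs(1)] C_Hom[OF homs(2)]
  let ?v = "add_arr (?u1 \<bullet> ?p1) (?u2 \<bullet> ?p2)"
  note up = GrMod_Comp_Hom[OF ph(1) uh(1)] GrMod_Comp_Hom[OF ph(2) uh(2)]
  have v: "?v \<in> Hom A (C0 (shift k Pm)) (C0 Y)" by (rule add_arr_Hom[OF up])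
  have CY: "graded_module R (C0 Y)" using Hom_target_module[OF v] .
  then interpret CY: graded_module R "C0 Y" .
  have pi: "sa k pj1 \<bullet> sa k in1 = Id A (shift k Rm)" "sa k pj2 \<bullet> sa k in2 = Id A (shift k Rm)"
    using GrMod_Comp_Hom[OF homs(1,3)] GrMod_Comp_Hom[OF homs(2,4)] GrMod_Id_Hom[OF R]
    by (auto intro!: Hom_eqI simp: mor_Comp[OF homs(1)] mor_Comp[OF homs(2)] mor_Id)
  have cpi: "?p1 \<bullet> CC (sa k in1) = Id A (C0 (shift k Rm))" "?p2 \<bullet> CC (sa k in2) = Id A (C0 (shift k Rm))"
    unfolding comult.F.farr_Comp[OF homs(1,3), symmetric] comult.F.farr_Comp[OF homs(2,4), symmetric]
    unfolding pi by (rule comult.F.farr_Id[OF R])+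
  have pp: "mor ?p1 (mor (CC (sa k in1)) z) = z" "mor ?p2 (mor (CC (sa k in2)) z) = z"
    if "z \<in> carrier (C0 (shift k Rm))" for z
    using that by (simp_all add: mor_Comp[OF ih(1), symmetric] mor_Comp[OF ih(2), symmetric] cpi mor_Id)
  \<comment> \<open>Each projection kills the other injection, and \<open>C\<close> preserves zero
    arrows.\<close>
  have cross: "mor ?p2 (mor (CC (sa k in1)) z) = \<one>\<^bsub>C0 (shift k Rm)\<^esub>"
    "mor ?p1 (mor (CC (sa k in2)) z) = \<one>\<^bsub>C0 (shift k Rm)\<^esub>"
    if z: "z \<in> carrier (C0 (shift k Rm))" for z
    unfolding mor_Comp[OF ih(1) z, symmetric] mor_Comp[OF ih(2) z, symmetric]
      comult.F.farr_Comp[OF homs(1,4), symmetric] comult.F.farr_Comp[OF homs(2,3), symmetric]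
    by (rule C_zero[OF GrMod_Comp_Hom[OF homs(1,4)] _ z] C_zero[OF GrMod_Comp_Hom[OF homs(2,3)] _ z];
        simp add: mor_Comp[OF homs(1)] mor_Comp[OF homs(2)])+
  have v1: "?v \<bullet> CC (sa k in1) = ?u1"
    by (rule Hom_eqI[OF GrMod_Comp_Hom[OF ih(1) v] uh(1)])
      (simp add: mor_Comp[OF ih(1)] add_arr_mor[OF up] mor_Comp[OF ph(1)] mor_Comp[OF ph(2)]
        Hom_closed[OF ih(1)] pp cross Hom_one[OF uh(2)] Hom_closed[OF uh(1)])
  have v2: "?v \<bullet> CC (sa k in2) = ?u2"
    by (rule Hom_eqI[OF GrMod_Comp_Hom[OF ih(2) v] uh(2)])
      (simp add: mor_Comp[OF ih(2)] add_arr_mor[OF up] mor_Comp[OF ph(1)] mor_Comp[OF ph(2)]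
        Hom_closed[OF ih(2)] pp cross Hom_one[OF uh(1)] Hom_closed[OF uh(2)])
  let ?d = "\<lambda>b. if b then ?u1 else ?u2"
  have "\<exists>!h. h \<in> Hom A (C0 (shift k Pm)) (C0 Y) \<and>
      (\<forall>b\<in>UNIV. h \<bullet> CC (sa k (if b then in1 else in2)) = ?d b)"
    using pres uh Hom_target[OF v] unfolding is_presentation_def is_copres_cocone_def
    by (auto simp del: GrMod_Obj)
  moreover have "CC u \<in> Hom A (C0 (shift k Pm)) (C0 Y) \<and>
      (\<forall>b\<in>UNIV. CC u \<bullet> CC (sa k (if b then in1 else in2)) = ?d b)"
    using C_Hom[OF u] comult.F.farr_Comp[OF homs(1) u] comult.F.farr_Comp[OF homs(2) u] by auto
  moreover have "?v \<in> Hom A (C0 (shift k Pm)) (C0 Y) \<and>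
      (\<forall>b\<in>UNIV. ?v \<bullet> CC (sa k (if b then in1 else in2)) = ?d b)"
    using v v1 v2 by auto
  ultimately have "CC u = ?v" by blast
  then show ?thesis
    using y by (simp add: add_arr_mor[OF up] mor_Comp[OF ph(1)] mor_Comp[OF ph(2)])
qed

text \<open>A sum factors as the diagonal of R followed by the copairing of its summands. Both
  projections split the diagonal, so splitting the image of the copairing gives the sum of the
  images.\<close>

lemma C_add:
  assumes f: "f \<in> Hom A Rm Y" and g: "g \<in> Hom A Rm Y" and h: "h \<in> Hom A Rm Y"
    and sum: "\<And>r. r \<in> carrier R \<Longrightarrow> mor h r = mor f r \<otimes>\<^bsub>Y\<^esub> mor g r" and y: "y \<in> carrier (C0 Rm)"
  shows "mor (CC h) y = mor (CC f) y \<otimes>\<^bsub>C0 Y\<^esub> mor (CC g) y"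
proof -
  have f': "f \<in> Hom A (shift 0 Rm) Y" and g': "g \<in> Hom A (shift 0 Rm) Y" using f g by simp_all
  let ?u = "copair 0 Y f g"
  have u: "?u \<in> Hom A (shift 0 Pm) Y" by (rule copair_Hom[OF f' g'])
  then have u': "?u \<in> Hom A Pm Y" by simp
  have "h = ?u \<bullet> diag"
    by (rule Hom_eqI[OF h GrMod_Comp_Hom[OF diag_Hom u']])
      (simp add: mor_Comp[OF diag_Hom] copair_mor[OF f' g'] sum)
  then have "mor (CC h) y = mor (CC ?u) (mor (CC diag) y)"
    using comult.F.farr_Comp[OF diag_Hom u'] mor_Comp[OF C_Hom[OF diag_Hom] y] by simp
  also have "\<dots> = mor (CC f) (mor (CC pj1) (mor (CC diag) y)) \<otimes>\<^bsub>C0 Y\<^esub>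
      mor (CC g) (mor (CC pj2) (mor (CC diag) y))"
    using C_split[OF u] Hom_closed[OF C_Hom[OF diag_Hom] y] copair_in1[OF f' g'] copair_in2[OF f' g']
    by simp
  finally have sum': "mor (CC h) y = mor (CC f) (mor (CC pj1) (mor (CC diag) y)) \<otimes>\<^bsub>C0 Y\<^esub>
      mor (CC g) (mor (CC pj2) (mor (CC diag) y))" .
  have "pj1 \<bullet> diag = Id A Rm" "pj2 \<bullet> diag = Id A Rm"
    using GrMod_Comp_Hom[OF diag_Hom pj1_Hom] GrMod_Comp_Hom[OF diag_Hom pj2_Hom] GrMod_Id_Hom[OF reg_Obj]
    by (auto intro!: Hom_eqI simp: mor_Comp[OF diag_Hom] mor_Id)
  then have "CC pj1 \<bullet> CC diag = Id A (C0 Rm)" "CC pj2 \<bullet> CC diag = Id A (C0 Rm)"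
    using comult.F.farr_Comp[OF diag_Hom pj1_Hom] comult.F.farr_Comp[OF diag_Hom pj2_Hom]
      comult.F.farr_Id[OF reg_Obj] by simp_all
  then have "mor (CC pj1) (mor (CC diag) y) = y" "mor (CC pj2) (mor (CC diag) y) = y"
    using y by (simp_all add: mor_Comp[OF C_Hom[OF diag_Hom], symmetric] mor_Id)
  with sum' show ?thesis by simp
qed

end

section \<open>The bimodule \<open>C(R)\<close>\<close>

context shift_setting
begin

declare GrMod_Obj [simp del]

lemma shift_Obj_iff: "shift i N \<in> Obj A \<longleftrightarrow> N \<in> Obj A"
  using shift_Obj[of "shift i N" U R "- i"] shift_Obj[of N U R i] by auto

lemma C0_Obj: "M \<in> Obj A \<Longrightarrow> C0 M \<in> Obj A"
  by (rule comult.F.fobj_Obj)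

context
  fixes i M N f
  assumes f: "f \<in> Hom A M (shift i N)"
begin

lemma f_obj: "M \<in> Obj A" "N \<in> Obj A"
  using Hom_objs[OF f] shift_Obj_iff by auto

lemma f_arr: "f \<in> Arr A" "Dom A f = M" "Cod A f = shift i N"
  using f by (auto simp: A.Hom_iff)

lemma Chat_Hom: "Chat i N f \<in> Hom A (C0 M) (shift i (C0 N))"
  using Chat_simps[OF f_arr f_obj(2)] by (simp add: A.Hom_iff)

lemma hat_closed: "y \<in> carrier (C0 M) \<Longrightarrow> mor (Chat i N f) y \<in> carrier (C0 N)"
  using Hom_closed[OF Chat_Hom] by simp

lemma hat_mult: "y \<in> carrier (C0 M) \<Longrightarrow> z \<in> carrier (C0 M) \<Longrightarrow>
    mor (Chat i N f) (y \<otimes>\<^bsub>C0 M\<^esub> z) = mor (Chat i N f) y \<otimes>\<^bsub>C0 N\<^esub> mor (Chat i N f) z"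
  using Hom_mult[OF Chat_Hom] by simp

lemma hat_ract: "y \<in> carrier (C0 M) \<Longrightarrow> r \<in> carrier R \<Longrightarrow>
    mor (Chat i N f) (ract (C0 M) y r) = ract (C0 N) (mor (Chat i N f) y) r"
  using Hom_ract[OF Chat_Hom] by simp

lemma hat_deg: "y \<in> deg (C0 M) n \<Longrightarrow> mor (Chat i N f) y \<in> deg (C0 N) (n + i)"
  using Hom_deg[OF Chat_Hom] by simp

lemma hat_eq: "y \<in> carrier (C0 M) \<Longrightarrow> mor (Chat i N f) y = mor (si i N) (mor (CC f) y)"
  unfolding Chat_def by (rule mor_Comp[OF C_Hom[OF f]])

lemma hat_comp:
  assumes g: "g \<in> Hom A N (shift j K)" and y: "y \<in> carrier (C0 M)"
  shows "mor (Chat (i + j) K (sa i g \<bullet> f)) y = mor (Chat j K g) (mor (Chat i N f) y)"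
proof -
  have K: "K \<in> Obj A" using Hom_target[OF g] shift_Obj_iff by auto
  have "g \<in> Arr A" "Dom A g = N" "Cod A g = shift j K" using g by (auto simp: A.Hom_iff)
  from Chat_comp[OF f_arr f_obj(2) this K] show ?thesis
    by (simp add: mor_Comp[OF Chat_Hom y])
qed

lemma hat_counit:
  assumes y: "y \<in> carrier (C0 M)"
  shows "mor (counit C N) (mor (Chat i N f) y) = mor f (mor (counit C M) y)"
  using arg_cong[OF Chat_counit[OF f_arr f_obj(2)], of "\<lambda>h. mor h y"]
  by (simp add: mor_Comp[OF Chat_Hom y] mor_Comp[OF Cd.counit_Hom[OF f_obj(1)] y])

lemma hat_comult:
  assumes y: "y \<in> carrier (C0 M)"
  shows "mor (comult C N) (mor (Chat i N f) y) = mor (Chat i (C0 N) (Chat i N f)) (mor (comult C M) y)"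
  using arg_cong[OF Chat_comult[OF f_arr f_obj(2)], of "\<lambda>h. mor h y"]
  by (simp add: mor_Comp[OF Chat_Hom y] mor_Comp[OF Cd.comult_Hom[OF f_obj(1)] y])

end

lemma hat_0: "f \<in> Hom A M N \<Longrightarrow> Chat 0 N f = CC f"
  by (rule Chat_0) (auto simp: A.Hom_iff)

definition lam :: "int \<Rightarrow> 'u gmod \<Rightarrow> 'u \<Rightarrow> 'u garrow" where
  "lam i M x = Arrow Rm (shift i M) (\<lambda>r\<in>carrier R. ract M x r)"

text \<open>For \<open>x\<close> in \<open>M\<close>, the map \<open>C(R) \<rightarrow> C(M)\<close> induced by \<open>R \<rightarrow> M, r \<mapsto> x r\<close>.\<close>

definition L :: "'u gmod \<Rightarrow> 'u \<Rightarrow> 'u \<Rightarrow> 'u" where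
  "L M x d = gext M (deg M) (C0 M) (\<lambda>i x. mor (Chat i M (lam i M x)) d) x"

abbreviation "D0 \<equiv> C0 Rm"

lemma D0_Obj: "D0 \<in> Obj A" by (rule C0_Obj[OF reg_Obj])

context
  fixes M
  assumes M: "M \<in> Obj A"
begin

interpretation M: graded_module R M using M by (simp add: GrMod_Obj)
interpretation CM: graded_module R "C0 M" using C0_Obj[OF M] by (simp add: GrMod_Obj)
interpretation D0: graded_module R D0 using D0_Obj by (simp add: GrMod_Obj)

lemma lam_Hom: "x \<in> deg M i \<Longrightarrow> lam i M x \<in> Hom A Rm (shift i M)"
proof -
  assume x: "x \<in> deg M i"
  then have xc: "x \<in> carrier M" by (rule M.deg_closed)
  have "is_graded_map R Rm (shift i M) (ract M x)"
    using xc M.degree_ract[OF x]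
    by (auto simp: is_graded_map_def hom_def M.ract_closed M.ract_add_right M.ract_mult add.commute)
  from restrict_Hom[OF reg_Obj shift_Obj[OF M] this] show ?thesis by (simp add: lam_def)
qed

lemma lam_mor: "r \<in> carrier R \<Longrightarrow> mor (lam i M x) r = ract M x r"
  by (simp add: lam_def)

lemma hat_lam_add:
  assumes x: "x \<in> deg M i" and y: "y \<in> deg M i" and d: "d \<in> carrier D0"
  shows "mor (Chat i M (lam i M (x \<otimes>\<^bsub>M\<^esub> y))) d =
    mor (Chat i M (lam i M x)) d \<otimes>\<^bsub>C0 M\<^esub> mor (Chat i M (lam i M y)) d"
proof -
  have xy: "x \<otimes>\<^bsub>M\<^esub> y \<in> deg M i" using x y by (rule M.deg_mult)
  have "mor (CC (lam i M (x \<otimes>\<^bsub>M\<^esub> y))) d =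
      mor (CC (lam i M x)) d \<otimes>\<^bsub>C0 (shift i M)\<^esub> mor (CC (lam i M y)) d"
    by (rule C_add[OF lam_Hom[OF x] lam_Hom[OF y] lam_Hom[OF xy] _ d])
      (use x y in \<open>simp add: lam_mor M.ract_add_left M.deg_closed\<close>)
  moreover have s: "si i M \<in> Hom A (C0 (shift i M)) (shift i (C0 M))"
    using M by (simp add: A.Hom_iff)
  ultimately show ?thesis
    using d Hom_mult[OF s] Hom_closed[OF C_Hom[OF lam_Hom[OF x]]] Hom_closed[OF C_Hom[OF lam_Hom[OF y]]]
    by (simp add: hat_eq[OF lam_Hom[OF x]] hat_eq[OF lam_Hom[OF y]] hat_eq[OF lam_Hom[OF xy]])
qed

lemma L_hom_left: "d \<in> carrier D0 \<Longrightarrow> (\<lambda>x. L M x d) \<in> hom M (C0 M)"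
  unfolding L_def
  using M.gext_hom[OF CM.comm_group_axioms, of "\<lambda>i x. mor (Chat i M (lam i M x)) d"]
    hat_closed[OF lam_Hom] hat_lam_add by simp

lemma L_homogeneous: "d \<in> carrier D0 \<Longrightarrow> x \<in> deg M i \<Longrightarrow> L M x d = mor (Chat i M (lam i M x)) d"
  unfolding L_def
  using M.gext_homogeneous[OF CM.comm_group_axioms, of "\<lambda>i x. mor (Chat i M (lam i M x)) d" x i]
    hat_closed[OF lam_Hom] hat_lam_add by simp

text \<open>\<open>evaluate\<close> multiplies over the support with \<open>finprod\<close>, whereas
  \<open>L\<close> uses \<open>gfinprod\<close>; the two agree once the support is finite.\<close>

lemma L_finite: "d \<in> carrier D0 \<Longrightarrow> x \<in> carrier M \<Longrightarrow>
    finite {i. mor (Chat i M (lam i M (gcomp M (deg M) x i))) d \<noteq> \<one>\<^bsub>C0 M\<^esub>}"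
  using M.gext_finite[OF CM.comm_group_axioms, of "\<lambda>i x. mor (Chat i M (lam i M x)) d" x]
    hat_closed[OF lam_Hom] hat_lam_add by simp

lemma L_closed: "x \<in> carrier M \<Longrightarrow> d \<in> carrier D0 \<Longrightarrow> L M x d \<in> carrier (C0 M)"
  using hom_in_carrier[OF L_hom_left] by blast

lemma L_mult_left: "x \<in> carrier M \<Longrightarrow> y \<in> carrier M \<Longrightarrow> d \<in> carrier D0 \<Longrightarrow>
    L M (x \<otimes>\<^bsub>M\<^esub> y) d = L M x d \<otimes>\<^bsub>C0 M\<^esub> L M y d"
  using hom_mult[OF L_hom_left] by blast

lemma L_mult_right:
  assumes "x \<in> carrier M" and d: "d \<in> carrier D0" and e: "e \<in> carrier D0"
  shows "L M x (d \<otimes>\<^bsub>D0\<^esub> e) = L M x d \<otimes>\<^bsub>C0 M\<^esub> L M x e"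
  using assms(1)
proof (induction x rule: M.graded_induct)
  case (homogeneous i x)
  then show ?case using d e hat_mult[OF lam_Hom] by (simp add: L_homogeneous)
next
  case (mult x y)
  then show ?case using d e by (simp add: L_mult_left L_closed CM.m_ac)
qed

lemma L_ract:
  assumes "x \<in> carrier M" and d: "d \<in> carrier D0" and r: "r \<in> carrier R"
  shows "L M x (ract D0 d r) = ract (C0 M) (L M x d) r"
  using assms(1)
proof (induction x rule: M.graded_induct)
  case (homogeneous i x)
  then show ?case using d r hat_ract[OF lam_Hom] by (simp add: L_homogeneous D0.ract_closed)
next
  case (mult x y)
  then show ?case using d r by (simp add: L_mult_left L_closed D0.ract_closed CM.ract_add_left)
qed

lemma L_deg: "x \<in> deg M i \<Longrightarrow> d \<in> deg D0 j \<Longrightarrow> L M x d \<in> deg (C0 M) (i + j)"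
  using hat_deg[OF lam_Hom] by (simp add: L_homogeneous D0.deg_closed add.commute)

text \<open>For homogeneous \<open>x\<close> the arrow of \<open>mor g x\<close> is the arrow of
  \<open>x\<close> followed by \<open>g\<close>, so this is functoriality of the enriched functor.
  Allowing \<open>g\<close> a degree \<open>j\<close> makes it cover naturality in M, the balance
  law and the comultiplication at once.\<close>

lemma L_natural:
  assumes g: "g \<in> Hom A M (shift j N)" and x: "x \<in> carrier M" and d: "d \<in> carrier D0"
  shows "mor (Chat j N g) (L M x d) = L N (mor g x) d"
proof -
  have N: "N \<in> Obj A" using Hom_target[OF g] shift_Obj_iff by auto
  from x show ?thesis
  proof (induction x rule: M.graded_induct)
    case (homogeneous i x)
    have gx: "mor g x \<in> deg N (i + j)" using Hom_deg[OF g homogeneous] by simp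
    have lN: "mor (lam k N y) r = ract N y r" if "r \<in> carrier R" for k y r
      using that by (simp add: lam_def)
    have l: "lam (i + j) N (mor g x) \<in> Hom A Rm (shift (i + j) N)"
      by (rule shift_setting.lam_Hom[OF shift_setting_axioms N gx])
    have sg: "sa i g \<in> Hom A (shift i M) (shift (i + j) N)" using shift_arr_Hom[OF g, of i] by simp
    have "lam (i + j) N (mor g x) = sa i g \<bullet> lam i M x"
    proof (rule Hom_eqI[OF l GrMod_Comp_Hom[OF lam_Hom[OF homogeneous] sg]])
      fix r assume "r \<in> carrier Rm"
      then show "mor (lam (i + j) N (mor g x)) r = mor (sa i g \<bullet> lam i M x) r"
        using homogeneous Hom_ract[OF g] lN
        by (simp add: mor_Comp[OF lam_Hom[OF homogeneous]] lam_mor M.deg_closed)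
    qed
    then have "mor (Chat (i + j) N (lam (i + j) N (mor g x))) d = mor (Chat j N g) (L M x d)"
      using hat_comp[OF lam_Hom[OF homogeneous] g d] L_homogeneous[OF d homogeneous] by simp
    moreover have "L N (mor g x) d = mor (Chat (i + j) N (lam (i + j) N (mor g x))) d"
      by (rule shift_setting.L_homogeneous[OF shift_setting_axioms N d gx])
    ultimately show ?case by simp
  next
    case (mult x y)
    have "mor (Chat j N g) (L M (x \<otimes>\<^bsub>M\<^esub> y) d) =
        mor (Chat j N g) (L M x d) \<otimes>\<^bsub>C0 N\<^esub> mor (Chat j N g) (L M y d)"
      using mult d by (simp add: L_mult_left hat_mult[OF g] L_closed)
    also have "\<dots> = L N (mor g x \<otimes>\<^bsub>N\<^esub> mor g y) d"
      using mult d Hom_closed[OF g]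
        shift_setting.L_mult_left[OF shift_setting_axioms N, of "mor g x" "mor g y" d] by simp
    finally show ?case using mult Hom_mult[OF g] by simp
  qed
qed

end

lemma L_C: "f \<in> Hom A M N \<Longrightarrow> x \<in> carrier M \<Longrightarrow> d \<in> carrier D0 \<Longrightarrow>
    mor (CC f) (L M x d) = L N (mor f x) d"
  using L_natural[of M f 0 N x d] Hom_source[of f U R M N] by (simp add: hat_0)

lemma L_one: "d \<in> carrier D0 \<Longrightarrow> L Rm \<one>\<^bsub>R\<^esub> d = d"
proof -
  assume d: "d \<in> carrier D0"
  have "lam 0 Rm \<one>\<^bsub>R\<^esub> = Id A Rm"
    unfolding lam_def GrMod_Id by (auto intro!: restrict_ext)
  moreover have "L Rm \<one>\<^bsub>R\<^esub> d = mor (Chat 0 Rm (lam 0 Rm \<one>\<^bsub>R\<^esub>)) d"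
    by (rule L_homogeneous[OF reg_Obj d]) (simp add: R.degree_one)
  ultimately show ?thesis
    using d comult.F.farr_Id[OF reg_Obj] by (simp add: hat_0[OF GrMod_Id_Hom[OF reg_Obj]] mor_Id)
qed

text \<open>Naturality of \<open>L\<close> along left multiplication by \<open>x\<close>, itself an
  arrow of degree \<open>i\<close> out of R.\<close>

lemma L_balanced:
  assumes M: "M \<in> Obj A" and x: "x \<in> carrier M" and r: "r \<in> carrier R" and d: "d \<in> carrier D0"
  shows "L M (ract M x r) d = L M x (L Rm r d)"
proof -
  interpret M: graded_module R M using M by (simp add: GrMod_Obj)
  have rd: "L Rm r d \<in> carrier D0" using L_closed[OF reg_Obj] r d by simp
  from x show ?thesis
  proof (induction x rule: M.graded_induct)
    case (homogeneous i x)
    have "L M (mor (lam i M x) r) d = mor (Chat i M (lam i M x)) (L Rm r d)"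
      using L_natural[OF reg_Obj lam_Hom[OF M homogeneous], of r d] r d by simp
    then show ?case
      using r L_homogeneous[OF M rd homogeneous] by (simp add: lam_mor[OF M])
  next
    case (mult x y)
    then show ?case using r d rd by (simp add: M.ract_add_left L_mult_left[OF M] M.ract_closed)
  qed
qed

text \<open>Naturality of the counit along left multiplication by \<open>x\<close>, extended
  additively to inhomogeneous \<open>x\<close>.\<close>

lemma L_counit:
  assumes M: "M \<in> Obj A" and x: "x \<in> carrier M" and d: "d \<in> carrier D0"
  shows "mor (counit C M) (L M x d) = ract M x (mor (counit C Rm) d)"
proof -
  interpret M: graded_module R M using M by (simp add: GrMod_Obj)
  have e: "mor (counit C Rm) d \<in> carrier R"
    using Hom_closed[OF Cd.counit_Hom[OF reg_Obj] d] by simp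
  from x show ?thesis
  proof (induction x rule: M.graded_induct)
    case (homogeneous i x)
    then show ?case
      using hat_counit[OF lam_Hom[OF M homogeneous] d] e
      by (simp add: L_homogeneous[OF M d homogeneous] lam_mor[OF M])
  next
    case (mult x y)
    then show ?case
      using d e Hom_mult[OF Cd.counit_Hom[OF M]]
      by (simp add: L_mult_left[OF M] L_closed[OF M] M.ract_add_left)
  qed
qed

abbreviation "Db \<equiv> value_bimod U R C \<sigma>"

lemma Db_rmod [simp]: "rmod Db = D0"
  by (simp add: value_bimod_def)

lemma hcomponent_eq: "hcomponent R r = gcomp Rm (deg Rm) r"
proof -
  have "is_decomposition (add_monoid R) (rdeg R) r = is_decomposition Rm (rdeg R) r"
    by (intro ext) (simp add: same_decomposition[of Rm "add_monoid R"])
  then show ?thesis by (simp add: hcomponent_def gcomp_def)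
qed

text \<open>The component of degree \<open>i\<close> of left multiplication by \<open>r\<close> is
  the arrow of the component of \<open>r\<close>. Hence the action coming from the enrichment is
  \<open>L\<close> at the regular module.\<close>

lemma Db_lact:
  assumes r: "r \<in> carrier R" and d: "d \<in> carrier D0"
  shows "lact Db r d = L Rm r d"
proof -
  let ?h = "\<lambda>i. mor (Chat i Rm (lam i Rm (gcomp Rm (deg Rm) r i))) d"
  have l: "left_mult R r i = lam i Rm (gcomp Rm (deg Rm) r i)" for i
    by (simp add: left_mult_def lam_def hcomponent_eq)
  have "lact Db r d = finprod D0 ?h {i. ?h i \<noteq> \<one>\<^bsub>D0\<^esub>}"
    by (simp add: value_bimod_def evaluate_def enriched_map_def l Chat_def)
  also have "\<dots> = L Rm r d"
    using L_finite[OF reg_Obj d, of r] r by (simp add: L_def gext_def gfinprod_def)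
  finally show ?thesis .
qed

text \<open>The bimodule laws are properties of \<open>L\<close> at M = R: associativity of the left
  action is \<open>L_balanced\<close>, and commutation with the right action is
  \<open>L_ract\<close>.\<close>

lemma Db_bimod: "bimod Db"
proof -
  interpret D0: graded_module R D0 using D0_Obj by (simp add: GrMod_Obj)
  note facts = L_closed[OF reg_Obj, simplified] L_mult_left[OF reg_Obj, simplified]
    L_mult_right[OF reg_Obj, simplified] L_ract[OF reg_Obj, simplified] L_balanced[OF reg_Obj, simplified]
  have "graded_bimodule R Db"
    by (intro graded_bimodule.intro graded_bimodule_axioms.intro)
      (simp_all add: Db_lact facts D0.graded_module_axioms D0.ract_closed L_one D0.deg_closed R.rdeg_closed
        L_deg[OF reg_Obj, simplified])
  then show ?thesis using D0_Obj by (simp add: bimod_def GrMod_Obj)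
qed

end

section \<open>The comparison isomorphism\<close>

context graded_setting
begin

lemma small_superset_int:
  assumes "M \<in> Obj A"
  obtains Z where "Z \<in> U" "infinite Z" "carrier M \<subseteq> Z" "carrier R \<subseteq> Z" "(UNIV :: int set) \<lesssim> Z"
proof -
  have "carrier M \<in> U" using assms by simp
  then obtain Z where Z: "Z \<in> U" "infinite Z" "carrier M \<union> carrier R \<subseteq> Z"
    using small_infinite_superset[OF small_Un[OF _ R_small]] by blast
  have "(UNIV :: int set) \<lesssim> (UNIV :: nat set)"
    unfolding lepoll_def using inj_to_nat by blast
  also have "(UNIV :: nat set) \<lesssim> Z" using Z(2) by (simp add: infinite_le_lepoll)
  finally show ?thesis using Z that by blast
qed

end

section \<open>Presentations of graded modules and their images\<close>

context shift_setting
begin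

text \<open>Every graded module \<open>M\<close> is a colimit of copies of \<open>(R \<oplus> R)(-i)\<close>, one for each pair \<open>x, y\<close> in
  \<open>M\<^sub>i\<close>, mapped to \<open>M\<close> by \<open>(a, b) \<mapsto> x a + y b\<close>; the relations identify \<open>(a, b)\<close> at \<open>(x, y)\<close> with
  \<open>(1, 0)\<close> at \<open>(x a + y b, 0)\<close>.  Single generators would not suffice, since a compatible family of
  maps on them need not be additive.\<close>

definition gens :: "'u gmod \<Rightarrow> (int \<times> 'u \<times> 'u) set" where
  "gens M = {(i, x, y). x \<in> deg M i \<and> y \<in> deg M i}"

definition rels :: "'u gmod \<Rightarrow> (int \<times> 'u \<times> 'u \<times> int \<times> 'u \<times> 'u) set" where
  "rels M = {(i, x, y, j, a, b). x \<in> deg M i \<and> y \<in> deg M i \<and> a \<in> rdeg R j \<and> b \<in> rdeg R j}"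

definition gen_obj :: "int \<times> 'u \<times> 'u \<Rightarrow> 'u gmod" where
  "gen_obj = (\<lambda>(i, x, y). shift (- i) Pm)"

definition rel_obj :: "int \<times> 'u \<times> 'u \<times> int \<times> 'u \<times> 'u \<Rightarrow> 'u gmod" where
  "rel_obj = (\<lambda>(i, x, y, j, a, b). shift (- i - j) Rm)"

definition rel_s :: "int \<times> 'u \<times> 'u \<times> int \<times> 'u \<times> 'u \<Rightarrow> int \<times> 'u \<times> 'u" where
  "rel_s = (\<lambda>(i, x, y, j, a, b). (i, x, y))"

definition rel_t :: "'u gmod \<Rightarrow> int \<times> 'u \<times> 'u \<times> int \<times> 'u \<times> 'u \<Rightarrow> int \<times> 'u \<times> 'u" where
  "rel_t M = (\<lambda>(i, x, y, j, a, b). (i + j, ract M x a \<otimes>\<^bsub>M\<^esub> ract M y b, \<one>\<^bsub>M\<^esub>))"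

text \<open>Sends 1 to \<open>upair (a, b)\<close> while \<open>rel_g\<close> sends 1 to (1, 0). The
  shift by \<open>- i - j\<close> makes the first land in the object of the generator of degree
  \<open>i\<close> and the second in that of degree \<open>i + j\<close>.\<close>

definition rel_f :: "int \<times> 'u \<times> 'u \<times> int \<times> 'u \<times> 'u \<Rightarrow> 'u garrow" where
  "rel_f = (\<lambda>(i, x, y, j, a, b). sa (- i - j) (lam j Pm (upair (a, b))))"

definition rel_g :: "int \<times> 'u \<times> 'u \<times> int \<times> 'u \<times> 'u \<Rightarrow> 'u garrow" where
  "rel_g = (\<lambda>(i, x, y, j, a, b). sa (- i - j) in1)"

definition gen_arr :: "'u gmod \<Rightarrow> int \<times> 'u \<times> 'u \<Rightarrow> 'u garrow" where
  "gen_arr M = (\<lambda>(i, x, y). copair (- i) M (sa (- i) (lam i M x)) (sa (- i) (lam i M y)))"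

lemmas rel_defs = gens_def rels_def gen_obj_def rel_obj_def rel_s_def rel_t_def rel_f_def rel_g_def gen_arr_def

context
  fixes M
  assumes M: "M \<in> Obj A"
begin

interpretation M: graded_module R M using M by (simp add: GrMod_Obj)
interpretation CM: graded_module R "C0 M" using C0_Obj[OF M] by (simp add: GrMod_Obj)
interpretation D0: graded_module R D0 using D0_Obj by (simp add: GrMod_Obj)

lemma rel_st: "k \<in> rels M \<Longrightarrow> rel_s k \<in> gens M \<and> rel_t M k \<in> gens M"
  by (auto simp: rel_defs M.deg_mult M.degree_ract M.deg_one)

lemma gen_obj_Obj: "gen_obj i \<in> Obj A"
  by (simp add: gen_obj_def pair_mod_Obj split: prod.splits)

lemma rel_obj_Obj: "rel_obj k \<in> Obj A"
  by (simp add: rel_obj_def reg_Obj split: prod.splits)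

lemma rel_f_Hom: "k \<in> rels M \<Longrightarrow> rel_f k \<in> Hom A (rel_obj k) (gen_obj (rel_s k))"
proof -
  assume "k \<in> rels M"
  then obtain i x y j a b where k: "k = (i, x, y, j, a, b)" and ab: "a \<in> rdeg R j" "b \<in> rdeg R j"
    by (auto simp: rels_def)
  have "lam j Pm (upair (a, b)) \<in> Hom A Rm (shift j Pm)"
    by (rule lam_Hom[OF pair_mod_Obj]) (use ab in auto)
  from shift_arr_Hom[OF this, of "- i - j"] show ?thesis by (simp add: k rel_defs)
qed

lemma rel_g_Hom: "k \<in> rels M \<Longrightarrow> rel_g k \<in> Hom A (rel_obj k) (gen_obj (rel_t M k))"
  using shift_arr_Hom[OF in1_Hom] by (auto simp: rel_defs)

lemma sa_lam_Hom: "x \<in> deg M i \<Longrightarrow> sa (- i) (lam i M x) \<in> Hom A (shift (- i) Rm) M"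
  using shift_arr_Hom[OF lam_Hom[OF M], of x i "- i"] by simp

lemma gen_arr_Hom: "k \<in> gens M \<Longrightarrow> gen_arr M k \<in> Hom A (gen_obj k) M"
  by (auto simp: rel_defs intro!: copair_Hom sa_lam_Hom)

lemma gen_arr_mor: "x \<in> deg M i \<Longrightarrow> y \<in> deg M i \<Longrightarrow> a \<in> carrier R \<Longrightarrow> b \<in> carrier R \<Longrightarrow>
    mor (gen_arr M (i, x, y)) (upair (a, b)) = ract M x a \<otimes>\<^bsub>M\<^esub> ract M y b"
  by (simp add: gen_arr_def copair_mor[OF sa_lam_Hom sa_lam_Hom] lam_mor[OF M])

text \<open>The mediating map is read off homogeneous elements; the relations make it additive and
  linear, and the direct sum extends it to all of M.\<close>

lemma presentation_universal:
  assumes Y: "is_copres_cocone A (gens M) (rels M) gen_obj rel_s (rel_t M) rel_f rel_g Y d"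
  shows "\<exists>!h. h \<in> Hom A M Y \<and> (\<forall>k\<in>gens M. h \<bullet> gen_arr M k = d k)"
proof -
  have YO: "Y \<in> Obj A" using Y by (simp add: is_copres_cocone_def)
  interpret Y: graded_module R Y using YO by (simp add: GrMod_Obj)
  have d: "d (i, x, y) \<in> Hom A (shift (- i) Pm) Y" if "x \<in> deg M i" "y \<in> deg M i" for i x y
    using Y that by (auto simp: is_copres_cocone_def rel_defs)
  \<comment> \<open>The value at \<open>x\<close> is forced, since \<open>x\<close> is the image of
    (1, 0) under the generator indexed by \<open>x\<close> and the neutral element.\<close>
  define h0 where "h0 = (\<lambda>i x. mor (d (i, x, \<one>\<^bsub>M\<^esub>)) (upair (\<one>\<^bsub>R\<^esub>, \<zero>\<^bsub>R\<^esub>)))"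
  have key: "mor (d (i, x, y)) (upair (a, b)) = h0 (i + j) (ract M x a \<otimes>\<^bsub>M\<^esub> ract M y b)"
    if xy: "x \<in> deg M i" "y \<in> deg M i" and ab: "a \<in> rdeg R j" "b \<in> rdeg R j" for i x y j a b
  proof -
    let ?k = "(i, x, y, j, a, b)"
    have k: "?k \<in> rels M" using that by (simp add: rels_def)
    then have "d (rel_s ?k) \<bullet> rel_f ?k = d (rel_t M ?k) \<bullet> rel_g ?k"
      using Y by (simp add: is_copres_cocone_def)
    then have "mor (d (rel_s ?k)) (mor (rel_f ?k) \<one>\<^bsub>R\<^esub>) = mor (d (rel_t M ?k)) (mor (rel_g ?k) \<one>\<^bsub>R\<^esub>)"
      using mor_Comp[OF rel_f_Hom[OF k], of "\<one>\<^bsub>R\<^esub>" "d (rel_s ?k)"]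
        mor_Comp[OF rel_g_Hom[OF k], of "\<one>\<^bsub>R\<^esub>" "d (rel_t M ?k)"] by (simp add: rel_obj_def)
    then show ?thesis
      using ab by (simp add: rel_defs h0_def lam_def R.rdeg_closed)
  qed
  have ract_zero: "ract M y \<zero>\<^bsub>R\<^esub> = \<one>\<^bsub>M\<^esub>" if "y \<in> carrier M" for y
    using M.ract_add_right[OF that, of "\<zero>\<^bsub>R\<^esub>" "\<zero>\<^bsub>R\<^esub>"] M.ract_closed[OF that, of "\<zero>\<^bsub>R\<^esub>"] by simp
  have h0_closed: "h0 i x \<in> deg Y i" if x: "x \<in> deg M i" for i x
    unfolding h0_def
    using Hom_deg[OF d[OF x M.deg_one], of "upair (\<one>\<^bsub>R\<^esub>, \<zero>\<^bsub>R\<^esub>)" i] R.degree_one rdeg_zero by simp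
  \<comment> \<open>The instance \<open>a = b = 1\<close> in degree 0. It is for this step that
    generators come in pairs.\<close>
  have h0_mult: "h0 i (x \<otimes>\<^bsub>M\<^esub> y) = h0 i x \<otimes>\<^bsub>Y\<^esub> h0 i y" if xy: "x \<in> deg M i" "y \<in> deg M i" for i x y
  proof -
    note dxy = d[OF xy]
    have "h0 (i + 0) (ract M x \<one>\<^bsub>R\<^esub> \<otimes>\<^bsub>M\<^esub> ract M y \<one>\<^bsub>R\<^esub>) = mor (d (i, x, y)) (upair (\<one>\<^bsub>R\<^esub>, \<one>\<^bsub>R\<^esub>))"
      by (rule key[OF xy R.degree_one R.degree_one, symmetric])
    also have "\<dots> = mor (d (i, x, y)) (upair (\<one>\<^bsub>R\<^esub>, \<zero>\<^bsub>R\<^esub>)) \<otimes>\<^bsub>Y\<^esub> mor (d (i, x, y)) (upair (\<zero>\<^bsub>R\<^esub>, \<one>\<^bsub>R\<^esub>))"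
      using Hom_mult[OF dxy, of "upair (\<one>\<^bsub>R\<^esub>, \<zero>\<^bsub>R\<^esub>)" "upair (\<zero>\<^bsub>R\<^esub>, \<one>\<^bsub>R\<^esub>)"] by simp
    also have "\<dots> = h0 i x \<otimes>\<^bsub>Y\<^esub> h0 i y"
      using key[OF xy R.degree_one rdeg_zero] key[OF xy rdeg_zero R.degree_one] xy
      by (simp add: ract_zero M.deg_closed M.ract_one)
    finally show ?thesis using xy by (simp add: M.ract_one M.deg_closed)
  qed
  have h0_ract: "h0 (i + j) (ract M x r) = ract Y (h0 i x) r" if x: "x \<in> deg M i" and r: "r \<in> rdeg R j"
    for i j x r
  proof -
    have rc: "r \<in> carrier R" using r by (rule R.rdeg_closed)
    have "h0 (i + j) (ract M x r \<otimes>\<^bsub>M\<^esub> ract M \<one>\<^bsub>M\<^esub> \<zero>\<^bsub>R\<^esub>) = mor (d (i, x, \<one>\<^bsub>M\<^esub>)) (upair (r, \<zero>\<^bsub>R\<^esub>))"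
      by (rule key[OF x M.deg_one r rdeg_zero, symmetric])
    also have "\<dots> = ract Y (h0 i x) r"
      unfolding h0_def
      using Hom_ract[OF d[OF x M.deg_one], of "upair (\<one>\<^bsub>R\<^esub>, \<zero>\<^bsub>R\<^esub>)" r] rc by simp
    finally show ?thesis using x rc by (simp add: ract_zero M.ract_closed M.deg_closed)
  qed
  define h where "h = Arrow M Y (restrict (gext M (deg M) Y h0) (carrier M))"
  note h0_ext = M.gext_hom[OF Y.comm_group_axioms, of h0] M.gext_homogeneous[OF Y.comm_group_axioms, of h0]
  have gh: "gext M (deg M) Y h0 \<in> hom M Y"
    by (rule h0_ext(1)) (use h0_closed Y.deg_closed h0_mult in auto)
  have g0: "gext M (deg M) Y h0 x = h0 i x" if "x \<in> deg M i" for x i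
    by (rule h0_ext(2)) (use that h0_closed Y.deg_closed h0_mult in auto)
  have hH: "h \<in> Hom A M Y"
    unfolding h_def
  proof (rule restrict_Hom[OF M YO is_graded_mapI[OF M.graded_module_axioms Y.graded_module_axioms gh]])
    show "gext M (deg M) Y h0 (ract M x r) = ract Y (gext M (deg M) Y h0 x) r"
      if "x \<in> deg M i" "r \<in> rdeg R j" for i j x r
      using that by (simp add: g0 g0[OF M.degree_ract] h0_ract)
    show "gext M (deg M) Y h0 x \<in> deg Y i" if "x \<in> deg M i" for x i
      using that by (simp add: g0 h0_closed)
  qed
  have h0m: "mor h x = h0 i x" if "x \<in> deg M i" for x i
    using that by (simp add: h_def g0 M.deg_closed)
  show ?thesis
  proof (rule ex1I[of _ h], intro conjI hH ballI)
    fix k assume k: "k \<in> gens M"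
    then obtain i x y where k_eq: "k = (i, x, y)" and xy: "x \<in> deg M i" "y \<in> deg M i"
      by (auto simp: gens_def)
    have ga: "gen_arr M k \<in> Hom A (shift (- i) Pm) M" using gen_arr_Hom[OF k] by (simp add: gen_obj_def k_eq)
    have dk: "d k \<in> Hom A (shift (- i) Pm) Y" using d[OF xy] by (simp add: k_eq)
    interpret P: graded_module R "shift (- i) Pm" using Hom_source[OF ga] by (simp add: GrMod_Obj)
    show "h \<bullet> gen_arr M k = d k"
    proof (rule Hom_eqI[OF GrMod_Comp_Hom[OF ga hH] dk])
      fix u assume u: "u \<in> carrier (shift (- i) Pm)"
      show "mor (h \<bullet> gen_arr M k) u = mor (d k) u"
      proof (rule P.hom_eqI_homogeneous[OF Y.is_group Hom_hom[OF GrMod_Comp_Hom[OF ga hH]] Hom_hom[OF dk] _ u])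
        \<comment> \<open>In \<open>shift (- i) Pm\<close> degree \<open>n\<close> means entries of
          degree \<open>n - i\<close>, so \<open>key\<close> applies with
          \<open>j = n - i\<close>.\<close>
        fix n u assume u: "u \<in> deg (shift (- i) Pm) n"
        then obtain a b where ab: "u = upair (a, b)" "a \<in> rdeg R (n - i)" "b \<in> rdeg R (n - i)" by auto
        have "mor (h \<bullet> gen_arr M k) u = mor h (ract M x a \<otimes>\<^bsub>M\<^esub> ract M y b)"
          using mor_Comp[OF ga P.deg_closed[OF u], of h] ab xy
          by (simp add: k_eq gen_arr_mor R.rdeg_closed)
        also have "\<dots> = h0 (i + (n - i)) (ract M x a \<otimes>\<^bsub>M\<^esub> ract M y b)"
          using ab xy by (intro h0m M.deg_mult M.degree_ract)
        also have "\<dots> = mor (d k) u"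
          using key[OF xy ab(2,3)] by (simp add: k_eq ab(1))
        finally show "mor (h \<bullet> gen_arr M k) u = mor (d k) u" .
      qed
    qed
  next
    fix h' assume h': "h' \<in> Hom A M Y \<and> (\<forall>k\<in>gens M. h' \<bullet> gen_arr M k = d k)"
    show "h' = h"
    proof (rule Hom_eqI[OF conjunct1[OF h'] hH])
      fix x assume "x \<in> carrier M"
      then show "mor h' x = mor h x"
      proof (rule M.hom_eqI_homogeneous[OF Y.is_group Hom_hom[OF conjunct1[OF h']] Hom_hom[OF hH], rotated])
        fix i x assume x: "x \<in> deg M i"
        have k: "(i, x, \<one>\<^bsub>M\<^esub>) \<in> gens M" using x M.deg_one by (simp add: gens_def)
        then have ga: "gen_arr M (i, x, \<one>\<^bsub>M\<^esub>) \<in> Hom A (shift (- i) Pm) M"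
          using gen_arr_Hom by (fastforce simp: gen_obj_def)
        \<comment> \<open>Uniqueness: \<open>x\<close> is reached from (1, 0), where every solution
          takes the value prescribed by the cocone.\<close>
        have "mor h' x = mor (h' \<bullet> gen_arr M (i, x, \<one>\<^bsub>M\<^esub>)) (upair (\<one>\<^bsub>R\<^esub>, \<zero>\<^bsub>R\<^esub>))"
          using x gen_arr_mor[OF x M.deg_one, of "\<one>\<^bsub>R\<^esub>" "\<zero>\<^bsub>R\<^esub>"]
          by (simp add: mor_Comp[OF ga] ract_zero M.deg_closed M.ract_one)
        also have "\<dots> = h0 i x" using h' k by (simp add: h0_def)
        finally show "mor h' x = mor h x" by (simp add: h0m[OF x])
      qed
    qed
  qed
qed

text \<open>The cocone condition is distributivity and associativity of the right action:
  \<open>x (a r) + y (b r) = (x a + y b) r\<close>.\<close>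

lemma module_presentation:
  "is_presentation A (gens M) (rels M) gen_obj rel_s (rel_t M) rel_f rel_g M (gen_arr M)"
  unfolding is_presentation_def
proof (intro conjI allI impI presentation_universal)
  show "is_copres_cocone A (gens M) (rels M) gen_obj rel_s (rel_t M) rel_f rel_g M (gen_arr M)"
    unfolding is_copres_cocone_def
  proof (intro conjI ballI M gen_arr_Hom)
    fix k assume k: "k \<in> rels M"
    note st = rel_st[OF k]
    note fH = rel_f_Hom[OF k] and gH = rel_g_Hom[OF k]
    note sH = gen_arr_Hom[OF conjunct1[OF st]] and tH = gen_arr_Hom[OF conjunct2[OF st]]
    show "gen_arr M (rel_s k) \<bullet> rel_f k = gen_arr M (rel_t M k) \<bullet> rel_g k"
    proof (rule Hom_eqI[OF GrMod_Comp_Hom[OF fH sH] GrMod_Comp_Hom[OF gH tH]])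
      fix r assume r: "r \<in> carrier (rel_obj k)"
      obtain i x y j a b where k_eq: "k = (i, x, y, j, a, b)" and h: "x \<in> deg M i" "y \<in> deg M i"
        "a \<in> rdeg R j" "b \<in> rdeg R j" using k by (auto simp: rels_def)
      have rc: "r \<in> carrier R" using r by (simp add: rel_obj_def k_eq)
      have z: "ract M x a \<otimes>\<^bsub>M\<^esub> ract M y b \<in> deg M (i + j)" using h by (intro M.deg_mult M.degree_ract)
      have "mor (gen_arr M (rel_s k) \<bullet> rel_f k) r = ract M x (a \<otimes>\<^bsub>R\<^esub> r) \<otimes>\<^bsub>M\<^esub> ract M y (b \<otimes>\<^bsub>R\<^esub> r)"
        using r rc h by (simp add: mor_Comp[OF fH]) (simp add: k_eq rel_s_def rel_f_def lam_def gen_arr_mor R.rdeg_closed)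
      moreover have "mor (gen_arr M (rel_t M k) \<bullet> rel_g k) r =
          ract M (ract M x a \<otimes>\<^bsub>M\<^esub> ract M y b) r \<otimes>\<^bsub>M\<^esub> ract M \<one>\<^bsub>M\<^esub> \<zero>\<^bsub>R\<^esub>"
        using r rc by (simp add: mor_Comp[OF gH]) (simp add: k_eq rel_t_def rel_g_def gen_arr_mor[OF z M.deg_one])
      ultimately show "mor (gen_arr M (rel_s k) \<bullet> rel_f k) r = mor (gen_arr M (rel_t M k) \<bullet> rel_g k) r"
        using h rc by (simp add: M.ract_one_left M.ract_add_left M.ract_mult M.ract_closed M.deg_closed R.rdeg_closed)
    qed
  qed
qed

text \<open>Generators and relations are tuples over the integers, M and R, so they inject into one
  small infinite set and the diagram is small.\<close>

lemma C_module_presentation: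
  "is_presentation A (gens M) (rels M) (\<lambda>i. C0 (gen_obj i)) rel_s (rel_t M) (\<lambda>k. CC (rel_f k))
     (\<lambda>k. CC (rel_g k)) (C0 M) (\<lambda>i. CC (gen_arr M i))"
proof -
  obtain Z where Z: "Z \<in> U" "infinite Z" "carrier M \<subseteq> Z" "carrier R \<subseteq> Z" and int: "(UNIV :: int set) \<lesssim> Z"
    using small_superset_int[OF M] by blast
  note times = times_lepoll_infinite[OF Z(2)]
  have MZ: "carrier M \<lesssim> Z" and RZ: "carrier R \<lesssim> Z" using Z by (simp_all add: subset_imp_lepoll)
  have "gens M \<subseteq> UNIV \<times> carrier M \<times> carrier M" by (auto simp: gens_def M.deg_closed)
  from lepoll_trans[OF subset_imp_lepoll[OF this]] have 1: "gens M \<lesssim> Z"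
    using times[OF int times[OF MZ MZ]] by blast
  have "rels M \<subseteq> UNIV \<times> carrier M \<times> carrier M \<times> UNIV \<times> carrier R \<times> carrier R"
    by (auto simp: rels_def M.deg_closed R.rdeg_closed)
  from lepoll_trans[OF subset_imp_lepoll[OF this]] have 2: "rels M \<lesssim> Z"
    using times[OF int times[OF MZ times[OF MZ times[OF int times[OF RZ RZ]]]]] by blast
  show ?thesis
    by (rule C_preserves[OF 1 2 Z(1,2) rel_st gen_obj_Obj rel_obj_Obj rel_f_Hom rel_g_Hom module_presentation])
qed

section \<open>The comparison map and its inverse\<close>

definition phi :: "'u garrow" where
  "phi = Arrow (M \<boxtimes> Db) (C0 M) (tensor_lift U R M Db (C0 M) (L M))"

lemma phi_bal: "balanced R M Db (C0 M) (L M)"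
  by (rule balancedI)
    (simp_all add: L_closed[OF M] L_mult_left[OF M] L_mult_right[OF M] L_balanced[OF M] Db_lact)

lemma phi_Hom: "phi \<in> Hom A (M \<boxtimes> Db) (C0 M)"
  unfolding phi_def
  by (rule lift_Hom[OF M Db_bimod C0_Obj[OF M] phi_bal]) (simp_all add: L_ract[OF M] L_deg[OF M])

lemma phi_pu: "x \<in> carrier M \<Longrightarrow> d \<in> carrier D0 \<Longrightarrow> mor phi (pu M Db x d) = L M x d"
  unfolding phi_def
  using lift_pu[OF M Db_bimod Obj_comm_group[OF C0_Obj[OF M]] phi_bal] by simp

text \<open>Tensoring with \<open>x\<close> raises degrees by \<open>i\<close>; the shift of the
  source by \<open>- i\<close> turns it into a degree-preserving arrow.\<close>

definition pu_arr :: "int \<Rightarrow> 'u \<Rightarrow> 'u garrow" where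
  "pu_arr i x = Arrow (shift (- i) D0) (M \<boxtimes> Db) (\<lambda>d\<in>carrier D0. pu M Db x d)"

lemma pu_arr_Hom: "x \<in> deg M i \<Longrightarrow> pu_arr i x \<in> Hom A (shift (- i) D0) (M \<boxtimes> Db)"
proof -
  assume x: "x \<in> deg M i"
  then have xc: "x \<in> carrier M" by (rule M.deg_closed)
  have "pu M Db x d \<in> deg (M \<boxtimes> Db) n" if "d \<in> deg D0 (n - i)" for d n
    using pu_deg[OF M Db_bimod x, of d "n - i"] that by simp
  then have "is_graded_map R (shift (- i) D0) (M \<boxtimes> Db) (pu M Db x)"
    using xc pu_closed[OF M Db_bimod xc] pu_mult_right[OF M Db_bimod xc] pu_ract[OF M Db_bimod xc]
    by (auto simp: is_graded_map_def hom_def)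
  from restrict_Hom[OF shift_Obj[OF D0_Obj] tns_Obj[OF M Db_bimod] this] show ?thesis
    by (simp add: pu_arr_def)
qed

lemma pu_arr_mor: "d \<in> carrier D0 \<Longrightarrow> mor (pu_arr i x) d = pu M Db x d"
  by (simp add: pu_arr_def)

abbreviation "pr1 i \<equiv> Chat (- i) Rm (sa (- i) pj1)"
abbreviation "pr2 i \<equiv> Chat (- i) Rm (sa (- i) pj2)"

lemma sa_pj: "sa k pj1 \<in> Hom A (shift k Pm) (shift k Rm)" "sa k pj2 \<in> Hom A (shift k Pm) (shift k Rm)"
  by (rule shift_arr_Hom pj1_Hom pj2_Hom)+

text \<open>The inverse on a generator: with \<open>d\<close> and \<open>e\<close> the two
  projections of an element to C(R), the value is
  \<open>x \<otimes> d + y \<otimes> e\<close>.\<close>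

definition psi_gen :: "int \<times> 'u \<times> 'u \<Rightarrow> 'u garrow" where
  "psi_gen = (\<lambda>(i, x, y). add_arr (pu_arr i x \<bullet> pr1 i) (pu_arr i y \<bullet> pr2 i))"

lemma psi_gen:
  assumes x: "x \<in> deg M i" and y: "y \<in> deg M i"
  shows psi_gen_Hom: "psi_gen (i, x, y) \<in> Hom A (C0 (shift (- i) Pm)) (M \<boxtimes> Db)"
    and psi_gen_mor: "c \<in> carrier (C0 (shift (- i) Pm)) \<Longrightarrow>
      mor (psi_gen (i, x, y)) c = pu M Db x (mor (pr1 i) c) \<otimes>\<^bsub>M \<boxtimes> Db\<^esub> pu M Db y (mor (pr2 i) c)"
proof -
  note p1 = Chat_Hom[OF sa_pj(1)[of "- i"]] and p2 = Chat_Hom[OF sa_pj(2)[of "- i"]]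
  note h = GrMod_Comp_Hom[OF p1 pu_arr_Hom[OF x]] GrMod_Comp_Hom[OF p2 pu_arr_Hom[OF y]]
  show "psi_gen (i, x, y) \<in> Hom A (C0 (shift (- i) Pm)) (M \<boxtimes> Db)"
    unfolding psi_gen_def using add_arr_Hom[OF h] by simp
  show "c \<in> carrier (C0 (shift (- i) Pm)) \<Longrightarrow>
      mor (psi_gen (i, x, y)) c = pu M Db x (mor (pr1 i) c) \<otimes>\<^bsub>M \<boxtimes> Db\<^esub> pu M Db y (mor (pr2 i) c)"
    using hat_closed[OF sa_pj(1)] hat_closed[OF sa_pj(2)]
    by (simp add: psi_gen_def add_arr_mor[OF h] mor_Comp[OF p1] mor_Comp[OF p2] pu_arr_mor)
qed

lemma hat_after_C:
  assumes f: "f \<in> Hom A K N" and g: "g \<in> Hom A N (shift j N')" and c: "c \<in> carrier (C0 K)"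
  shows "mor (Chat j N' g) (mor (CC f) c) = mor (Chat j N' (g \<bullet> f)) c"
  using hat_comp[of f K 0 N g j N' c] assms by (simp add: hat_0[OF f])

text \<open>Composition of enriched arrows with the identity of N(m) read as an arrow of degree
  \<open>m\<close> to N, on which the enriched functor is \<open>si m N\<close>.\<close>

lemma hat_shifted:
  assumes g: "g \<in> Hom A N (shift j K)" and N: "N \<in> Obj A" and c: "c \<in> carrier (C0 (shift m N))"
  shows "mor (Chat (m + j) K (sa m g)) c = mor (Chat j K g) (mor (si m N) c)"
proof -
  have id: "Id A (shift m N) \<in> Hom A (shift m N) (shift m N)" by (rule GrMod_Id_Hom[OF shift_Obj[OF N]])
  have "sa m g \<bullet> Id A (shift m N) = sa m g"
    using shift_arr_Hom[OF g, of m] A.Comp_Id by blast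
  then show ?thesis
    using hat_comp[OF id g c] hat_eq[OF id c] comult.F.farr_Id[OF shift_Obj[OF N]] c by (simp add: mor_Id)
qed

lemma si_Hom: "N \<in> Obj A \<Longrightarrow> si m N \<in> Hom A (C0 (shift m N)) (shift m (C0 N))"
  by (simp add: A.Hom_iff)

text \<open>With \<open>u\<close> the element of C(R) under \<open>c\<close>, the relation becomes
  \<open>x \<otimes> a u + y \<otimes> b u = (x a + y b) \<otimes> u\<close>, which is the balance
  law.\<close>

lemma psi_cocone:
  "is_copres_cocone A (gens M) (rels M) (\<lambda>i. C0 (gen_obj i)) rel_s (rel_t M) (\<lambda>k. CC (rel_f k))
     (\<lambda>k. CC (rel_g k)) (M \<boxtimes> Db) psi_gen"
  unfolding is_copres_cocone_def
proof (intro conjI ballI tns_Obj[OF M Db_bimod])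
  show "psi_gen k \<in> Hom A (C0 (gen_obj k)) (M \<boxtimes> Db)" if "k \<in> gens M" for k
    using that psi_gen_Hom by (auto simp: gens_def gen_obj_def)
  then have pH: "psi_gen k \<in> Hom A (C0 (gen_obj k)) (M \<boxtimes> Db)" if "k \<in> gens M" for k
    using that by blast
  fix k assume k: "k \<in> rels M"
  obtain i x y j a b where k_eq: "k = (i, x, y, j, a, b)" and h: "x \<in> deg M i" "y \<in> deg M i"
    "a \<in> rdeg R j" "b \<in> rdeg R j" using k by (auto simp: rels_def)
  note st = rel_st[OF k]
  note fH = rel_f_Hom[OF k] and gH = rel_g_Hom[OF k]
  let ?m = "- i - j"
  let ?z = "ract M x a \<otimes>\<^bsub>M\<^esub> ract M y b"
  have z: "?z \<in> deg M (i + j)" using h by (intro M.deg_mult M.degree_ract)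
  have fH': "rel_f k \<in> Hom A (shift ?m Rm) (shift (- i) Pm)"
    and gH': "rel_g k \<in> Hom A (shift ?m Rm) (shift (- (i + j)) Pm)"
    using fH gH by (simp_all add: k_eq rel_obj_def gen_obj_def rel_s_def rel_t_def)
  have la: "lam j Rm a \<in> Hom A Rm (shift j Rm)" "lam j Rm b \<in> Hom A Rm (shift j Rm)"
    using h by (auto intro!: lam_Hom reg_Obj)
  have pf: "sa (- i) pj1 \<bullet> rel_f k = sa ?m (lam j Rm a)" "sa (- i) pj2 \<bullet> rel_f k = sa ?m (lam j Rm b)"
    and pg: "sa (- (i + j)) pj1 \<bullet> rel_g k = Id A (shift ?m Rm)"
  proof -
    have t: "sa ?m (lam j Rm a) \<in> Hom A (shift ?m Rm) (shift (- i) Rm)"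
      "sa ?m (lam j Rm b) \<in> Hom A (shift ?m Rm) (shift (- i) Rm)"
      using shift_arr_Hom[OF la(1), of ?m] shift_arr_Hom[OF la(2), of ?m] by simp_all
    show "sa (- i) pj1 \<bullet> rel_f k = sa ?m (lam j Rm a)"
      by (rule Hom_eqI[OF GrMod_Comp_Hom[OF fH' sa_pj(1)] t(1)])
        (use h in \<open>simp add: mor_Comp[OF fH'], simp add: k_eq rel_f_def lam_def R.rdeg_closed\<close>)
    show "sa (- i) pj2 \<bullet> rel_f k = sa ?m (lam j Rm b)"
      by (rule Hom_eqI[OF GrMod_Comp_Hom[OF fH' sa_pj(2)] t(2)])
        (use h in \<open>simp add: mor_Comp[OF fH'], simp add: k_eq rel_f_def lam_def R.rdeg_closed\<close>)
    have pgH: "sa (- (i + j)) pj1 \<bullet> rel_g k \<in> Hom A (shift ?m Rm) (shift ?m Rm)"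
      using GrMod_Comp_Hom[OF gH' sa_pj(1)] by simp
    show "sa (- (i + j)) pj1 \<bullet> rel_g k = Id A (shift ?m Rm)"
      by (rule Hom_eqI[OF pgH GrMod_Id_Hom[OF shift_Obj[OF reg_Obj]]])
        (simp add: mor_Comp[OF gH'], simp add: k_eq rel_g_def mor_Id)
  qed
  show "psi_gen (rel_s k) \<bullet> CC (rel_f k) = psi_gen (rel_t M k) \<bullet> CC (rel_g k)"
  proof (rule Hom_eqI[OF GrMod_Comp_Hom[OF C_Hom[OF fH] pH] GrMod_Comp_Hom[OF C_Hom[OF gH] pH]])
    fix c assume c: "c \<in> carrier (C0 (rel_obj k))"
    then have c': "c \<in> carrier (C0 (shift ?m Rm))" by (simp add: rel_obj_def k_eq)
    define u where "u = mor (si ?m Rm) c"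
    have u: "u \<in> carrier D0" using Hom_closed[OF si_Hom[OF reg_Obj] c'] by (simp add: u_def)
    \<comment> \<open>As \<open>- i = ?m + j\<close>, the shift by \<open>?m\<close> splits off and
      leaves the action of \<open>a\<close> on \<open>u\<close>.\<close>
    have 1: "mor (pr1 i) (mor (CC (rel_f k)) c) = L Rm a u"
      using hat_after_C[OF fH' sa_pj(1) c'] hat_shifted[OF la(1) reg_Obj c'] h(3) L_homogeneous[OF reg_Obj u, of a j]
      by (simp add: pf u_def)
    have 2: "mor (pr2 i) (mor (CC (rel_f k)) c) = L Rm b u"
      using hat_after_C[OF fH' sa_pj(2) c'] hat_shifted[OF la(2) reg_Obj c'] h(4) L_homogeneous[OF reg_Obj u, of b j]
      by (simp add: pf u_def)
    have 3: "mor (pr1 (i + j)) (mor (CC (rel_g k)) c) = u"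
    proof -
      have "mor (pr1 (i + j)) (mor (CC (rel_g k)) c) = mor (Chat ?m Rm (Id A (shift ?m Rm))) c"
        using hat_after_C[OF gH' sa_pj(1) c'] by (simp add: pg[simplified])
      also have "\<dots> = u"
        using c' comult.F.farr_Id[OF shift_Obj[OF reg_Obj], of ?m]
        by (simp add: hat_eq[OF GrMod_Id_Hom[OF shift_Obj[OF reg_Obj]]] mor_Id u_def)
      finally show ?thesis .
    qed
    have fc: "mor (CC (rel_f k)) c \<in> carrier (C0 (shift (- i) Pm))"
      and gc: "mor (CC (rel_g k)) c \<in> carrier (C0 (shift (- (i + j)) Pm))"
      using Hom_closed[OF C_Hom[OF fH'] c'] Hom_closed[OF C_Hom[OF gH'] c'] by blast+
    have "mor (psi_gen (rel_s k) \<bullet> CC (rel_f k)) c = mor (psi_gen (i, x, y)) (mor (CC (rel_f k)) c)"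
      using mor_Comp[OF C_Hom[OF fH] c] by (simp add: k_eq rel_s_def)
    also have "\<dots> = pu M Db x (L Rm a u) \<otimes>\<^bsub>M \<boxtimes> Db\<^esub> pu M Db y (L Rm b u)"
      using psi_gen_mor[OF h(1,2) fc] by (simp only: 1 2)
    also have "\<dots> = pu M Db ?z u"
      using h u pu_balanced[OF M Db_bimod, of x a u] pu_balanced[OF M Db_bimod, of y b u]
        pu_mult_left[OF M Db_bimod, of "ract M x a" "ract M y b" u]
      by (simp add: Db_lact M.deg_closed R.rdeg_closed M.ract_closed)
    also have "\<dots> = pu M Db ?z u \<otimes>\<^bsub>M \<boxtimes> Db\<^esub> pu M Db \<one>\<^bsub>M\<^esub> (mor (pr2 (i + j)) (mor (CC (rel_g k)) c))"
    proof -
      interpret T: graded_module R "M \<boxtimes> Db" using tns_Obj[OF M Db_bimod] by (simp add: GrMod_Obj)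
      have "mor (pr2 (i + j)) (mor (CC (rel_g k)) c) \<in> carrier D0"
        using hat_closed[OF sa_pj(2) gc] .
      then show ?thesis
        using pu_one_left[OF M Db_bimod] pu_closed[OF M Db_bimod M.deg_closed[OF z]] u by simp
    qed
    also have "\<dots> = mor (psi_gen (i + j, ?z, \<one>\<^bsub>M\<^esub>)) (mor (CC (rel_g k)) c)"
      using psi_gen_mor[OF z M.deg_one gc] by (simp only: 3)
    also have "\<dots> = mor (psi_gen (rel_t M k) \<bullet> CC (rel_g k)) c"
      using mor_Comp[OF C_Hom[OF gH] c] by (simp add: k_eq rel_t_def)
    finally show "mor (psi_gen (rel_s k) \<bullet> CC (rel_f k)) c = mor (psi_gen (rel_t M k) \<bullet> CC (rel_g k)) c" .
  qed (use st in auto)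
qed

text \<open>\<open>psi\<close> is induced by the colimit property of C(M). That
  \<open>phi \<bullet> psi\<close> is the identity follows from uniqueness on the legs; the other
  composite is tested on homogeneous pure tensors, by exhibiting \<open>L M x d\<close> as a value
  of a leg.\<close>

lemma phi_iso: "is_iso A phi"
proof -
  note pres = C_module_presentation
  obtain psi where psi: "psi \<in> Hom A (C0 M) (M \<boxtimes> Db)" and
    psi_gen_eq: "\<And>k. k \<in> gens M \<Longrightarrow> psi \<bullet> CC (gen_arr M k) = psi_gen k"
    using pres psi_cocone unfolding is_presentation_def by blast
  have CM: "is_copres_cocone A (gens M) (rels M) (\<lambda>i. C0 (gen_obj i)) rel_s (rel_t M) (\<lambda>k. CC (rel_f k))
     (\<lambda>k. CC (rel_g k)) (C0 M) (\<lambda>i. CC (gen_arr M i))"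
    using pres by (simp add: is_presentation_def)
  have uniq: "f = g" if "f \<in> Hom A (C0 M) (C0 M)" "g \<in> Hom A (C0 M) (C0 M)"
    "\<And>k. k \<in> gens M \<Longrightarrow> f \<bullet> CC (gen_arr M k) = CC (gen_arr M k)"
    "\<And>k. k \<in> gens M \<Longrightarrow> g \<bullet> CC (gen_arr M k) = CC (gen_arr M k)" for f g
    using pres CM that unfolding is_presentation_def by blast
  have "phi \<bullet> psi = Id A (C0 M)"
  proof (rule uniq[OF GrMod_Comp_Hom[OF psi phi_Hom] GrMod_Id_Hom[OF C0_Obj[OF M]]])
    fix k assume k: "k \<in> gens M"
    then obtain i x y where k_eq: "k = (i, x, y)" and xy: "x \<in> deg M i" "y \<in> deg M i"
      by (auto simp: gens_def)
    have gH: "gen_arr M k \<in> Hom A (shift (- i) Pm) M"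
      using gen_arr_Hom[OF k] by (simp add: k_eq gen_obj_def)
    note cH = C_Hom[OF gH]
    show "Id A (C0 M) \<bullet> CC (gen_arr M k) = CC (gen_arr M k)" using A.Id_Comp[OF cH] .
    have pH: "psi_gen k \<in> Hom A (C0 (shift (- i) Pm)) (M \<boxtimes> Db)" using psi_gen_Hom[OF xy] by (simp add: k_eq)
    have "phi \<bullet> psi_gen k = CC (gen_arr M k)"
    proof (rule Hom_eqI[OF GrMod_Comp_Hom[OF pH phi_Hom] cH])
      fix c assume c: "c \<in> carrier (C0 (shift (- i) Pm))"
      note d1 = hat_closed[OF sa_pj(1) c] and d2 = hat_closed[OF sa_pj(2) c]
      have "mor (phi \<bullet> psi_gen k) c = L M x (mor (pr1 i) c) \<otimes>\<^bsub>C0 M\<^esub> L M y (mor (pr2 i) c)"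
        using mor_Comp[OF pH c, of phi] xy d1 d2
          pu_closed[OF M Db_bimod M.deg_closed[OF xy(1)]] pu_closed[OF M Db_bimod M.deg_closed[OF xy(2)]]
        by (simp add: k_eq psi_gen_mor[OF xy c] Hom_mult[OF phi_Hom] phi_pu M.deg_closed)
      \<comment> \<open>The degrees \<open>- i\<close> and \<open>i\<close> cancel, and on arrows of
        degree 0 the enriched functor is \<open>C\<close> itself.\<close>
      moreover have Lx: "L M x (mor (Chat (- i) Rm (sa (- i) p)) c) =
          mor (CC (sa (- i) (lam i M x))) (mor (CC (sa (- i) p)) c)"
        if x: "x \<in> deg M i" and p: "p \<in> Hom A Pm Rm" for x p
      proof -
        note ps = shift_arr_Hom[OF p, of "- i"]
        have lH: "lam i M x \<in> Hom A Rm (shift i M)" using x by (rule lam_Hom[OF M])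
        have "L M x (mor (Chat (- i) Rm (sa (- i) p)) c) =
            mor (Chat (- i + i) M (sa (- i) (lam i M x) \<bullet> sa (- i) p)) c"
          unfolding hat_comp[OF ps lH c] by (rule L_homogeneous[OF M hat_closed[OF ps c] x])
        also have "\<dots> = mor (CC (sa (- i) (lam i M x) \<bullet> sa (- i) p)) c"
          using hat_0[OF GrMod_Comp_Hom[OF ps sa_lam_Hom[OF x]]] by simp
        also have "\<dots> = mor (CC (sa (- i) (lam i M x))) (mor (CC (sa (- i) p)) c)"
          unfolding comult.F.farr_Comp[OF ps sa_lam_Hom[OF x]] by (rule mor_Comp[OF C_Hom[OF ps] c])
        finally show ?thesis .
      qed
      moreover have "mor (CC (gen_arr M k)) c =
          mor (CC (sa (- i) (lam i M x))) (mor (CC (sa (- i) pj1)) c) \<otimes>\<^bsub>C0 M\<^esub>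
          mor (CC (sa (- i) (lam i M y))) (mor (CC (sa (- i) pj2)) c)"
        using C_split[OF gH c] by (simp add: k_eq gen_arr_def copair_in1 copair_in2 sa_lam_Hom xy)
      ultimately show "mor (phi \<bullet> psi_gen k) c = mor (CC (gen_arr M k)) c"
        using xy pj1_Hom pj2_Hom by simp
    qed
    then show "phi \<bullet> psi \<bullet> CC (gen_arr M k) = CC (gen_arr M k)"
      using A.Comp_assoc[OF cH psi phi_Hom] psi_gen_eq[OF k] by simp
  qed
  then have right: "mor phi (mor psi y) = y" if "y \<in> carrier (C0 M)" for y
    using that by (metis mor_Comp[OF psi] mor_Id)
  have left: "mor psi (mor phi t) = t" if "t \<in> carrier (M \<boxtimes> Db)" for t
    using that
  proof (induction rule: tns_induct_homogeneous[OF M Db_bimod, consumes 1, case_names pure mult])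
    case (mult s t)
    then show ?case by (simp add: Hom_mult[OF phi_Hom] Hom_mult[OF psi] Hom_closed[OF phi_Hom])
  next
    case (pure x d i j)
    have dc: "d \<in> carrier D0" using pure(2) D0.deg_closed by simp
    have xc: "x \<in> carrier M" using pure(1) by (rule M.deg_closed)
    let ?k = "(i, x, \<one>\<^bsub>M\<^esub>)"
    have k: "?k \<in> gens M" using pure M.deg_one by (simp add: gens_def)
    have gH: "gen_arr M ?k \<in> Hom A (shift (- i) Pm) M"
      using gen_arr_Hom[OF k] by (simp add: gen_obj_def)
    have lH: "lam i M x \<in> Hom A Rm (shift i M)" by (rule lam_Hom[OF M pure(1)])
    note iH = shift_arr_Hom[OF in1_Hom, of "- i"]
    note inv = A.inverse_arr[OF si_iso[OF reg_Obj] si_Hom[OF reg_Obj], of "- i"]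
    \<comment> \<open>To reach \<open>d\<close> from a leg, it is pulled back along the shift
      isomorphism to C(R(-i)) and then included by the first injection. The first projection of the
      resulting \<open>c\<close> returns \<open>d\<close>.\<close>
    define v where "v = mor (inverse_arr A (si (- i) Rm)) d"
    have v: "v \<in> carrier (C0 (shift (- i) Rm))" using Hom_closed[OF inv(1)] dc by (simp add: v_def)
    have sv: "mor (si (- i) Rm) v = d"
      using mor_Comp[OF inv(1), of d "si (- i) Rm"] inv(3) dc by (simp add: v_def mor_Id)
    define c where "c = mor (CC (sa (- i) in1)) v"
    have c: "c \<in> carrier (C0 (shift (- i) Pm))" using Hom_closed[OF C_Hom[OF iH] v] by (simp add: c_def)
    have "gen_arr M ?k \<bullet> sa (- i) in1 = sa (- i) (lam i M x)"
      using copair_in1[OF sa_lam_Hom[OF pure(1)] sa_lam_Hom[OF M.deg_one]] by (simp add: gen_arr_def)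
    then have "mor (CC (gen_arr M ?k)) c = mor (CC (sa (- i) (lam i M x))) v"
      using comult.F.farr_Comp[OF iH gH] mor_Comp[OF C_Hom[OF iH] v] by (simp add: c_def)
    also have "\<dots> = mor (Chat (- i + i) M (sa (- i) (lam i M x))) v"
      using hat_0[OF sa_lam_Hom[OF pure(1)]] by simp
    also have "\<dots> = L M x d"
      using hat_shifted[OF lH reg_Obj v] sv L_homogeneous[OF M dc pure(1)] by simp
    finally have cL: "mor (CC (gen_arr M ?k)) c = L M x d" .
    have pi: "sa (- i) pj1 \<bullet> sa (- i) in1 = Id A (shift (- i) Rm)"
      by (rule Hom_eqI[OF GrMod_Comp_Hom[OF iH sa_pj(1)] GrMod_Id_Hom[OF shift_Obj[OF reg_Obj]]])
        (simp add: mor_Comp[OF iH] mor_Id)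
    have p1: "mor (pr1 i) c = d"
    proof -
      have "mor (pr1 i) c = mor (Chat (- i) Rm (Id A (shift (- i) Rm))) v"
        using hat_after_C[OF iH sa_pj(1) v] by (simp add: pi c_def)
      also have "\<dots> = d"
        using v sv comult.F.farr_Id[OF shift_Obj[OF reg_Obj], of "- i"]
        by (simp add: hat_eq[OF GrMod_Id_Hom[OF shift_Obj[OF reg_Obj]]] mor_Id)
      finally show ?thesis .
    qed
    interpret T: graded_module R "M \<boxtimes> Db" using tns_Obj[OF M Db_bimod] by (simp add: GrMod_Obj)
    have "mor psi (mor phi (pu M Db x d)) = mor psi (mor (CC (gen_arr M ?k)) c)"
      using phi_pu[OF xc dc] cL by simp
    also have "\<dots> = mor (psi_gen ?k) c"
      using mor_Comp[OF C_Hom[OF gH] c, of psi] psi_gen_eq[OF k] by simp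
    also have "\<dots> = pu M Db x d"
      using psi_gen_mor[OF pure(1) M.deg_one c] p1 pu_one_left[OF M Db_bimod] hat_closed[OF sa_pj(2) c]
        pu_closed[OF M Db_bimod xc] dc by simp
    finally show ?case .
  qed
  show ?thesis by (rule GrMod_is_inverseI(2)[OF phi_Hom psi left right])
qed

end

end

section \<open>The coring and its comonad\<close>

context shift_setting
begin

definition theta :: "'u gmod \<Rightarrow> 'u garrow" where
  "theta M = inverse_arr A (phi M)"

lemma theta:
  assumes M: "M \<in> Obj A"
  shows theta_Hom: "theta M \<in> Hom A (C0 M) (M \<boxtimes> Db)"
    and theta_phi: "theta M \<bullet> phi M = Id A (M \<boxtimes> Db)"
    and phi_theta: "phi M \<bullet> theta M = Id A (C0 M)"
  unfolding theta_def using A.inverse_arr[OF phi_iso[OF M] phi_Hom[OF M]] by auto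

lemma theta_iso: "M \<in> Obj A \<Longrightarrow> is_iso A (theta M)"
  using theta[of M] phi_Hom[of M] by (auto simp: is_iso_def is_inverse_def A.Hom_iff intro!: exI[of _ "phi M"])

lemma tns_Obj': "M \<in> Obj A \<Longrightarrow> M \<boxtimes> Db \<in> Obj A"
  by (rule tns_Obj[OF _ Db_bimod])

lemma phi_inj: "M \<in> Obj A \<Longrightarrow> s \<in> carrier (M \<boxtimes> Db) \<Longrightarrow> t \<in> carrier (M \<boxtimes> Db) \<Longrightarrow>
    mor (phi M) s = mor (phi M) t \<Longrightarrow> s = t"
  using theta_phi[of M] by (metis mor_Comp[OF phi_Hom] mor_Id)

abbreviation "tarr f \<equiv> tensor_arr U R f Db Db (\<lambda>d. d)"

lemmas tarr_Hom = tensor_arr_Hom[OF _ Db_bimod Db_bimod bimod_map_id]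
lemmas tarr_pu = tensor_arr_pu[OF _ Db_bimod Db_bimod bimod_map_id, simplified]

lemma phi_natural:
  assumes f: "f \<in> Hom A M N"
  shows "CC f \<bullet> phi M = phi N \<bullet> tarr f"
proof -
  have M: "M \<in> Obj A" and N: "N \<in> Obj A" using Hom_objs[OF f] by auto
  note t = tarr_Hom[OF f]
  show ?thesis
    by (rule tns_Hom_eqI[OF M Db_bimod GrMod_Comp_Hom[OF phi_Hom[OF M] C_Hom[OF f]]
          GrMod_Comp_Hom[OF t phi_Hom[OF N]]])
      (simp add: mor_Comp[OF t] mor_Comp[OF phi_Hom[OF M]] pu_closed[OF M Db_bimod, simplified]
        phi_pu[OF M] phi_pu[OF N] tarr_pu[OF f] L_C[OF f] Hom_closed[OF f])
qed

definition Dl :: "'u garrow" where "Dl = theta D0 \<bullet> comult C Rm"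

lemma Dl_Hom: "Dl \<in> Hom A D0 (D0 \<boxtimes> Db)"
  unfolding Dl_def by (rule GrMod_Comp_Hom[OF Cd.comult_Hom[OF reg_Obj] theta_Hom[OF D0_Obj]])

lemma phi_Dl: "d \<in> carrier D0 \<Longrightarrow> mor (phi D0) (mor Dl d) = mor (comult C Rm) d"
proof -
  assume d: "d \<in> carrier D0"
  note c = Cd.comult_Hom[OF reg_Obj]
  have "phi D0 \<bullet> Dl = comult C Rm"
    unfolding Dl_def using A.Comp_assoc[OF c theta_Hom[OF D0_Obj] phi_Hom[OF D0_Obj]]
    by (simp add: phi_theta[OF D0_Obj] A.Id_Comp[OF c])
  then show ?thesis using mor_Comp[OF Dl_Hom d, of "phi D0"] by simp
qed

lemma DD_bimod: "bimod (Db \<boxtimes>\<boxtimes> Db)" by (rule tensor_bimod[OF Db_bimod Db_bimod])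

text \<open>The arrow of a homogeneous \<open>r\<close> commutes with the comultiplication of
  \<open>C\<close> by \<open>hat_comult\<close>. It remains to see the same action on the tensor
  product through the injective map \<open>phi D0\<close>.\<close>

lemma comult_left_linear: "is_left_linear R Db (Db \<boxtimes>\<boxtimes> Db) (mor Dl)"
  unfolding is_left_linear_def
proof (intro ballI, unfold Db_rmod)
  note DO = D0_Obj
  interpret DD: graded_bimodule R "Db \<boxtimes>\<boxtimes> Db" using DD_bimod by (simp add: bimod_def)
  fix r d assume r: "r \<in> carrier R" and d: "d \<in> carrier D0"
  have Dd: "mor Dl d \<in> carrier (D0 \<boxtimes> Db)" using Hom_closed[OF Dl_Hom d] .
  have "mor Dl (L Rm r d) = lact (Db \<boxtimes>\<boxtimes> Db) r (mor Dl d)"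
    using r
  proof (induction r rule: R.ring_graded_induct)
    case (add r s)
    then have "mor Dl (L Rm (r \<oplus>\<^bsub>R\<^esub> s) d) = mor Dl (L Rm r d) \<otimes>\<^bsub>D0 \<boxtimes> Db\<^esub> mor Dl (L Rm s d)"
      using d L_mult_left[OF reg_Obj, of r s d] L_closed[OF reg_Obj] Hom_mult[OF Dl_Hom] by simp
    then show ?case using add Dd by (simp add: DD.lact_add_left)
  next
    case (homogeneous i r)
    have rc: "r \<in> carrier R" using homogeneous by (rule R.rdeg_closed)
    have lH: "lam i Rm r \<in> Hom A Rm (shift i Rm)" using homogeneous by (auto intro: lam_Hom[OF reg_Obj])
    let ?g = "Chat i Rm (lam i Rm r)"
    have gH: "?g \<in> Hom A D0 (shift i D0)" by (rule Chat_Hom[OF lH])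
    have gL: "mor ?g e = L Rm r e" if "e \<in> carrier D0" for e
      using L_homogeneous[OF reg_Obj that, of r i] homogeneous by simp
    \<comment> \<open>The comparison map turns the action of \<open>r\<close> on the first tensor
      factor into the enriched functor applied twice to the arrow of \<open>r\<close>; on pure
      tensors this is \<open>L_natural\<close>.\<close>
    have "mor (phi D0) (lact (Db \<boxtimes>\<boxtimes> Db) r t) = mor (Chat i D0 ?g) (mor (phi D0) t)"
      if "t \<in> carrier (D0 \<boxtimes> Db)" for t
      using that
    proof (induction rule: tns_induct[OF DO Db_bimod, consumes 1, case_names pure mult])
      case (pure x e)
      then show ?case
        using rc tns_lact_pu[OF Db_bimod Db_bimod rc, of x e] phi_pu[OF DO, of "L Rm r x" e]
          phi_pu[OF DO, of x e] L_natural[OF DO gH, of x e] gL[of x] Db_lact[OF rc, of x]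
          hat_closed[OF lH, of x] by simp
    next
      case (mult s t)
      then show ?case
        using rc DD.lact_add_right[of r s t] DD.lact_closed[of r s] DD.lact_closed[of r t]
        by (simp add: Hom_mult[OF phi_Hom[OF DO]] hat_mult[OF gH] Hom_closed[OF phi_Hom[OF DO]])
    qed
    from this[OF Dd] have "mor (phi D0) (lact (Db \<boxtimes>\<boxtimes> Db) r (mor Dl d)) = mor (phi D0) (mor Dl (L Rm r d))"
      using hat_comult[OF lH d] gL[OF d] phi_Dl[OF d] phi_Dl[of "L Rm r d"] hat_closed[OF lH d] by simp
    from phi_inj[OF DO _ _ this] show ?case
      using DD.lact_closed[OF rc, of "mor Dl d"] Dd Hom_closed[OF Dl_Hom] hat_closed[OF lH d] gL[OF d] by simp
  qed
  then show "mor Dl (lact Db r d) = lact (Db \<boxtimes>\<boxtimes> Db) r (mor Dl d)"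
    using r d by (simp add: Db_lact)
qed

abbreviation "Ep \<equiv> counit C Rm"

lemma Ep_Hom: "Ep \<in> Hom A D0 Rm"
  by (rule Cd.counit_Hom[OF reg_Obj])

lemma counit_left_linear: "is_left_linear R Db (reg_bimod R) (mor Ep)"
  using L_counit[OF reg_Obj] by (simp add: is_left_linear_def Db_lact)

lemma Dl_bimod_map: "bimod_map Db (Db \<boxtimes>\<boxtimes> Db) (mor Dl)"
  using Dl_Hom comult_left_linear by (simp add: bimod_map_def GrMod_Hom)

lemma Ep_bimod_map: "bimod_map Db (reg_bimod R) (mor Ep)"
  using Ep_Hom counit_left_linear by (simp add: bimod_map_def GrMod_Hom)

abbreviation "TC \<equiv> tensor_comonad U R Db Dl Ep"
abbreviation "asc M \<equiv> associator U R M Db Db"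
abbreviation "idD M \<equiv> tensor_arr U R (Id A M) Db (Db \<boxtimes>\<boxtimes> Db) (mor Dl)"
abbreviation "idE M \<equiv> tensor_arr U R (Id A M) Db (reg_bimod R) (mor Ep)"

lemma TC_simps [simp]: "fobj TC M = M \<boxtimes> Db" "farr TC f = tarr f"
  "comult TC M = inverse_arr A (asc M) \<bullet> idD M" "counit TC M = right_unitor U R M \<bullet> idE M"
  by (simp_all add: tensor_comonad_def)

section \<open>Comparison of the counits and comultiplications\<close>

context
  fixes M
  assumes M: "M \<in> Obj A"
begin

lemma idD_Hom: "idD M \<in> Hom A (M \<boxtimes> Db) (M \<boxtimes> (Db \<boxtimes>\<boxtimes> Db))"
  by (rule tensor_arr_Hom[OF GrMod_Id_Hom[OF M] Db_bimod DD_bimod Dl_bimod_map])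

lemma idD_pu: "x \<in> carrier M \<Longrightarrow> d \<in> carrier D0 \<Longrightarrow>
    mor (idD M) (pu M Db x d) = pu M (Db \<boxtimes>\<boxtimes> Db) x (mor Dl d)"
  using tensor_arr_pu[OF GrMod_Id_Hom[OF M] Db_bimod DD_bimod Dl_bimod_map, of x d] by (simp add: mor_Id)

lemma idE_Hom: "idE M \<in> Hom A (M \<boxtimes> Db) (M \<boxtimes> reg_bimod R)"
  by (rule tensor_arr_Hom[OF GrMod_Id_Hom[OF M] Db_bimod reg_bimod Ep_bimod_map])

lemma idE_pu: "x \<in> carrier M \<Longrightarrow> d \<in> carrier D0 \<Longrightarrow>
    mor (idE M) (pu M Db x d) = pu M (reg_bimod R) x (mor Ep d)"
  using tensor_arr_pu[OF GrMod_Id_Hom[OF M] Db_bimod reg_bimod Ep_bimod_map, of x d] by (simp add: mor_Id)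

lemma asc_Hom: "asc M \<in> Hom A ((M \<boxtimes> Db) \<boxtimes> Db) (M \<boxtimes> (Db \<boxtimes>\<boxtimes> Db))"
  by (rule associator_Hom[OF M Db_bimod Db_bimod])

lemmas asc_inv = A.inverse_arr[OF associator_iso[OF M Db_bimod Db_bimod] asc_Hom]

lemma comult_TC_Hom: "comult TC M \<in> Hom A (M \<boxtimes> Db) ((M \<boxtimes> Db) \<boxtimes> Db)"
  unfolding TC_simps by (rule GrMod_Comp_Hom[OF idD_Hom asc_inv(1)])

lemma counit_TC_Hom: "counit TC M \<in> Hom A (M \<boxtimes> Db) M"
  unfolding TC_simps by (rule GrMod_Comp_Hom[OF idE_Hom right_unitor_Hom[OF M]])

text \<open>Both sides send \<open>x \<otimes> d\<close> to \<open>x\<close> acted on by the counit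
  of \<open>d\<close>, by \<open>L_counit\<close>.\<close>

lemma counit_TC: "counit TC M = counit C M \<bullet> phi M"
proof (rule tns_Hom_eqI[OF M Db_bimod counit_TC_Hom GrMod_Comp_Hom[OF phi_Hom[OF M] Cd.counit_Hom[OF M]]])
  fix x d assume x: "x \<in> carrier M" and d: "d \<in> carrier (rmod Db)"
  then have xd: "pu M Db x d \<in> carrier (M \<boxtimes> Db)" by (rule pu_closed[OF M Db_bimod])
  show "mor (counit TC M) (pu M Db x d) = mor (counit C M \<bullet> phi M) (pu M Db x d)"
    using x d Hom_closed[OF Ep_Hom, of d] xd
    by (simp add: mor_Comp[OF idE_Hom] idE_pu right_unitor_pu[OF M] mor_Comp[OF phi_Hom[OF M]]
        phi_pu[OF M] L_counit[OF M])
qed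

text \<open>The comultiplications agree on \<open>x \<otimes> d\<close> because both sides extend, from pure tensors
  \<open>u = d \<otimes> e\<close> to all \<open>u\<close> in \<open>D \<otimes> D\<close>, the iterated action of \<open>x\<close>.\<close>

lemma comult_TC: "CC (phi M) \<bullet> (phi (M \<boxtimes> Db) \<bullet> comult TC M) = comult C M \<bullet> phi M"
proof -
  note MT = tns_Obj'[OF M]
  let ?a = "inverse_arr A (asc M)"
  note ph = phi_Hom[OF M] and pT = phi_Hom[OF MT] and cph = C_Hom[OF phi_Hom[OF M]]
  note lhs = GrMod_Comp_Hom[OF GrMod_Comp_Hom[OF comult_TC_Hom pT] cph]
  note rhs = GrMod_Comp_Hom[OF ph Cd.comult_Hom[OF M]]
  interpret M: graded_module R M using M by (simp add: GrMod_Obj)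
  interpret D0: graded_module R D0 using D0_Obj by (simp add: GrMod_Obj)
  show ?thesis
  proof (rule Hom_eqI[OF lhs rhs])
    fix t assume "t \<in> carrier (M \<boxtimes> Db)"
    then show "mor (CC (phi M) \<bullet> (phi (M \<boxtimes> Db) \<bullet> comult TC M)) t = mor (comult C M \<bullet> phi M) t"
    proof (induction rule: tns_induct_homogeneous[OF M Db_bimod, consumes 1, case_names pure mult])
      case (mult s t)
      then show ?case by (simp only: Hom_mult[OF lhs] Hom_mult[OF rhs])
    next
      case (pure x d i j)
      have xc: "x \<in> carrier M" using pure(1) by (rule M.deg_closed)
      have dc: "d \<in> carrier D0" using pure(2) D0.deg_closed by simp
      have lH: "lam i M x \<in> Hom A Rm (shift i M)" by (rule lam_Hom[OF M pure(1)])
      let ?g = "Chat i M (lam i M x)"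
      have gH: "?g \<in> Hom A D0 (shift i (C0 M))" by (rule Chat_Hom[OF lH])
      have gL: "mor ?g e = L M x e" if "e \<in> carrier D0" for e
        using L_homogeneous[OF M that pure(1)] by simp
      have puD: "pu M (Db \<boxtimes>\<boxtimes> Db) x u \<in> carrier (M \<boxtimes> (Db \<boxtimes>\<boxtimes> Db))" if "u \<in> carrier (D0 \<boxtimes> Db)" for u
        using pu_closed[OF M DD_bimod xc, of u] that by simp
      have key: "mor (CC (phi M)) (mor (phi (M \<boxtimes> Db)) (mor ?a (pu M (Db \<boxtimes>\<boxtimes> Db) x u))) =
          mor (Chat i (C0 M) ?g) (mor (phi D0) u)" if "u \<in> carrier (D0 \<boxtimes> Db)" for u
        using that
      proof (induction rule: tns_induct[OF D0_Obj Db_bimod, consumes 1, case_names pure mult])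
        case (pure e e')
        then have e: "e \<in> carrier D0" "e' \<in> carrier D0" by simp_all
        have xe: "pu M Db x e \<in> carrier (M \<boxtimes> Db)" using pu_closed[OF M Db_bimod xc] e by simp
        have "mor ?a (pu M (Db \<boxtimes>\<boxtimes> Db) x (pu D0 Db e e')) = pu (M \<boxtimes> Db) Db (pu M Db x e) e'"
          using inverse_associator_pu[OF M Db_bimod Db_bimod xc, of e e'] e by simp
        then have "mor (CC (phi M)) (mor (phi (M \<boxtimes> Db)) (mor ?a (pu M (Db \<boxtimes>\<boxtimes> Db) x (pu D0 Db e e')))) =
            L (C0 M) (L M x e) e'"
          using phi_pu[OF MT xe e(2)] L_C[OF ph xe e(2)] phi_pu[OF M xc e(1)] by simp
        also have "\<dots> = mor (Chat i (C0 M) ?g) (mor (phi D0) (pu D0 Db e e'))"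
          using phi_pu[OF D0_Obj e] L_natural[OF D0_Obj gH e] gL[OF e(1)] by simp
        finally show ?case .
      next
        case (mult s t)
        have "pu M (Db \<boxtimes>\<boxtimes> Db) x (s \<otimes>\<^bsub>D0 \<boxtimes> Db\<^esub> t) =
            pu M (Db \<boxtimes>\<boxtimes> Db) x s \<otimes>\<^bsub>M \<boxtimes> (Db \<boxtimes>\<boxtimes> Db)\<^esub> pu M (Db \<boxtimes>\<boxtimes> Db) x t"
          using pu_mult_right[OF M DD_bimod xc, of s t] mult by simp
        then show ?case
          using mult puD
          by (simp add: Hom_mult[OF asc_inv(1)] Hom_mult[OF pT] Hom_mult[OF cph] Hom_closed[OF asc_inv(1)]
              Hom_closed[OF pT] Hom_mult[OF phi_Hom[OF D0_Obj]] hat_mult[OF gH] Hom_closed[OF phi_Hom[OF D0_Obj]])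
      qed
      have t: "pu M Db x d \<in> carrier (M \<boxtimes> Db)" using pu_closed[OF M Db_bimod xc] dc by simp
      have "mor (CC (phi M) \<bullet> (phi (M \<boxtimes> Db) \<bullet> comult TC M)) (pu M Db x d) =
          mor (CC (phi M)) (mor (phi (M \<boxtimes> Db)) (mor (comult TC M) (pu M Db x d)))"
        by (simp only: mor_Comp[OF GrMod_Comp_Hom[OF comult_TC_Hom pT] t] mor_Comp[OF comult_TC_Hom t])
      also have "mor (comult TC M) (pu M Db x d) = mor ?a (pu M (Db \<boxtimes>\<boxtimes> Db) x (mor Dl d))"
        using mor_Comp[OF idD_Hom t] by (simp add: idD_pu[OF xc dc])
      also have "mor (CC (phi M)) (mor (phi (M \<boxtimes> Db)) \<dots>) = mor (Chat i (C0 M) ?g) (mor (comult C Rm) d)"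
        using key[OF Hom_closed[OF Dl_Hom dc]] phi_Dl[OF dc] by simp
      also have "\<dots> = mor (comult C M) (L M x d)"
        using hat_comult[OF lH dc] gL[OF dc] by simp
      also have "\<dots> = mor (comult C M \<bullet> phi M) (pu M Db x d)"
        by (simp add: mor_Comp[OF ph t] phi_pu[OF M xc dc])
      finally show ?case .
    qed
  qed
qed

end

lemma TC_functor: "cat_functor A A TC"
proof (intro cat_functor.intro cat_functor_axioms.intro A.category_axioms, unfold TC_simps)
  show "M \<in> Obj A \<Longrightarrow> M \<boxtimes> Db \<in> Obj A" for M by (rule tns_Obj')
  show "f \<in> Hom A M N \<Longrightarrow> tarr f \<in> Hom A (M \<boxtimes> Db) (N \<boxtimes> Db)" for f M N by (rule tarr_Hom)
  show "tarr (Id A M) = Id A (M \<boxtimes> Db)" if M: "M \<in> Obj A" for M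
    by (rule tns_Hom_eqI[OF M Db_bimod tarr_Hom[OF GrMod_Id_Hom[OF M]] GrMod_Id_Hom[OF tns_Obj'[OF M]]])
      (simp add: tarr_pu[OF GrMod_Id_Hom[OF M]] mor_Id pu_closed[OF M Db_bimod, simplified])
  show "tarr (g \<bullet> f) = tarr g \<bullet> tarr f" if f: "f \<in> Hom A M N" and g: "g \<in> Hom A N K" for f g M N K
  proof -
    note gf = GrMod_Comp_Hom[OF f g]
    have M: "M \<in> Obj A" using Hom_source[OF f] .
    show ?thesis
      by (rule tns_Hom_eqI[OF M Db_bimod tarr_Hom[OF gf] GrMod_Comp_Hom[OF tarr_Hom[OF f] tarr_Hom[OF g]]])
        (simp add: tarr_pu[OF gf] tarr_pu[OF f] tarr_pu[OF g] mor_Comp[OF tarr_Hom[OF f]] mor_Comp[OF f]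
          Hom_closed[OF f] pu_closed[OF M Db_bimod, simplified])
  qed
qed

lemma TC_data: "comonad_data A TC"
  using comult_TC_Hom counit_TC_Hom
  by (intro comonad_data.intro comonad_data_axioms.intro A.category_axioms TC_functor) auto

lemma theta_nat_iso: "nat_iso A A C TC theta"
proof (intro nat_iso.intro nat_trans.intro nat_trans_axioms.intro nat_iso_axioms.intro
    comult.F.cat_functor_axioms TC_functor theta_iso, unfold TC_simps)
  show "M \<in> Obj A \<Longrightarrow> theta M \<in> Hom A (C0 M) (M \<boxtimes> Db)" for M by (rule theta_Hom)
  fix f M N assume f: "f \<in> Hom A M N"
  have M: "M \<in> Obj A" and N: "N \<in> Obj A" using Hom_objs[OF f] by auto
  have s: "theta M \<in> Arr A" "Dom A (theta M) = C0 M" "Cod A (theta M) = M \<boxtimes> Db"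
    "theta N \<in> Arr A" "Dom A (theta N) = C0 N" "Cod A (theta N) = N \<boxtimes> Db"
    "phi M \<in> Arr A" "Dom A (phi M) = M \<boxtimes> Db" "Cod A (phi M) = C0 M"
    "phi N \<in> Arr A" "Dom A (phi N) = N \<boxtimes> Db" "Cod A (phi N) = C0 N"
    "CC f \<in> Arr A" "Dom A (CC f) = C0 M" "Cod A (CC f) = C0 N"
    "tarr f \<in> Arr A" "Dom A (tarr f) = M \<boxtimes> Db" "Cod A (tarr f) = N \<boxtimes> Db"
    using theta_Hom[OF M] theta_Hom[OF N] phi_Hom[OF M] phi_Hom[OF N] C_Hom[OF f] tarr_Hom[OF f]
    by (auto simp: A.Hom_iff)
  have "theta N \<bullet> CC f = theta N \<bullet> (CC f \<bullet> (phi M \<bullet> theta M))"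
    using s by (simp add: phi_theta[OF M])
  also have "\<dots> = theta N \<bullet> (phi N \<bullet> (tarr f \<bullet> theta M))"
    using s A.comp_extend[OF phi_natural[OF f], of "theta M"] by simp
  also have "\<dots> = tarr f \<bullet> theta M"
    using s A.comp_extend'[OF theta_phi[OF N], of "tarr f \<bullet> theta M"] by simp
  finally show "theta N \<bullet> CC f = tarr f \<bullet> theta M" .
qed

text \<open>The identities \<open>counit_TC\<close> and \<open>comult_TC\<close> are stated for
  \<open>phi\<close>; conjugation by its inverse gives the compatibilities for
  \<open>theta\<close>.\<close>

lemma TC_transport: "comonad_transport A C TC theta"
proof (intro comonad_transport.intro comonad_transport_axioms.intro A.category_axioms is_comonad_axioms
    TC_data theta_nat_iso)
  fix M assume M: "M \<in> Obj A"
  note MT = tns_Obj'[OF M] and CM = C0_Obj[OF M]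
  have s: "theta M \<in> Arr A" "Dom A (theta M) = C0 M" "Cod A (theta M) = M \<boxtimes> Db"
    "phi M \<in> Arr A" "Dom A (phi M) = M \<boxtimes> Db" "Cod A (phi M) = C0 M"
    "theta (C0 M) \<in> Arr A" "Dom A (theta (C0 M)) = C0 (C0 M)" "Cod A (theta (C0 M)) = C0 M \<boxtimes> Db"
    "phi (C0 M) \<in> Arr A" "Dom A (phi (C0 M)) = C0 M \<boxtimes> Db" "Cod A (phi (C0 M)) = C0 (C0 M)"
    "phi (M \<boxtimes> Db) \<in> Arr A" "Dom A (phi (M \<boxtimes> Db)) = (M \<boxtimes> Db) \<boxtimes> Db" "Cod A (phi (M \<boxtimes> Db)) = C0 (M \<boxtimes> Db)"
    "tarr (phi M) \<in> Arr A" "Dom A (tarr (phi M)) = (M \<boxtimes> Db) \<boxtimes> Db" "Cod A (tarr (phi M)) = C0 M \<boxtimes> Db"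
    "tarr (theta M) \<in> Arr A" "Dom A (tarr (theta M)) = C0 M \<boxtimes> Db" "Cod A (tarr (theta M)) = (M \<boxtimes> Db) \<boxtimes> Db"
    "comult TC M \<in> Arr A" "Dom A (comult TC M) = M \<boxtimes> Db" "Cod A (comult TC M) = (M \<boxtimes> Db) \<boxtimes> Db"
    using theta_Hom[OF M] phi_Hom[OF M] theta_Hom[OF CM] phi_Hom[OF CM] phi_Hom[OF MT]
      tarr_Hom[OF phi_Hom[OF M]] tarr_Hom[OF theta_Hom[OF M]] comult_TC_Hom[OF M]
    by (auto simp: A.Hom_iff simp del: TC_simps)
  have "counit TC M \<bullet> theta M = counit C M \<bullet> (phi M \<bullet> theta M)"
    unfolding counit_TC[OF M] using s M by simp
  then show "counit TC M \<bullet> theta M = counit C M"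
    using M by (simp add: phi_theta[OF M] del: TC_simps)
  let ?d = "comult TC M" and ?c = "comult C M"
  interpret T: cat_functor A A TC by (rule TC_functor)
  have tt: "tarr (theta M) \<bullet> tarr (phi M) = Id A ((M \<boxtimes> Db) \<boxtimes> Db)"
    using T.farr_Comp[OF phi_Hom[OF M] theta_Hom[OF M]] T.farr_Id[OF MT] by (simp add: theta_phi[OF M])
  \<comment> \<open>Solves \<open>comult_TC\<close> for the comultiplication of \<open>C\<close>,
    moving the outer comparison map inside by its naturality.\<close>
  have "?c = ?c \<bullet> (phi M \<bullet> theta M)"
    using M by (simp add: phi_theta[OF M])
  also have "\<dots> = (CC (phi M) \<bullet> (phi (M \<boxtimes> Db) \<bullet> ?d)) \<bullet> theta M"
    unfolding comult_TC[OF M] using s M by simp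
  also have "\<dots> = phi (C0 M) \<bullet> (tarr (phi M) \<bullet> (?d \<bullet> theta M))"
    using s M A.comp_extend[OF phi_natural[OF phi_Hom[OF M]], of "?d \<bullet> theta M"]
    by (simp del: TC_simps)
  finally have c: "?c = phi (C0 M) \<bullet> (tarr (phi M) \<bullet> (?d \<bullet> theta M))" .
  have "farr TC (theta M) \<bullet> (theta (C0 M) \<bullet> ?c) =
      tarr (theta M) \<bullet> (theta (C0 M) \<bullet> (phi (C0 M) \<bullet> (tarr (phi M) \<bullet> (?d \<bullet> theta M))))"
    by (subst c) simp
  also have "\<dots> = tarr (theta M) \<bullet> (tarr (phi M) \<bullet> (?d \<bullet> theta M))"
    using s A.comp_extend'[OF theta_phi[OF CM], of "tarr (phi M) \<bullet> (?d \<bullet> theta M)"] by (simp del: TC_simps)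
  also have "\<dots> = ?d \<bullet> theta M"
    using s A.comp_extend'[OF tt, of "?d \<bullet> theta M"] by (simp del: TC_simps)
  finally show "?d \<bullet> theta M = farr TC (theta M) \<bullet> (theta (C0 M) \<bullet> ?c)" by simp
qed

text \<open>The coring version states coassociativity after the associator, the comonad version has
  its inverse on the other side. Both counit conditions are the same composite up to
  bracketing.\<close>

lemma coring_comodule_iff: "is_coring_comodule U R Db Dl Ep X \<longleftrightarrow> is_comodule A TC X"
proof -
  obtain M \<rho> where X: "X = (M, \<rho>)" by (cases X)
  have "asc M \<bullet> (tarr \<rho> \<bullet> \<rho>) = idD M \<bullet> \<rho> \<longleftrightarrow> tarr \<rho> \<bullet> \<rho> = comult TC M \<bullet> \<rho>"
    "right_unitor U R M \<bullet> (idE M \<bullet> \<rho>) = counit TC M \<bullet> \<rho>"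
    if M: "M \<in> Obj A" and \<rho>: "\<rho> \<in> Hom A M (M \<boxtimes> Db)"
  proof -
    let ?a = "asc M" and ?i = "inverse_arr A (asc M)"
    have s: "?a \<in> Arr A" "Dom A ?a = (M \<boxtimes> Db) \<boxtimes> Db" "Cod A ?a = M \<boxtimes> (Db \<boxtimes>\<boxtimes> Db)"
      "?i \<in> Arr A" "Dom A ?i = M \<boxtimes> (Db \<boxtimes>\<boxtimes> Db)" "Cod A ?i = (M \<boxtimes> Db) \<boxtimes> Db"
      "idD M \<in> Arr A" "Dom A (idD M) = M \<boxtimes> Db" "Cod A (idD M) = M \<boxtimes> (Db \<boxtimes>\<boxtimes> Db)"
      "idE M \<in> Arr A" "Dom A (idE M) = M \<boxtimes> Db" "Cod A (idE M) = M \<boxtimes> reg_bimod R"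
      "right_unitor U R M \<in> Arr A" "Dom A (right_unitor U R M) = M \<boxtimes> reg_bimod R"
      "\<rho> \<in> Arr A" "Dom A \<rho> = M" "Cod A \<rho> = M \<boxtimes> Db"
      "tarr \<rho> \<in> Arr A" "Dom A (tarr \<rho>) = M \<boxtimes> Db" "Cod A (tarr \<rho>) = (M \<boxtimes> Db) \<boxtimes> Db"
      using asc_Hom[OF M] asc_inv(1)[OF M] idD_Hom[OF M] idE_Hom[OF M] right_unitor_Hom[OF M] \<rho> tarr_Hom[OF \<rho>]
      by (auto simp: A.Hom_iff)
    have ai: "?i \<bullet> (?a \<bullet> u) = u" if "u \<in> Arr A" "Cod A u = (M \<boxtimes> Db) \<boxtimes> Db" for u
      using A.comp_extend'[OF asc_inv(2)[OF M], of u] s that by simp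
    have ia: "?a \<bullet> (?i \<bullet> u) = u" if "u \<in> Arr A" "Cod A u = M \<boxtimes> (Db \<boxtimes>\<boxtimes> Db)" for u
      using A.comp_extend'[OF asc_inv(3)[OF M], of u] s that by simp
    have "comult TC M \<bullet> \<rho> = ?i \<bullet> (idD M \<bullet> \<rho>)" using s by simp
    then show "?a \<bullet> (tarr \<rho> \<bullet> \<rho>) = idD M \<bullet> \<rho> \<longleftrightarrow> tarr \<rho> \<bullet> \<rho> = comult TC M \<bullet> \<rho>"
    proof -
      assume c: "comult TC M \<bullet> \<rho> = ?i \<bullet> (idD M \<bullet> \<rho>)"
      have "?i \<bullet> (?a \<bullet> (tarr \<rho> \<bullet> \<rho>)) = tarr \<rho> \<bullet> \<rho>" "?a \<bullet> (?i \<bullet> (idD M \<bullet> \<rho>)) = idD M \<bullet> \<rho>"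
        using s by (intro ai ia; simp)+
      then show ?thesis unfolding c by metis
    qed
    show "right_unitor U R M \<bullet> (idE M \<bullet> \<rho>) = counit TC M \<bullet> \<rho>" using s by simp
  qed
  then show ?thesis
    unfolding X is_coring_comodule_def is_comodule_def
    by (auto simp del: TC_simps(3,4))
qed

lemma CoringComod_eq: "CoringComod U R Db Dl Ep = Comod A TC"
  by (simp add: CoringComod_def Comod_def coring_comodule_iff)

text \<open>C(R) with the comultiplication at R is the cofree comodule over \<open>C\<close> on R,
  and \<open>Dl\<close> is by definition its coaction pushed forward along
  \<open>theta\<close>.\<close>

lemma comodule_R: "is_coring_comodule U R Db Dl Ep (D0, Dl)"
proof -
  interpret comonad_transport A C TC theta by (rule TC_transport)
  have "is_comodule A C (D0, comult C Rm)"
    using reg_Obj comult_coassoc[OF reg_Obj] counit_left[OF reg_Obj] Cd.comult_Hom[OF reg_Obj]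
    by (simp add: is_comodule_def D0_Obj)
  from comodule_forward[OF this] show ?thesis
    by (simp only: coring_comodule_iff Dl_def[symmetric])
qed

lemma left_unitor_phi: "left_unitor U R Db = phi Rm"
proof (rule tns_Hom_eqI[OF reg_Obj Db_bimod])
  show "left_unitor U R Db \<in> Hom A (Rm \<boxtimes> Db) D0"
    using left_unitor_Hom[OF Db_bimod] by simp
  show "phi Rm \<in> Hom A (Rm \<boxtimes> Db) D0" by (rule phi_Hom[OF reg_Obj])
  show "mor (left_unitor U R Db) (pu Rm Db r d) = mor (phi Rm) (pu Rm Db r d)"
    if "r \<in> carrier Rm" "d \<in> carrier (rmod Db)" for r d
    using that left_unitor_pu[OF Db_bimod, of r d] phi_pu[OF reg_Obj, of r d] by (simp add: Db_lact)
qed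

text \<open>Coassociativity and the right counit law are the comodule laws of
  \<open>comodule_R\<close>, the latter coming from the left counit law of \<open>C\<close>. The
  left counit law of the coring comes, through naturality of \<open>phi\<close> at the counit, from
  the right counit law of \<open>C\<close>.\<close>

lemma coring: "graded_coring U R Db Dl Ep"
proof (intro graded_coring.intro graded_coring_axioms.intro, unfold Db_rmod)
  show "graded_bimodule R Db" "carrier D0 \<in> U" using Db_bimod by (simp_all add: bimod_def)
  show "Dl \<in> Hom A D0 (D0 \<boxtimes> Db)" "Ep \<in> Hom A D0 Rm" by (rule Dl_Hom Ep_Hom)+
  show "is_left_linear R Db (Db \<boxtimes>\<boxtimes> Db) (mor Dl)" "is_left_linear R Db (reg_bimod R) (mor Ep)"
    by (rule comult_left_linear counit_left_linear)+
  show "asc D0 \<bullet> (tarr Dl \<bullet> Dl) = idD D0 \<bullet> Dl" "right_unitor U R D0 \<bullet> (idE D0 \<bullet> Dl) = Id A D0"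
    using comodule_R by (simp_all add: is_coring_comodule_def)
  have s: "Dl \<in> Arr A" "Dom A Dl = D0" "Cod A Dl = D0 \<boxtimes> Db"
    "tarr Ep \<in> Arr A" "Dom A (tarr Ep) = D0 \<boxtimes> Db" "Cod A (tarr Ep) = Rm \<boxtimes> Db"
    "phi Rm \<in> Arr A" "Dom A (phi Rm) = Rm \<boxtimes> Db" "CC Ep \<in> Arr A" "Dom A (CC Ep) = C0 D0"
    "phi D0 \<in> Arr A" "Dom A (phi D0) = D0 \<boxtimes> Db" "Cod A (phi D0) = C0 D0"
    using Dl_Hom tarr_Hom[OF Ep_Hom] phi_Hom[OF reg_Obj] C_Hom[OF Ep_Hom] phi_Hom[OF D0_Obj]
    by (auto simp: A.Hom_iff)
  have "phi D0 \<bullet> Dl = comult C Rm"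
    by (rule Hom_eqI[OF GrMod_Comp_Hom[OF Dl_Hom phi_Hom[OF D0_Obj]] Cd.comult_Hom[OF reg_Obj]])
      (simp add: mor_Comp[OF Dl_Hom] phi_Dl)
  then have "left_unitor U R Db \<bullet> (tarr Ep \<bullet> Dl) = CC Ep \<bullet> comult C Rm"
    using A.comp_extend[OF phi_natural[OF Ep_Hom], of Dl] s by (simp add: left_unitor_phi)
  then show "left_unitor U R Db \<bullet> (tarr Ep \<bullet> Dl) = Id A D0"
    using counit_right[OF reg_Obj] by simp
qed

end

theorem theorem3p1p5:
  fixes U :: "'u set set" and R :: "'u gring"
    and C :: "('u gmod, 'u garrow) comonad" and \<sigma> :: "'u gmod \<Rightarrow> 'u garrow"
  assumes "small_universe U"
    and "graded_ring R"
    and "carrier R \<in> U"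
    and "is_comonad (GrMod U R) C"
    and "preserves_colimits U (GrMod U R) (GrMod U R) C"
    and "shift_preserving U R C \<sigma>"
  shows "\<exists>\<theta>.
    let D = value_bimod U R C \<sigma>;
        \<Delta> = \<theta> (fobj C (reg_mod R)) \<bullet>\<^bsub>GrMod U R\<^esub> comult C (reg_mod R);
        \<epsilon> = counit C (reg_mod R)
    in graded_coring U R D \<Delta> \<epsilon> \<and>
       comonad_iso (GrMod U R) C (tensor_comonad U R D \<Delta> \<epsilon>) \<theta> \<and>
       equivalent_categories (Comod (GrMod U R) C) (CoringComod U R D \<Delta> \<epsilon>)"
proof -
  interpret shift_setting U R C \<sigma>
    using assms by (simp add: shift_setting_def shift_setting_axioms_def graded_setting_def
        graded_setting_axioms_def)
  interpret comonad_transport A C TC theta by (rule TC_transport)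
  show ?thesis
    unfolding Let_def
    using coring T_comonad_iso comodules_equivalent CoringComod_eq
    by (intro exI[of _ theta]) (simp add: Dl_def)
qed

end
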